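(* There is a positively $1$-homogeneous and even function $f:\mathbb{R}^{2\times2}\to\mathbb{R}$, belonging to $C^\infty(\mathbb{R}^{2\times2}\setminus\{0\})$ and fulfilling every condition in the list (a)–(g) of the context (with $n=d=2$) except condition (e), such that there is a function $u_0\in C^\infty(\partial B_1(0),\mathbb{R}^2)$ which is not identically $0$ and such that $u=0$ is a minimizer of the problem $$\min_{w\in BV(\Omega,\mathbb{R}^2)}\int_\Omega f(\mathrm{D}^aw(x))\,\mathrm{d}x+\int_\Omega f^\infty\Big(\tfrac{\mathrm{d}\mathrm{D}^sw}{\mathrm{d}|\mathrm{D}^sw|}(x)\Big)\,\mathrm{d}|\mathrm{D}^sw|(x)+\int_{\partial\Omega}f^\infty((u_0-w)(x)\otimes\nu_x)\,\mathrm{d}\mathcal{H}^{1}(x)$$ on $\Omega=B_1(0)\subset\mathbb{R}^2$. In particular, for this data, $u\neq u_0$ on a subset of $\partial B_1(0)$ of positive $\mathcal{H}^1$-measure.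
   Context: Notation. $BV(\Omega,\mathbb{R}^n)$ is the space of $w\in L^1(\Omega,\mathbb{R}^n)$ whose distributional gradient $\mathrm{D}w$ is a bounded $\mathbb{R}^{n\times d}$-valued Radon measure; $\mathrm{D}w=\mathrm{D}^aw\,\mathcal{L}^d+\mathrm{D}^sw$ with $\mathrm{D}^aw$ the density of the absolutely continuous part and $\mathrm{D}^sw$ the singular part. Boundary values are meant in the trace sense. $\nu_x$ is the outer unit normal at $x\in\partial\Omega$. The recession function is $f^\infty(\xi)=\lim_{t\to+\infty}\frac1tf(t\xi)$ (so $f^\infty=f$ for positively $1$-homogeneous $f$). List of conditions on $f:\mathbb{R}^{n\times d}\to\mathbb{R}$: (a) $f$ is convex. (b) There is $C_1>0$ with $\frac1{C_1}|\xi|-C_1\le f(\xi)\le C_1(|\xi|+1)$ for all $\xi$. (c) There is $R>0$ such that $f\in C^2(\mathbb{R}^{n\times d}\setminus B_R(0))\cap C^1(\mathbb{R}^{n\times d}\setminus\{0\})$ and $\sup_{\xi:|\xi|\ge|a|}|\xi|\int_{|\xi|}^\infty\big\langle\mathrm{D}^2_\xi f(s\tfrac{\xi}{|\xi|})\tfrac{\xi}{|\xi|},\tfrac{\xi}{|\xi|}\big\rangle\,\mathrm{d}s\to0$ as $|a|\to+\infty$. (d) $f^\infty\in C^2(\mathbb{R}^{n\times d}\setminus\{0\})$. (e) There are positively $0$-homogeneous and odd functions $\mu_1:\mathbb{R}^n\setminus\{0\}\to\mathbb{R}^n$, $\mu_2:\mathbb{R}^d\setminus\{0\}\to\mathbb{R}^d$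 with $\mathrm{D}_\xi f^\infty(v_1\otimes v_2)=\mu_1(v_1)\otimes\mu_2(v_2)$ for all $v_1,v_2\ne0$. (f) There is $C_2>0$ such that $\mathrm{D}^2_\xi((f^\infty)^2)(\xi)\ge C_2\,\mathrm{Id}$ in the sense of positive definiteness for all $\xi\ne0$. (g) If for some $\xi\neq0$ there is a $\xi'$ with $\mathrm{D}_\xi f^\infty(\xi')=\mathrm{D}_\xi f(\xi)$, then $\mathrm{D}_\xi f^\infty(\xi')=\mathrm{D}_\xi f^\infty(\xi)$. *)

theory Defs
  imports "HOL-Analysis.Analysis" "HOL-Library.Extended_Nat"
begin

section \<open>Differentiability classes\<close>

primrec cont_diff_open ::
    "nat \<Rightarrow> 'a::euclidean_space set \<Rightarrow> ('a \<Rightarrow> 'b::real_normed_vector) \<Rightarrow> bool" where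
  "cont_diff_open 0 U f \<longleftrightarrow> continuous_on U f"
| "cont_diff_open (Suc k) U f \<longleftrightarrow>
     (\<forall>x\<in>U. f differentiable (at x)) \<and>
     (\<forall>v. cont_diff_open k U (\<lambda>x. frechet_derivative f (at x) v))"

text \<open>The class \<open>C\<^sup>k(S)\<close>, \<open>k \<le> \<infinity>\<close>. On a set that is not open (a closed set, a submanifold
  such as the unit circle) it means, as usual, the existence of a \<open>C\<^sup>k\<close> extension to a
  neighbourhood. On an open set it is ordinary \<open>k\<close>-fold continuous differentiability.\<close>

definition C_on :: "enat \<Rightarrow> 'a::euclidean_space set \<Rightarrow> ('a \<Rightarrow> 'b::real_normed_vector) \<Rightarrow> bool" where
  "C_on k S f \<longleftrightarrow> (\<exists>U g. open U \<and> S \<subseteq> U \<and> (\<forall>x\<in>S. g x = f x) \<and>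
     (\<forall>m. enat m \<le> k \<longrightarrow> cont_diff_open m U g))"

definition grad :: "('a::euclidean_space \<Rightarrow> real) \<Rightarrow> 'a \<Rightarrow> 'a" where
  "grad f x = (THE D. GDERIV f x :> D)"

definition hessian :: "('a::euclidean_space \<Rightarrow> real) \<Rightarrow> 'a \<Rightarrow> 'a \<Rightarrow> 'a" where
  "hessian f x h = frechet_derivative (grad f) (at x) h"

definition divergence :: "(real^'d \<Rightarrow> real^'d) \<Rightarrow> real^'d \<Rightarrow> real" where
  "divergence \<phi> x = (\<Sum>j\<in>UNIV. frechet_derivative \<phi> (at x) (axis j 1) $ j)"


section \<open>The integrand\<close>

text \<open>The \<open>n \<times> d\<close> matrices are \<open>real^'d^'n\<close>; their inner product and norm in the library are the
  Frobenius ones.\<close>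

definition tensor :: "real^'n \<Rightarrow> real^'d \<Rightarrow> real^'d^'n" (infixl \<open>\<otimes>\<^sub>v\<close> 75) where
  "v \<otimes>\<^sub>v w = (\<chi> i j. v $ i * w $ j)"

definition recession :: "('a::real_normed_vector \<Rightarrow> real) \<Rightarrow> 'a \<Rightarrow> real" where
  "recession f \<xi> = Lim at_top (\<lambda>t::real. f (t *\<^sub>R \<xi>) / t)"

definition pos_homogeneous1 :: "('a::real_vector \<Rightarrow> real) \<Rightarrow> bool" where
  "pos_homogeneous1 f \<longleftrightarrow> (\<forall>t>0. \<forall>\<xi>. f (t *\<^sub>R \<xi>) = t * f \<xi>)"

definition pos_homogeneous0_odd :: "('a::real_vector \<Rightarrow> 'a) \<Rightarrow> bool" where
  "pos_homogeneous0_odd \<mu> \<longleftrightarrow>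
     (\<forall>v. v \<noteq> 0 \<longrightarrow> (\<forall>t>0. \<mu> (t *\<^sub>R v) = \<mu> v) \<and> \<mu> (- v) = - \<mu> v)"

definition cond_a :: "(real^'d^'n \<Rightarrow> real) \<Rightarrow> bool" where
  "cond_a f \<longleftrightarrow> convex_on UNIV f"

definition cond_b :: "(real^'d^'n \<Rightarrow> real) \<Rightarrow> bool" where
  "cond_b f \<longleftrightarrow> (\<exists>C1>0. \<forall>\<xi>. 1 / C1 * norm \<xi> - C1 \<le> f \<xi> \<and> f \<xi> \<le> C1 * (norm \<xi> + 1))"

text \<open>The integrability clause is there because the library assigns the value \<open>0\<close> to the integral
  of a non-integrable function.\<close>

definition cond_c :: "(real^'d^'n \<Rightarrow> real) \<Rightarrow> bool" where
  "cond_c f \<longleftrightarrow>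
     (\<exists>R>0. C_on 2 (- ball 0 R) f \<and> C_on 1 (- {0}) f) \<and>
     (\<forall>\<^sub>F \<xi> in at_infinity. set_integrable lborel {norm \<xi>..}
        (\<lambda>s. hessian f (s *\<^sub>R sgn \<xi>) (sgn \<xi>) \<bullet> sgn \<xi>)) \<and>
     ((\<lambda>a. SUP \<xi>\<in>{\<xi>. norm a \<le> norm \<xi>}. ereal (norm \<xi> *
         (LINT s:{norm \<xi>..}|lborel. hessian f (s *\<^sub>R sgn \<xi>) (sgn \<xi>) \<bullet> sgn \<xi>)))
       \<longlongrightarrow> 0) (at_infinity :: (real^'d^'n) filter)"

definition cond_d :: "(real^'d^'n \<Rightarrow> real) \<Rightarrow> bool" where
  "cond_d f \<longleftrightarrow> C_on 2 (- {0}) (recession f)"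

definition cond_e :: "(real^'d^'n \<Rightarrow> real) \<Rightarrow> bool" where
  "cond_e f \<longleftrightarrow> (\<exists>\<mu>1 \<mu>2. pos_homogeneous0_odd \<mu>1 \<and> pos_homogeneous0_odd \<mu>2 \<and>
     (\<forall>v1 v2. v1 \<noteq> 0 \<and> v2 \<noteq> 0 \<longrightarrow> grad (recession f) (v1 \<otimes>\<^sub>v v2) = \<mu>1 v1 \<otimes>\<^sub>v \<mu>2 v2))"

definition cond_f :: "(real^'d^'n \<Rightarrow> real) \<Rightarrow> bool" where
  "cond_f f \<longleftrightarrow> (\<exists>C2>0. \<forall>\<xi>. \<xi> \<noteq> 0 \<longrightarrow>
     (\<forall>h. hessian (\<lambda>\<eta>. (recession f \<eta>)\<^sup>2) \<xi> h \<bullet> h \<ge> C2 * (h \<bullet> h)))"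

text \<open>The recession function is differentiable only away from \<open>0\<close>, whence \<open>\<xi>' \<noteq> 0\<close>.\<close>

definition cond_g :: "(real^'d^'n \<Rightarrow> real) \<Rightarrow> bool" where
  "cond_g f \<longleftrightarrow> (\<forall>\<xi> \<xi>'. \<xi> \<noteq> 0 \<and> \<xi>' \<noteq> 0 \<and> grad (recession f) \<xi>' = grad f \<xi> \<longrightarrow>
     grad (recession f) \<xi>' = grad (recession f) \<xi>)"


section \<open>Hausdorff measure\<close>

text \<open>\<open>m\<close>-dimensional Hausdorff measure with the normalisation that makes it agree with Lebesgue
  measure on \<open>m\<close>-dimensional Euclidean space.\<close>

definition hausdorff_pre :: "nat \<Rightarrow> real \<Rightarrow> 'a::metric_space set \<Rightarrow> ennreal" where
  "hausdorff_pre m \<delta> A =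
     (INF C\<in>{C :: nat \<Rightarrow> 'a set. A \<subseteq> (\<Union>i. C i) \<and> (\<forall>i. bounded (C i) \<and> diameter (C i) \<le> \<delta>)}.
        \<Sum>i. if C i = {} then 0 else ennreal (unit_ball_vol (real m) * (diameter (C i) / 2) ^ m))"

definition hausdorff_measure :: "nat \<Rightarrow> 'a::metric_space measure" where
  "hausdorff_measure m =
     measure_of UNIV (sets borel) (\<lambda>A. SUP \<delta>\<in>{0<..}. hausdorff_pre m \<delta> A)"


section \<open>Vector-valued measures\<close>

text \<open>A vector-valued measure is a set function, of which only the values on \<open>sets M\<close> matter.\<close>

definition variation :: "'a measure \<Rightarrow> ('a set \<Rightarrow> 'b::euclidean_space) \<Rightarrow> 'a set \<Rightarrow> ennreal" where
  "variation M \<mu> A =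
     (SUP P\<in>{P. finite P \<and> P \<subseteq> sets M \<and> disjoint P \<and> \<Union>P \<subseteq> A}. \<Sum>B\<in>P. ennreal (norm (\<mu> B)))"

definition variation_measure ::
    "'a measure \<Rightarrow> ('a set \<Rightarrow> 'b::euclidean_space) \<Rightarrow> 'a measure" where
  "variation_measure M \<mu> = measure_of (space M) (sets M) (variation M \<mu>)"

definition bounded_vector_measure ::
    "'a measure \<Rightarrow> ('a set \<Rightarrow> 'b::euclidean_space) \<Rightarrow> bool" where
  "bounded_vector_measure M \<mu> \<longleftrightarrow>
     (\<forall>A :: nat \<Rightarrow> 'a set. range A \<subseteq> sets M \<and> disjoint_family A \<longrightarrow>
        (\<lambda>i. \<mu> (A i)) sums \<mu> (\<Union>i. A i)) \<and>
     variation M \<mu> (space M) < \<infinity>"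

text \<open>The density \<open>d\<mu>/d|\<mu>|\<close>, determined \<open>|\<mu>|\<close>-almost everywhere.\<close>

definition polar_density ::
    "'a measure \<Rightarrow> ('a set \<Rightarrow> 'b::euclidean_space) \<Rightarrow> 'a \<Rightarrow> 'b" where
  "polar_density M \<mu> =
     (SOME h. integrable (variation_measure M \<mu>) h \<and>
        (\<forall>A\<in>sets M. \<mu> A = (LINT x:A|variation_measure M \<mu>. h x)))"

abbreviation borel_on :: "'a::topological_space set \<Rightarrow> 'a measure" where
  "borel_on \<Omega> \<equiv> restrict_space borel \<Omega>"

definition lebesgue_decomposition ::
    "'a::euclidean_space set \<Rightarrow> ('a set \<Rightarrow> 'b::euclidean_space) \<Rightarrow> ('a \<Rightarrow> 'b) \<Rightarrow> ('a set \<Rightarrow> 'b) \<Rightarrow> bool"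
  where
  "lebesgue_decomposition \<Omega> \<mu> a \<sigma> \<longleftrightarrow>
     set_integrable lborel \<Omega> a \<and>
     bounded_vector_measure (borel_on \<Omega>) \<sigma> \<and>
     (\<exists>N\<in>sets (borel_on \<Omega>). emeasure lborel N = 0 \<and>
        (\<forall>A\<in>sets (borel_on \<Omega>). \<sigma> A = \<sigma> (A \<inter> N))) \<and>
     (\<forall>A\<in>sets (borel_on \<Omega>). \<mu> A = (LINT x:A|lborel. a x) + \<sigma> A)"

definition ac_density ::
    "'a::euclidean_space set \<Rightarrow> ('a set \<Rightarrow> 'b::euclidean_space) \<Rightarrow> 'a \<Rightarrow> 'b" where
  "ac_density \<Omega> \<mu> = (SOME a. \<exists>\<sigma>. lebesgue_decomposition \<Omega> \<mu> a \<sigma>)"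

definition singular_part ::
    "'a::euclidean_space set \<Rightarrow> ('a set \<Rightarrow> 'b::euclidean_space) \<Rightarrow> 'a set \<Rightarrow> 'b" where
  "singular_part \<Omega> \<mu> A = \<mu> A - (LINT x:A|lborel. ac_density \<Omega> \<mu> x)"


section \<open>Functions of bounded variation and their traces\<close>

text \<open>\<open>w \<in> BV(\<Omega>)\<close> with distributional gradient \<open>\<mu>\<close>, which is unique on the Borel subsets of \<open>\<Omega>\<close>.
  The integral of \<open>\<phi>\<close> against \<open>\<mu>\<close> is written through \<open>\<mu> = (d\<mu>/d|\<mu>|) |\<mu>|\<close>.\<close>

definition BV_gradient ::
    "(real^'d) set \<Rightarrow> (real^'d \<Rightarrow> real^'n) \<Rightarrow> ((real^'d) set \<Rightarrow> real^'d^'n) \<Rightarrow> bool" where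
  "BV_gradient \<Omega> w \<mu> \<longleftrightarrow>
     set_integrable lebesgue \<Omega> w \<and>
     bounded_vector_measure (borel_on \<Omega>) \<mu> \<and>
     (\<forall>\<phi> :: real^'d \<Rightarrow> real.
        C_on \<infinity> UNIV \<phi> \<and> compact (closure {x. \<phi> x \<noteq> 0}) \<and> closure {x. \<phi> x \<noteq> 0} \<subseteq> \<Omega> \<longrightarrow>
        (\<forall>i j. (LINT x:\<Omega>|lebesgue. w x $ i * frechet_derivative \<phi> (at x) (axis j 1)) =
           - (LINT x|variation_measure (borel_on \<Omega>) \<mu>.
                \<phi> x * polar_density (borel_on \<Omega>) \<mu> x $ i $ j)))"

definition BV :: "(real^'d) set \<Rightarrow> (real^'d \<Rightarrow> real^'n) set" where
  "BV \<Omega> = {w. \<exists>\<mu>. BV_gradient \<Omega> w \<mu>}"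

text \<open>The unit vector \<open>n\<close> for which, near \<open>x\<close>, the set \<open>\<Omega>\<close> lies asymptotically in the half-space
  \<open>(y - x) \<bullet> n \<le> 0\<close> and its complement in the opposite one.\<close>

definition outer_unit_normal :: "'a::euclidean_space set \<Rightarrow> 'a \<Rightarrow> 'a" where
  "outer_unit_normal \<Omega> x = (THE n. norm n = 1 \<and>
     (\<forall>\<epsilon>>0. \<exists>\<delta>>0. \<forall>y\<in>ball x \<delta>.
        (y \<in> \<Omega> \<longrightarrow> (y - x) \<bullet> n \<le> \<epsilon> * norm (y - x)) \<and>
        (y \<notin> \<Omega> \<longrightarrow> (y - x) \<bullet> n \<ge> - \<epsilon> * norm (y - x))))"

text \<open>\<open>g\<close> represents the trace on \<open>\<partial>\<Omega>\<close> of the function \<open>w \<in> BV(\<Omega>)\<close> with gradient \<open>\<mu>\<close>. As in Evans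
  and Gariepy, the trace is the integrable function on the boundary for which the Gauss--Green
  formula holds with all continuously differentiable fields \<open>\<phi>\<close>. On a bounded Lipschitz domain it
  exists for every \<open>w \<in> BV(\<Omega>)\<close>, and is unique up to null sets.\<close>

definition BV_trace ::
    "(real^'d) set \<Rightarrow> (real^'d \<Rightarrow> real^'n) \<Rightarrow> ((real^'d) set \<Rightarrow> real^'d^'n) \<Rightarrow>
     (real^'d \<Rightarrow> real^'n) \<Rightarrow> bool" where
  "BV_trace \<Omega> w \<mu> g \<longleftrightarrow>
     set_integrable (hausdorff_measure (CARD('d) - 1)) (frontier \<Omega>) g \<and>
     (\<forall>\<phi> :: real^'d \<Rightarrow> real^'d. C_on 1 UNIV \<phi> \<longrightarrow>
        (\<forall>i. (LINT x:\<Omega>|lebesgue. w x $ i * divergence \<phi> x) =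
           - (LINT x|variation_measure (borel_on \<Omega>) \<mu>.
                \<phi> x \<bullet> (polar_density (borel_on \<Omega>) \<mu> x $ i))
           + (LINT x:frontier \<Omega>|hausdorff_measure (CARD('d) - 1).
                g x $ i * (\<phi> x \<bullet> outer_unit_normal \<Omega> x))))"


section \<open>The minimization problem\<close>

text \<open>The functional at a function of bounded variation with gradient \<open>\<mu>\<close> and trace \<open>g\<close>.\<close>

definition relaxed_energy ::
    "(real^'d) set \<Rightarrow> (real^'d^'n \<Rightarrow> real) \<Rightarrow> (real^'d \<Rightarrow> real^'n) \<Rightarrow>
     ((real^'d) set \<Rightarrow> real^'d^'n) \<Rightarrow> (real^'d \<Rightarrow> real^'n) \<Rightarrow> real" where
  "relaxed_energy \<Omega> f u0 \<mu> g =
     (LINT x:\<Omega>|lborel. f (ac_density \<Omega> \<mu> x))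
     + (LINT x|variation_measure (borel_on \<Omega>) (singular_part \<Omega> \<mu>).
          recession f (polar_density (borel_on \<Omega>) (singular_part \<Omega> \<mu>) x))
     + (LINT x:frontier \<Omega>|hausdorff_measure (CARD('d) - 1).
          recession f ((u0 x - g x) \<otimes>\<^sub>v outer_unit_normal \<Omega> x))"

text \<open>Gradient and trace being unique up to the choice of a representative, the quantifiers over
  \<open>\<mu>\<close>, \<open>g\<close>, \<open>\<mu>'\<close>, \<open>g'\<close> only name the gradients and traces of \<open>u\<close> and \<open>w\<close>.\<close>

definition BV_minimizer ::
    "(real^'d) set \<Rightarrow> (real^'d^'n \<Rightarrow> real) \<Rightarrow> (real^'d \<Rightarrow> real^'n) \<Rightarrow> (real^'d \<Rightarrow> real^'n) \<Rightarrow> bool"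
  where
  "BV_minimizer \<Omega> f u0 u \<longleftrightarrow> u \<in> BV \<Omega> \<and>
     (\<exists>\<mu> g. BV_gradient \<Omega> u \<mu> \<and> BV_trace \<Omega> u \<mu> g \<and>
        (\<forall>w\<in>BV \<Omega>. \<forall>\<mu>' g'. BV_gradient \<Omega> w \<mu>' \<and> BV_trace \<Omega> w \<mu>' g' \<longrightarrow>
           relaxed_energy \<Omega> f u0 \<mu> g \<le> relaxed_energy \<Omega> f u0 \<mu>' g'))"

end

theory Submission
  imports Defs
begin

text \<open>The integrand is \<open>f(\<xi>) = sqrt (\<bar>\<xi>\<bar>\<^sup>2 + det \<xi>)\<close>, the norm of a positive definite quadratic form
  \<open>Q \<xi> \<bullet> \<xi>\<close> with \<open>Q = id + cof/2\<close>. Its gradient \<open>Q \<xi> / f(\<xi>)\<close> at a rank-one matrix has rank two, so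
  (e) fails. The datum is \<open>u0(z) = z\<^sup>2\<close> on the unit circle. By duality, \<open>u = 0\<close> is a minimizer as
  soon as there is a calibration: a divergence-free field \<open>\<sigma>\<close> on the disc with \<open>\<sigma>(x) \<bullet> \<xi> \<le> f(\<xi>)\<close> for
  all \<open>\<xi>\<close> and with equality for \<open>\<xi> = u0(x) \<otimes> \<nu>\<^sub>x\<close> at the boundary. Such a field can be chosen
  polynomial, because \<open>Q (z\<^sup>2 \<otimes> z)\<close> has a divergence-free extension to the disc which stays in the polar
  body of \<open>f\<close>.\<close>

section \<open>Hausdorff measure\<close>

text \<open>Origin of the field: split a matrix into a conformal part \<open>\<zeta>\<close> and an
  anticonformal part \<open>\<eta>\<close>. For z^2 \<otimes> z on the circle they are z/2 and
  z^3/2, and \<open>Q\<close> turns them into 3z/4 and z^3/4. If \<open>\<eta>\<close> is extended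
  as z^3/4, zero divergence forces the derivative of \<open>\<zeta>\<close> in the conjugate
  variable to be -3z^2/4, so \<open>\<zeta>\<close> = h - 3/4 |z|^2 z with h holomorphic, and the
  boundary value leaves h = 3z/2. With s = |z|^2 the squared polar norm is then 1 - (1 - s)^3. The
  weight 1/2 in \<open>Q\<close> is the borderline: with \<open>Q = id + t cof\<close>, 0 \<le> t <
  1, the same construction gives a squared polar norm equal to 1 on the circle with s-derivative 2t
  - 1 there, so for t < 1/2 it exceeds 1 just inside.

  The measure theory is shaped by default values: densities are choices, a non-integrable function
  has integral 0, and \<open>measure_of\<close> returns the zero measure for a set function that is
  not countably additive. So polar densities and the Lebesgue decomposition have to be shown to
  exist, and Hausdorff measure has to be shown positive on the circle.\<close>

lemma hausdorff_pre_empty: "hausdorff_pre m \<delta> {} = 0" if "\<delta> > 0"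
proof -
  have "hausdorff_pre m \<delta> ({} :: 'a set) \<le>
      (\<Sum>i. if (\<lambda>_::nat. {} :: 'a set) i = {} then 0
         else ennreal (unit_ball_vol (real m) * (diameter ((\<lambda>_. {} :: 'a set) i) / 2) ^ m))"
    unfolding hausdorff_pre_def
    by (rule INF_lower) (use that in \<open>auto simp: diameter_def\<close>)
  then show ?thesis by simp
qed

lemma hausdorff_pre_mono: "A \<subseteq> B \<Longrightarrow> hausdorff_pre m \<delta> A \<le> hausdorff_pre m \<delta> B"
  unfolding hausdorff_pre_def by (rule INF_superset_mono) auto

lemma hausdorff_pre_antimono: "\<delta> \<le> \<epsilon> \<Longrightarrow> hausdorff_pre m \<epsilon> A \<le> hausdorff_pre m \<delta> A"
  unfolding hausdorff_pre_def by (rule INF_superset_mono) (auto intro: order_trans)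

text \<open>Covers of the \<open>A n\<close> that are optimal up to \<open>e * (1/2) ^ Suc n\<close>
  are merged into one sequence by \<open>prod_decode\<close>; the errors add up to
  \<open>e\<close>.\<close>

lemma hausdorff_pre_countable_subadditive:
  fixes A :: "nat \<Rightarrow> 'a::metric_space set"
  shows "hausdorff_pre m \<delta> (\<Union>n. A n) \<le> (\<Sum>n. hausdorff_pre m \<delta> (A n))"
proof (rule ennreal_le_epsilon)
  fix e :: real
  assume fin: "(\<Sum>n. hausdorff_pre m \<delta> (A n)) < top" and e: "0 < e"
  define cost :: "'a set \<Rightarrow> ennreal" where "cost C =
    (if C = {} then 0 else ennreal (unit_ball_vol (real m) * (diameter C / 2) ^ m))" for C
  define Cov where "Cov B = {C :: nat \<Rightarrow> 'a set. B \<subseteq> (\<Union>i. C i) \<and>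
    (\<forall>i. bounded (C i) \<and> diameter (C i) \<le> \<delta>)}" for B
  have pre: "hausdorff_pre m \<delta> B = (INF C\<in>Cov B. \<Sum>i. cost (C i))" for B
    by (simp add: hausdorff_pre_def Cov_def cost_def)
  have "\<exists>C\<in>Cov (A n). (\<Sum>i. cost (C i)) \<le> hausdorff_pre m \<delta> (A n) + ennreal (e * (1/2) ^ Suc n)" for n
  proof -
    have "hausdorff_pre m \<delta> (A n) < top"
      using fin by (metis ennreal_suminf_lessD)
    then have "hausdorff_pre m \<delta> (A n) < hausdorff_pre m \<delta> (A n) + ennreal (e * (1/2) ^ Suc n)"
      using e by (simp add: ennreal_zero_less_mult_iff)
    then obtain C where "C \<in> Cov (A n)"
      "(\<Sum>i. cost (C i)) < hausdorff_pre m \<delta> (A n) + ennreal (e * (1/2) ^ Suc n)"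
      unfolding pre INF_less_iff by blast
    then show ?thesis by (blast intro: less_imp_le)
  qed
  then obtain C where C: "\<And>n. C n \<in> Cov (A n)"
    and le: "\<And>n. (\<Sum>i. cost (C n i)) \<le> hausdorff_pre m \<delta> (A n) + ennreal (e * (1/2) ^ Suc n)"
    by metis
  define D where "D k = C (fst (prod_decode k)) (snd (prod_decode k))" for k
  have "x \<in> (\<Union>k. D k)" if x: "x \<in> A n" for n x
  proof -
    have "A n \<subseteq> (\<Union>i. C n i)" using C[of n] by (simp add: Cov_def)
    then obtain i where "x \<in> C n i" using x by blast
    then have "x \<in> D (prod_encode (n, i))" by (simp add: D_def)
    then show ?thesis by blast
  qed
  then have "D \<in> Cov (\<Union>n. A n)"
    using C by (auto simp: Cov_def D_def)
  then have "hausdorff_pre m \<delta> (\<Union>n. A n) \<le> (\<Sum>k. cost (D k))"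
    unfolding pre by (rule INF_lower)
  also have "\<dots> = (\<Sum>n. \<Sum>i. cost (C n i))"
    unfolding D_def
    using suminf_ennreal_2dimen[where f="\<lambda>p. cost (C (fst p) (snd p))"] by simp
  also have "\<dots> \<le> (\<Sum>n. hausdorff_pre m \<delta> (A n) + ennreal (e * (1/2) ^ Suc n))"
    by (intro suminf_le le) auto
  also have "\<dots> = (\<Sum>n. hausdorff_pre m \<delta> (A n)) + (\<Sum>n. ennreal (e * (1/2) ^ Suc n))"
    by (rule suminf_add[symmetric]) auto
  also have "(\<Sum>n. ennreal (e * (1/2) ^ Suc n)) = ennreal e"
    using sums_mult[OF power_half_series, of e] e
    by (subst suminf_ennreal2) (auto simp: sums_iff)
  finally show "hausdorff_pre m \<delta> (\<Union>n. A n) \<le> (\<Sum>n. hausdorff_pre m \<delta> (A n)) + ennreal e" .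
qed

text \<open>A set of diameter at most \<open>\<delta>\<close> cannot meet both \<open>A\<close> and
  \<open>B\<close>, so every cover of the union splits into a cover of \<open>A\<close> and one of
  \<open>B\<close>.\<close>

lemma hausdorff_pre_Un_separated:
  fixes A B :: "'a::metric_space set"
  assumes sep: "\<And>x y. x \<in> A \<Longrightarrow> y \<in> B \<Longrightarrow> \<delta> < dist x y" and "\<delta> > 0"
  shows "hausdorff_pre m \<delta> A + hausdorff_pre m \<delta> B \<le> hausdorff_pre m \<delta> (A \<union> B)"
proof -
  define cost :: "'a set \<Rightarrow> ennreal" where "cost C =
    (if C = {} then 0 else ennreal (unit_ball_vol (real m) * (diameter C / 2) ^ m))" for C
  define Cov where "Cov B = {C :: nat \<Rightarrow> 'a set. B \<subseteq> (\<Union>i. C i) \<and>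
    (\<forall>i. bounded (C i) \<and> diameter (C i) \<le> \<delta>)}" for B
  have pre: "hausdorff_pre m \<delta> B = (INF C\<in>Cov B. \<Sum>i. cost (C i))" for B
    by (simp add: hausdorff_pre_def Cov_def cost_def)
  have "hausdorff_pre m \<delta> A + hausdorff_pre m \<delta> B \<le> (\<Sum>i. cost (C i))" if C: "C \<in> Cov (A \<union> B)" for C
  proof -
    \<comment> \<open>Sets missing \<open>E\<close> are replaced by the empty set rather than
      dropped, which keeps the index type \<open>nat\<close>. The empty set costs 0 even for
      \<open>m = 0\<close>, where the power alone would give 1.\<close>
    define meet where "meet E i = (if C i \<inter> E = {} then {} else C i)" for E i
    have meet: "meet E \<in> Cov E" if "E \<subseteq> A \<union> B" for E
    proof -
      have "x \<in> (\<Union>i. meet E i)" if "x \<in> E" for x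
      proof -
        have "A \<union> B \<subseteq> (\<Union>i. C i)" using C unfolding Cov_def by blast
        then have "x \<in> (\<Union>i. C i)" using \<open>E \<subseteq> A \<union> B\<close> \<open>x \<in> E\<close> by blast
        then obtain i where "x \<in> C i" by blast
        then have "x \<in> meet E i" using \<open>x \<in> E\<close> by (auto simp: meet_def)
        then show ?thesis by blast
      qed
      then show ?thesis
        using C \<open>\<delta> > 0\<close> by (auto simp: Cov_def meet_def)
    qed
    have "cost (meet A i) + cost (meet B i) \<le> cost (C i)" for i
    proof (cases "C i \<inter> A = {} \<or> C i \<inter> B = {}")
      case True
      then show ?thesis by (auto simp: meet_def cost_def)
    next
      case False
      then obtain x y where xy: "x \<in> C i" "x \<in> A" "y \<in> C i" "y \<in> B" by blast
      then have "dist x y \<le> diameter (C i)" using C by (auto simp: Cov_def diameter_bounded_bound)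
      also have "\<dots> \<le> \<delta>" using C by (auto simp: Cov_def)
      finally show ?thesis using sep xy by force
    qed
    then have "(\<Sum>i. cost (meet A i) + cost (meet B i)) \<le> (\<Sum>i. cost (C i))"
      by (intro suminf_le) auto
    moreover have "(\<Sum>i. cost (meet A i) + cost (meet B i)) =
        (\<Sum>i. cost (meet A i)) + (\<Sum>i. cost (meet B i))"
      by (rule suminf_add[symmetric]) auto
    moreover have "hausdorff_pre m \<delta> A \<le> (\<Sum>i. cost (meet A i))"
      unfolding pre by (intro INF_lower meet) auto
    moreover have "hausdorff_pre m \<delta> B \<le> (\<Sum>i. cost (meet B i))"
      unfolding pre by (intro INF_lower meet) auto
    ultimately show ?thesis
      by (metis (no_types, lifting) add_mono order_trans)
  qed
  then show ?thesis unfolding pre[of "A \<union> B"] by (rule INF_greatest)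
qed

section \<open>Hausdorff outer measure and Caratheodory measurability of Borel sets\<close>

definition hausdorff_outer :: "nat \<Rightarrow> 'a::metric_space set \<Rightarrow> ennreal" where
  "hausdorff_outer m A = (SUP \<delta>\<in>{0<..}. hausdorff_pre m \<delta> A)"

lemma outer_measure_space_hausdorff_outer: "outer_measure_space UNIV (hausdorff_outer m)"
proof -
  have "hausdorff_outer m (\<Union>n. A n) \<le> (\<Sum>n. hausdorff_outer m (A n))" for A :: "nat \<Rightarrow> 'a set"
    unfolding hausdorff_outer_def
  proof (rule SUP_least)
    fix \<delta> :: real assume "\<delta> \<in> {0<..}"
    then show "hausdorff_pre m \<delta> (\<Union>n. A n) \<le> (\<Sum>n. SUP \<delta>\<in>{0<..}. hausdorff_pre m \<delta> (A n))"
      by (intro order_trans[OF hausdorff_pre_countable_subadditive] suminf_le SUP_upper) auto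
  qed
  moreover have "hausdorff_outer m A \<le> hausdorff_outer m B" if "A \<subseteq> B" for A B :: "'a set"
    unfolding hausdorff_outer_def using that by (auto intro!: SUP_mono hausdorff_pre_mono)
  moreover have "hausdorff_outer m ({} :: 'a set) = 0"
    unfolding hausdorff_outer_def
    by (rule antisym) (auto intro!: SUP_least simp: hausdorff_pre_empty)
  ultimately show ?thesis
    by (simp add: outer_measure_space_def positive_def increasing_def countably_subadditive_def)
qed

text \<open>This is the property of a metric outer measure, on which the measurability of closed
  sets rests. Below the scale \<open>d\<close> the premeasures are superadditive across the gap, and
  they grow as the scale shrinks, so two scales can be replaced by a common smaller one.\<close>

lemma hausdorff_outer_Un_separated:
  fixes A B :: "'a::metric_space set"
  assumes "d > 0" and sep: "\<And>x y. x \<in> A \<Longrightarrow> y \<in> B \<Longrightarrow> d \<le> dist x y"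
  shows "hausdorff_outer m A + hausdorff_outer m B \<le> hausdorff_outer m (A \<union> B)"
proof -
  have "hausdorff_pre m \<delta> A + hausdorff_pre m \<epsilon> B \<le> hausdorff_outer m (A \<union> B)"
    if "\<delta> > 0" "\<epsilon> > 0" for \<delta> \<epsilon>
  proof -
    \<comment> \<open>Half of \<open>d\<close>, because the separation required at scale
      \<open>k\<close> is strict.\<close>
    define k where "k = min (min \<delta> \<epsilon>) (d / 2)"
    have k: "k > 0" "k \<le> \<delta>" "k \<le> \<epsilon>" "k < d" using that \<open>d > 0\<close> by (auto simp: k_def)
    have "hausdorff_pre m \<delta> A + hausdorff_pre m \<epsilon> B \<le> hausdorff_pre m k A + hausdorff_pre m k B"
      using k by (intro add_mono hausdorff_pre_antimono)
    also have "\<dots> \<le> hausdorff_pre m k (A \<union> B)"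
      using k sep by (intro hausdorff_pre_Un_separated) force+
    also have "\<dots> \<le> hausdorff_outer m (A \<union> B)"
      unfolding hausdorff_outer_def using k by (intro SUP_upper) auto
    finally show ?thesis .
  qed
  moreover have "({0<..} :: real set) \<noteq> {}" by auto
  ultimately show ?thesis
    unfolding hausdorff_outer_def[of m A] hausdorff_outer_def[of m B]
    by (simp add: ennreal_SUP_add_left[symmetric] ennreal_SUP_add_right SUP_le_iff)
qed

text \<open>The gap between \<open>R i\<close> and a later \<open>R j\<close> depends on
  \<open>j\<close> only, so in the induction \<open>R n\<close> keeps the distance
  \<open>d n\<close> from the union of all earlier sets at once. A uniform gap would not fit shells
  that accumulate at a closed set.\<close>

lemma outer_measure_sum_separated:
  fixes \<phi> :: "'a::metric_space set \<Rightarrow> ennreal"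
  assumes empty: "\<phi> {} = 0"
    and separated: "\<And>A B d. d > 0 \<Longrightarrow> (\<And>x y. x \<in> A \<Longrightarrow> y \<in> B \<Longrightarrow> d \<le> dist x y) \<Longrightarrow>
      \<phi> A + \<phi> B \<le> \<phi> (A \<union> B)"
    and d: "\<And>i. d i > 0" "\<And>i j x y. i < j \<Longrightarrow> x \<in> R i \<Longrightarrow> y \<in> R j \<Longrightarrow> d j \<le> dist x y"
  shows "(\<Sum>k<n::nat. \<phi> (R k)) \<le> \<phi> (\<Union>k<n. R k)"
proof (induction n)
  case (Suc n)
  have "(\<Sum>k<Suc n. \<phi> (R k)) \<le> \<phi> (\<Union>k<n. R k) + \<phi> (R n)"
    using Suc by (simp add: add_mono)
  also have "\<dots> \<le> \<phi> ((\<Union>k<n. R k) \<union> R n)"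
    using d by (intro separated[of "d n"]) auto
  also have "(\<Union>k<n. R k) \<union> R n = (\<Union>k<Suc n. R k)"
    by (auto simp: less_Suc_eq)
  finally show ?case .
qed (simp add: empty)

text \<open>The shells \<open>R k\<close> with indices of equal parity are separated from each other, so the sum of
  their outer measures is finite; hence the part of \<open>X - F\<close> close to \<open>F\<close> is negligible.\<close>

lemma closed_in_lambda_system:
  fixes \<phi> :: "'a::metric_space set \<Rightarrow> ennreal"
  assumes oms: "outer_measure_space UNIV \<phi>"
    and separated: "\<And>A B d. d > 0 \<Longrightarrow> (\<And>x y. x \<in> A \<Longrightarrow> y \<in> B \<Longrightarrow> d \<le> dist x y) \<Longrightarrow>
      \<phi> A + \<phi> B \<le> \<phi> (A \<union> B)"
    and "closed F"
  shows "F \<in> lambda_system UNIV UNIV \<phi>"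
proof -
  have empty: "\<phi> {} = 0" and mono: "A \<subseteq> B \<Longrightarrow> \<phi> A \<le> \<phi> B" for A B
    using oms by (auto simp: outer_measure_space_def positive_def increasing_def)
  \<comment> \<open>\<open>countably_subadditive\<close> speaks of disjoint families only, so every
    use below has to supply disjointness.\<close>
  have csub: "\<phi> (\<Union>n. A n) \<le> (\<Sum>n. \<phi> (A n))" if "disjoint_family A" for A :: "nat \<Rightarrow> 'a set"
    using oms that by (auto simp: outer_measure_space_def countably_subadditive_def)
  have sub: "\<phi> (A \<union> B) \<le> \<phi> A + \<phi> B" if "A \<inter> B = {}" for A B
  proof -
    have "disjoint_family (binaryset A B)"
      using that by (auto simp: disjoint_family_on_def binaryset_def)
    from csub[OF this] have "\<phi> (A \<union> B) \<le> (\<Sum>n. \<phi> (binaryset A B n))"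
      by (simp add: UN_binaryset_eq)
    also have "\<dots> = \<phi> A + \<phi> B" by (rule suminf_binaryset_eq) (rule empty)
    finally show ?thesis .
  qed
  \<comment> \<open>Finiteness of \<open>\<phi> X\<close> makes the series over the shells converge;
    for infinite \<open>\<phi> X\<close> the inequality is trivial.\<close>
  have key: "\<phi> (X \<inter> F) + \<phi> (X - F) \<le> \<phi> X" if "F \<noteq> {}" "\<phi> X < top" for X
  proof (rule ennreal_le_epsilon)
    fix e :: real assume e: "0 < e"
    define r :: "nat \<Rightarrow> real" where "r n = (1/2) ^ n" for n
    have r_pos: "r n > 0" and r_Suc: "r (Suc n) = r n / 2" for n by (auto simp: r_def)
    have r_mono: "r n \<le> r m" if "m \<le> n" for m n
      unfolding r_def using that by (intro power_decreasing) auto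
    define D where "D n = {x\<in>X. r n \<le> infdist x F}" for n
    define R where "R n = {x\<in>X. r (Suc n) \<le> infdist x F \<and> infdist x F < r n}" for n
    \<comment> \<open>A point of \<open>R i\<close> has distance at least \<open>r (Suc i)\<close>,
      hence at least \<open>2 * r j\<close>, from \<open>F\<close>, while a point of
      \<open>R j\<close> is closer than \<open>r j\<close>. Neighbouring shells touch, hence the gap
      of two in the index.\<close>
    have R_sep: "r j \<le> dist x y" if "Suc (Suc i) \<le> j" "x \<in> R i" "y \<in> R j" for i j x y
    proof -
      obtain j' where j': "j = Suc j'" "Suc i \<le> j'" using \<open>Suc (Suc i) \<le> j\<close> by (cases j) auto
      have "2 * r j \<le> r (Suc i)" using j' r_mono[of "Suc i" j'] by (simp add: r_Suc)
      then show ?thesis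
        using that(2,3) infdist_triangle[of x F y] by (simp add: R_def)
    qed
    have half: "(\<Sum>k<n. \<phi> (R (2 * k + b))) \<le> \<phi> X" for n b
    proof -
      have "(\<Sum>k<n. \<phi> (R (2 * k + b))) \<le> \<phi> (\<Union>k<n. R (2 * k + b))"
      proof (rule outer_measure_sum_separated[where R="\<lambda>k. R (2 * k + b)" and \<phi>=\<phi>])
        show "r (2 * j + b) > 0" for j by (rule r_pos)
        show "r (2 * j + b) \<le> dist x y"
          if "i < j" "x \<in> R (2 * i + b)" "y \<in> R (2 * j + b)" for i j x y
          using R_sep[of "2 * i + b" "2 * j + b" x y] that by auto
      qed (use empty separated in auto)
      also have "\<dots> \<le> \<phi> X" by (rule mono) (auto simp: R_def)
      finally show ?thesis .
    qed
    have dbl: "(\<Sum>k<2 * n. \<phi> (R k)) = (\<Sum>k<n. \<phi> (R (2 * k + 0))) + (\<Sum>k<n. \<phi> (R (2 * k + 1)))" for n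
      by (induction n) (auto simp: algebra_simps)
    have "(\<Sum>k<n. \<phi> (R k)) \<le> \<phi> X + \<phi> X" for n
    proof -
      have "(\<Sum>k<n. \<phi> (R k)) \<le> (\<Sum>k<2 * n. \<phi> (R k))" by (rule sum_mono2) auto
      also have "\<dots> \<le> \<phi> X + \<phi> X" unfolding dbl by (intro add_mono half)
      finally show ?thesis .
    qed
    then have "(\<Sum>k. \<phi> (R k)) \<le> \<phi> X + \<phi> X" by (intro suminf_le_const) auto
    also have "\<dots> < top" using that by simp
    finally have fin: "(\<Sum>k. \<phi> (R k)) < top" .
    define g where "g k = enn2real (\<phi> (R k))" for k
    have "\<phi> (R k) < top" for k using fin by (metis ennreal_suminf_lessD)
    then have g: "\<phi> (R k) = ennreal (g k)" for k by (simp add: g_def)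
    have "g k \<ge> 0" for k by (simp add: g_def)
    \<comment> \<open>A tail of this series will bound the part of \<open>X - F\<close> that is
      closer to \<open>F\<close> than \<open>r N\<close>.\<close>
    then have "summable g"
      using fin unfolding g by (intro summable_suminf_not_top) auto
    then obtain N where N: "norm (\<Sum>i. g (i + N)) < e"
      using suminf_exist_split[OF e] by blast
    have "X - F \<subseteq> D N \<union> (\<Union>k. R (k + N))"
    proof
      fix x assume x: "x \<in> X - F"
      then have ip: "infdist x F > 0"
        using \<open>closed F\<close> \<open>F \<noteq> {}\<close> by (simp add: infdist_pos_not_in_closed)
      show "x \<in> D N \<union> (\<Union>k. R (k + N))"
      proof (cases "x \<in> D N")
        case False
        define l where "l = (LEAST k. r (Suc k) \<le> infdist x F)"
        obtain n0 where "r n0 < infdist x F"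
          unfolding r_def using real_arch_pow_inv[OF ip, of "1/2"] by auto
        then have "r (Suc n0) \<le> infdist x F" using r_pos[of n0] by (simp add: r_Suc)
        then have L: "r (Suc l) \<le> infdist x F" unfolding l_def by (rule LeastI)
        have lN: "l \<ge> N"
          using L False x r_mono[of "Suc l" N] by (fastforce simp: D_def not_less_eq_eq[symmetric])
        have "infdist x F < r l"
        \<comment> \<open>For \<open>l = 0\<close> minimality says nothing: then \<open>lN\<close>
          forces \<open>N = 0\<close>, and the bound is that \<open>x\<close> lies outside
          \<open>D 0\<close>.\<close>
        proof (cases l)
          case 0
          with lN False x show ?thesis by (auto simp: D_def)
        next
          case (Suc l')
          then have "\<not> r (Suc l') \<le> infdist x F" by (metis l_def lessI not_less_Least)
          then show ?thesis using Suc by simp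
        qed
        with L x have "x \<in> R (l - N + N)" using lN by (simp add: R_def)
        then show ?thesis by blast
      qed simp
    qed
    then have "\<phi> (X - F) \<le> \<phi> (D N \<union> (\<Union>k. R (k + N)))" by (rule mono)
    also have "\<dots> \<le> \<phi> (D N) + \<phi> (\<Union>k. R (k + N))"
    proof (rule sub)
      have "x \<notin> R (k + N)" if "x \<in> D N" for x k
        using that r_mono[of N "k + N"] by (auto simp: D_def R_def)
      then show "D N \<inter> (\<Union>k. R (k + N)) = {}" by blast
    qed
    also have "\<phi> (\<Union>k. R (k + N)) \<le> (\<Sum>k. \<phi> (R (k + N)))"
    proof (rule csub)
      have "R i \<inter> R j = {}" if "i < j" for i j
      proof -
        have "r j \<le> r (Suc i)" using that by (intro r_mono) auto
        then show ?thesis by (fastforce simp: R_def)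
      qed
      then show "disjoint_family (\<lambda>k. R (k + N))"
        unfolding disjoint_family_on_def by (metis Int_commute add_less_cancel_right linorder_neqE_nat)
    qed
    also have "(\<Sum>k. \<phi> (R (k + N))) = ennreal (\<Sum>k. g (k + N))"
      unfolding g using \<open>summable g\<close> \<open>\<And>k. g k \<ge> 0\<close> by (intro suminf_ennreal2) (auto simp: summable_iff_shift)
    also have "\<dots> \<le> ennreal e" using N by (intro ennreal_leI) auto
    finally have "\<phi> (X - F) \<le> \<phi> (D N) + ennreal e" by (simp add: add_left_mono)
    then have "\<phi> (X \<inter> F) + \<phi> (X - F) \<le> \<phi> (X \<inter> F) + \<phi> (D N) + ennreal e"
      by (metis add_left_mono add.assoc)
    also have "\<phi> (X \<inter> F) + \<phi> (D N) \<le> \<phi> ((X \<inter> F) \<union> D N)"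
    proof (rule separated[of "r N"])
      fix x y assume "x \<in> X \<inter> F" "y \<in> D N"
      then show "r N \<le> dist x y"
        using infdist_le[of x F y] by (auto simp: D_def dist_commute)
    qed (rule r_pos)
    also have "\<dots> \<le> \<phi> X" by (rule mono) (auto simp: D_def)
    finally show "\<phi> (X \<inter> F) + \<phi> (X - F) \<le> \<phi> X + ennreal e" by (simp add: add_right_mono)
  qed
  have "\<phi> (X \<inter> F) + \<phi> (X - F) = \<phi> X" for X
  proof (rule antisym)
    show "\<phi> X \<le> \<phi> (X \<inter> F) + \<phi> (X - F)"
      using sub[of "X \<inter> F" "X - F"] by (simp add: Int_Diff_Un) blast
    show "\<phi> (X \<inter> F) + \<phi> (X - F) \<le> \<phi> X"
      using key[of X] by (cases "F = {}"; cases "\<phi> X < top") (auto simp: empty less_top[symmetric])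
  qed
  then show ?thesis
    by (simp add: lambda_system_def Int_commute Diff_eq)
qed

text \<open>\<open>measure_of\<close> keeps the given values only if they form a measure on the
  generated sigma-algebra. Caratheodory's theorem gives countable additivity on the
  \<open>lambda_system\<close>, which is a sigma-algebra containing the closed sets and therefore
  all Borel sets.\<close>

lemma emeasure_hausdorff_measure:
  assumes "A \<in> sets borel"
  shows "emeasure (hausdorff_measure m) (A :: 'a::metric_space set) = hausdorff_outer m A"
proof -
  interpret sigma_algebra UNIV "UNIV :: 'a set set" using sigma_algebra_Pow[of UNIV] by simp
  have ms: "measure_space UNIV (lambda_system UNIV UNIV (hausdorff_outer m)) (hausdorff_outer m :: 'a set \<Rightarrow> _)"
    by (rule caratheodory_lemma[OF outer_measure_space_hausdorff_outer])
  then interpret L: sigma_algebra UNIV "lambda_system UNIV UNIV (hausdorff_outer m) :: 'a set set"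
    by (simp add: measure_space_def)
  have "sets (borel :: 'a measure) = sigma_sets UNIV (Collect closed)"
    unfolding borel_eq_closed by (rule sets_measure_of) simp
  moreover have "Collect closed \<subseteq> (lambda_system UNIV UNIV (hausdorff_outer m) :: 'a set set)"
    by (auto intro!: closed_in_lambda_system outer_measure_space_hausdorff_outer hausdorff_outer_Un_separated)
  ultimately have "sets borel \<subseteq> (lambda_system UNIV UNIV (hausdorff_outer m) :: 'a set set)"
    using L.sigma_sets_subset by simp
  then have "countably_additive (sets borel) (hausdorff_outer m :: 'a set \<Rightarrow> _)"
    using ms by (auto simp: measure_space_def countably_additive_def subset_eq)
  moreover have "positive (sets borel) (hausdorff_outer m :: 'a set \<Rightarrow> _)"
    using outer_measure_space_hausdorff_outer[where 'a='a] by (simp add: outer_measure_space_def positive_def)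
  ultimately show ?thesis
    using assms sets.sigma_algebra_axioms[of "borel :: 'a measure"]
    unfolding hausdorff_measure_def hausdorff_outer_def[symmetric, abs_def]
    by (intro emeasure_measure_of_sigma) (auto simp: space_borel)
qed

lemma sets_hausdorff_measure [measurable_cong, simp]: "sets (hausdorff_measure m) = sets borel"
  unfolding hausdorff_measure_def
  using sets.sigma_sets_eq[of "borel :: 'a measure"] by (simp add: space_borel)

text \<open>A 1-Lipschitz image of \<open>C i\<close> fits into an interval of length
  \<open>diameter (C i)\<close>, and for \<open>m = 1\<close> the factor
  \<open>unit_ball_vol 1 = 2\<close> makes the cost of \<open>C i\<close> exactly this length.
  Countable subadditivity of Lebesgue measure on the line then bounds every cover from
  below.\<close>

lemma hausdorff_outer_1_ge_shadow:
  fixes A :: "'a::metric_space set" and p :: "'a \<Rightarrow> real"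
  assumes p: "\<And>x y. \<bar>p x - p y\<bar> \<le> dist x y" and "{a..b} \<subseteq> p ` A"
  shows "ennreal (b - a) \<le> hausdorff_outer 1 A"
proof -
  have "ennreal (b - a) \<le> (\<Sum>i. if C i = {} then 0
      else ennreal (unit_ball_vol (real 1) * (diameter (C i) / 2) ^ 1))"
    if C: "A \<subseteq> (\<Union>i. C i)" "\<And>i. bounded (C i)" for C :: "nat \<Rightarrow> 'a set"
  proof -
    define I where "I i = (if C i = {} then {} else
      {Inf (p ` C i)..Inf (p ` C i) + diameter (C i)})" for i
    have "p x \<in> I i" if x: "x \<in> C i" for x i
    proof -
      have close: "p x - diameter (C i) \<le> p y" if "y \<in> C i" for y
        using p[of x y] diameter_bounded_bound[OF C(2) x that] by linarith
      then have "bdd_below (p ` C i)" by (intro bdd_belowI[of _ "p x - diameter (C i)"]) auto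
      then have "Inf (p ` C i) \<le> p x" using x by (intro cInf_lower) auto
      moreover have "p x - diameter (C i) \<le> Inf (p ` C i)"
        using x close by (intro cInf_greatest) auto
      ultimately show ?thesis using x by (auto simp: I_def)
    qed
    then have "p x \<in> (\<Union>i. I i)" if "x \<in> A" for x
      using subsetD[OF C(1) that] by blast
    then have "p ` A \<subseteq> (\<Union>i. I i)" by (rule image_subsetI)
    with assms(2) have "{a..b} \<subseteq> (\<Union>i. I i)" by (rule subset_trans)
    then have "emeasure lborel {a..b} \<le> emeasure lborel (\<Union>i. I i)"
      by (intro emeasure_mono) (auto simp: I_def)
    also have "\<dots> \<le> (\<Sum>i. emeasure lborel (I i))"
      by (intro emeasure_subadditive_countably) (auto simp: I_def)
    also have "\<dots> = (\<Sum>i. if C i = {} then 0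
        else ennreal (unit_ball_vol (real 1) * (diameter (C i) / 2) ^ 1))"
      by (intro suminf_cong) (auto simp: I_def diameter_ge_0 C(2))
    finally show ?thesis by (cases "a \<le> b") (auto simp: ennreal_neg)
  qed
  \<comment> \<open>The estimate is independent of the mesh of the cover, so one scale suffices for
    a bound on the supremum.\<close>
  then have "ennreal (b - a) \<le> hausdorff_pre 1 1 A"
    unfolding hausdorff_pre_def by (intro INF_greatest) auto
  also have "\<dots> \<le> hausdorff_outer 1 A"
    unfolding hausdorff_outer_def by (intro SUP_upper) auto
  finally show ?thesis .
qed

section \<open>The variation of a vector measure and its densities\<close>

lemma bounded_vector_measure_sums:
  assumes "bounded_vector_measure M \<mu>" "range A \<subseteq> sets M" "disjoint_family A"
  shows "(\<lambda>i. \<mu> (A i)) sums \<mu> (\<Union>i. A i)"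
  using assms unfolding bounded_vector_measure_def by blast

lemma bounded_vector_measure_empty:
  assumes "bounded_vector_measure M \<mu>"
  shows "\<mu> {} = 0"
proof -
  have "(\<lambda>i::nat. \<mu> {}) sums \<mu> (\<Union>i::nat. {})"
    by (rule bounded_vector_measure_sums[OF assms]) (auto simp: disjoint_family_on_def)
  then show ?thesis by (simp add: sums_iff summable_const_iff)
qed

lemma bounded_vector_measure_Un:
  assumes "bounded_vector_measure M \<mu>" "A \<in> sets M" "B \<in> sets M" "A \<inter> B = {}"
  shows "\<mu> (A \<union> B) = \<mu> A + \<mu> B"
proof -
  have "(\<lambda>i. \<mu> (binaryset A B i)) sums \<mu> (\<Union>i. binaryset A B i)"
    using assms
    by (intro bounded_vector_measure_sums[OF assms(1)])
      (auto simp: disjoint_family_on_def binaryset_def)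
  moreover have "(\<lambda>i. \<mu> (binaryset A B i)) sums (\<mu> A + \<mu> B)"
    by (rule binaryset_sums) (rule bounded_vector_measure_empty[OF assms(1)])
  ultimately show ?thesis by (metis UN_binaryset_eq sums_unique2)
qed

lemma variation_mono: "A \<subseteq> B \<Longrightarrow> variation M \<mu> A \<le> variation M \<mu> B"
  unfolding variation_def by (rule SUP_subset_mono) auto

lemma norm_le_variation: "A \<in> sets M \<Longrightarrow> ennreal (norm (\<mu> A)) \<le> variation M \<mu> A"
  unfolding variation_def by (rule SUP_upper2[of "{A}"]) auto

lemma variation_superadditive:
  assumes \<mu>: "bounded_vector_measure M \<mu>" and "A \<inter> B = {}"
  shows "variation M \<mu> A + variation M \<mu> B \<le> variation M \<mu> (A \<union> B)"
proof -
  define \<P> where "\<P> E = {P. finite P \<and> P \<subseteq> sets M \<and> disjoint P \<and> \<Union>P \<subseteq> E}" for E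
  have ne: "\<P> E \<noteq> {}" for E by (auto simp: \<P>_def intro: exI[of _ "{}"])
  have "(\<Sum>C\<in>P. ennreal (norm (\<mu> C))) + (\<Sum>C\<in>Q. ennreal (norm (\<mu> C))) \<le> variation M \<mu> (A \<union> B)"
    if "P \<in> \<P> A" "Q \<in> \<P> B" for P Q
  proof -
    have "\<Union>P \<inter> \<Union>Q = {}" using that \<open>A \<inter> B = {}\<close> unfolding \<P>_def by blast
    then have PQ: "P \<union> Q \<in> \<P> (A \<union> B)"
      using that \<open>A \<inter> B = {}\<close> by (auto simp: \<P>_def intro!: disjoint_union)
    \<comment> \<open>The two families lie in disjoint sets but may both contain the empty set; this
      is their only overlap, and \<open>\<mu>\<close> vanishes there.\<close>
    have "C = {}" if "C \<in> P \<inter> Q" for C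
      using that \<open>P \<in> \<P> A\<close> \<open>Q \<in> \<P> B\<close> \<open>A \<inter> B = {}\<close> unfolding \<P>_def by blast
    then have "(\<Sum>C\<in>P \<inter> Q. ennreal (norm (\<mu> C))) = 0"
      using bounded_vector_measure_empty[OF \<mu>] by (intro sum.neutral ballI) fastforce
    moreover have "(\<Sum>C\<in>P. ennreal (norm (\<mu> C))) + (\<Sum>C\<in>Q. ennreal (norm (\<mu> C))) =
        (\<Sum>C\<in>P \<union> Q. ennreal (norm (\<mu> C))) + (\<Sum>C\<in>P \<inter> Q. ennreal (norm (\<mu> C)))"
      using that by (intro sum.union_inter[symmetric]) (auto simp: \<P>_def)
    ultimately have "(\<Sum>C\<in>P. ennreal (norm (\<mu> C))) + (\<Sum>C\<in>Q. ennreal (norm (\<mu> C))) =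
        (\<Sum>C\<in>P \<union> Q. ennreal (norm (\<mu> C)))" by simp
    also have "\<dots> \<le> variation M \<mu> (A \<union> B)"
      unfolding variation_def \<P>_def[symmetric] by (rule SUP_upper[OF PQ])
    finally show ?thesis .
  qed
  then show ?thesis
    unfolding variation_def[of M \<mu> A] variation_def[of M \<mu> B] \<P>_def[symmetric]
    using ne by (simp add: ennreal_SUP_add_left[symmetric] ennreal_SUP_add_right SUP_le_iff)
qed

lemma norm_sums_le_suminf:
  fixes f :: "nat \<Rightarrow> 'a::real_normed_vector"
  assumes "f sums s"
  shows "ennreal (norm s) \<le> (\<Sum>i. ennreal (norm (f i)))"
proof (rule LIMSEQ_le_const2)
  have "(\<lambda>n. norm (\<Sum>i<n. f i)) \<longlonglongrightarrow> norm s"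
    using assms by (intro tendsto_norm) (simp add: sums_def)
  then show "(\<lambda>n. ennreal (norm (\<Sum>i<n. f i))) \<longlonglongrightarrow> ennreal (norm s)"
    by (rule tendsto_ennrealI)
  have "ennreal (norm (\<Sum>i<n. f i)) \<le> (\<Sum>i. ennreal (norm (f i)))" for n
  proof -
    have "ennreal (norm (\<Sum>i<n. f i)) \<le> ennreal (\<Sum>i<n. norm (f i))"
      by (intro ennreal_leI norm_sum)
    also have "\<dots> = (\<Sum>i<n. ennreal (norm (f i)))" by (simp add: sum_ennreal)
    also have "\<dots> \<le> (\<Sum>i. ennreal (norm (f i)))" by (intro sum_le_suminf) auto
    finally show ?thesis .
  qed
  then show "\<exists>N. \<forall>n\<ge>N. ennreal (norm (\<Sum>i<n. f i)) \<le> (\<Sum>i. ennreal (norm (f i)))" by blast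
qed

text \<open>Each member of a finite disjoint family is cut along the sets \<open>A i\<close>; for
  fixed \<open>i\<close> the pieces form a family that competes in the variation on
  \<open>A i\<close>.\<close>

lemma variation_countable_subadditive:
  assumes \<mu>: "bounded_vector_measure M \<mu>" and A: "range A \<subseteq> sets M" "disjoint_family A"
  shows "variation M \<mu> (\<Union>i. A i) \<le> (\<Sum>i. variation M \<mu> (A i))"
  unfolding variation_def[of M \<mu> "\<Union>i. A i"]
proof (rule SUP_least)
  fix P assume "P \<in> {P. finite P \<and> P \<subseteq> sets M \<and> disjoint P \<and> \<Union>P \<subseteq> (\<Union>i. A i)}"
  then have P: "finite P" "P \<subseteq> sets M" "disjoint P" "\<Union>P \<subseteq> (\<Union>i. A i)" by auto
  have "(\<Sum>B\<in>P. ennreal (norm (\<mu> B))) \<le> (\<Sum>B\<in>P. \<Sum>i. ennreal (norm (\<mu> (B \<inter> A i))))"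
  proof (rule sum_mono)
    fix B assume B: "B \<in> P"
    have "(\<lambda>i. \<mu> (B \<inter> A i)) sums \<mu> (\<Union>i. B \<inter> A i)"
      using A B P by (intro bounded_vector_measure_sums[OF \<mu>]) (auto simp: disjoint_family_on_def)
    moreover have "(\<Union>i. B \<inter> A i) = B" using B P(4) by blast
    ultimately show "ennreal (norm (\<mu> B)) \<le> (\<Sum>i. ennreal (norm (\<mu> (B \<inter> A i))))"
      using norm_sums_le_suminf by metis
  qed
  also have "\<dots> = (\<Sum>i. \<Sum>B\<in>P. ennreal (norm (\<mu> (B \<inter> A i))))"
    by (rule suminf_sum[symmetric]) auto
  also have "\<dots> \<le> (\<Sum>i. variation M \<mu> (A i))"
  proof (intro suminf_le allI)
    fix i
    have "(\<Sum>B\<in>P. ennreal (norm (\<mu> (B \<inter> A i)))) = (\<Sum>C\<in>(\<lambda>B. B \<inter> A i) ` P. ennreal (norm (\<mu> C)))"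
    proof (subst sum.reindex_nontrivial[OF P(1)])
      \<comment> \<open>Disjoint members can have the same trace on \<open>A i\<close> only if that
        trace is empty, so passing to the image set loses no mass.\<close>
      fix B C assume "B \<in> P" "C \<in> P" "B \<noteq> C" "B \<inter> A i = C \<inter> A i"
      then have "B \<inter> A i = {}" using P(3) by (auto simp: disjoint_def)
      then show "ennreal (norm (\<mu> (B \<inter> A i))) = 0"
        by (simp add: bounded_vector_measure_empty[OF \<mu>])
    qed simp
    also have "\<dots> \<le> variation M \<mu> (A i)"
      unfolding variation_def
    proof (rule SUP_upper, intro CollectI conjI)
      show "(\<lambda>B. B \<inter> A i) ` P \<subseteq> sets M" using P A by auto
      show "disjoint ((\<lambda>B. B \<inter> A i) ` P)" using P(3) by (auto simp: disjoint_def)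
    qed (use P in auto)
    finally show "(\<Sum>B\<in>P. ennreal (norm (\<mu> (B \<inter> A i)))) \<le> variation M \<mu> (A i)" .
  qed auto
  finally show "(\<Sum>B\<in>P. ennreal (norm (\<mu> B))) \<le> (\<Sum>i. variation M \<mu> (A i))" .
qed

lemma variation_empty:
  assumes "bounded_vector_measure M \<mu>"
  shows "variation M \<mu> {} = 0"
proof -
  have "(\<Sum>B\<in>P. ennreal (norm (\<mu> B))) = 0" if "\<Union>P \<subseteq> {}" for P
    using that bounded_vector_measure_empty[OF assms] by (intro sum.neutral) auto
  then show ?thesis
    unfolding variation_def by (intro antisym SUP_least) auto
qed

text \<open>Superadditivity bounds the finite partial sums and monotonicity passes to the limit.
  This is what keeps \<open>variation_measure\<close> from being the default zero measure of
  \<open>measure_of\<close>.\<close>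

lemma variation_countably_additive:
  assumes \<mu>: "bounded_vector_measure M \<mu>"
  shows "countably_additive (sets M) (variation M \<mu>)"
proof (rule countably_additiveI)
  fix A :: "nat \<Rightarrow> 'a set" assume A: "range A \<subseteq> sets M" "disjoint_family A"
  have "(\<Sum>i<n. variation M \<mu> (A i)) \<le> variation M \<mu> (\<Union>i<n. A i)" for n
  proof (induction n)
    case 0
    then show ?case by simp
  next
    case (Suc n)
    have "(\<Sum>i<Suc n. variation M \<mu> (A i)) \<le> variation M \<mu> (\<Union>i<n. A i) + variation M \<mu> (A n)"
      using Suc by (simp add: add_mono)
    also have "\<dots> \<le> variation M \<mu> ((\<Union>i<n. A i) \<union> A n)"
    proof (rule variation_superadditive[OF \<mu>])
      have "A i \<inter> A n = {}" if "i < n" for i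
        using A(2) that by (auto simp: disjoint_family_on_def)
      then show "(\<Union>i<n. A i) \<inter> A n = {}" by blast
    qed
    also have "(\<Union>i<n. A i) \<union> A n = (\<Union>i<Suc n. A i)" by (auto simp: less_Suc_eq)
    finally show ?case .
  qed
  then have "(\<Sum>i<n. variation M \<mu> (A i)) \<le> variation M \<mu> (\<Union>i. A i)" for n
    by (rule order_trans) (intro variation_mono, auto)
  then have "(\<Sum>i. variation M \<mu> (A i)) \<le> variation M \<mu> (\<Union>i. A i)"
    by (intro suminf_le_const) auto
  then show "(\<Sum>i. variation M \<mu> (A i)) = variation M \<mu> (\<Union>i. A i)"
    using variation_countable_subadditive[OF \<mu> A] by (rule antisym)
qed

lemma sets_variation_measure [simp, measurable_cong]: "sets (variation_measure M \<mu>) = sets M"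
  unfolding variation_measure_def by (simp add: sets.space_closed sets.sigma_sets_eq)

lemma space_variation_measure [simp]: "space (variation_measure M \<mu>) = space M"
  unfolding variation_measure_def by (simp add: sets.space_closed)

lemma emeasure_variation_measure:
  assumes "bounded_vector_measure M \<mu>" "A \<in> sets M"
  shows "emeasure (variation_measure M \<mu>) A = variation M \<mu> A"
  unfolding variation_measure_def
  using assms sets.sigma_algebra_axioms
  by (intro emeasure_measure_of_sigma variation_countably_additive)
    (auto simp: positive_def variation_empty)

lemma finite_measure_variation_measure:
  assumes "bounded_vector_measure M \<mu>"
  shows "finite_measure (variation_measure M \<mu>)"
  using assms
  by (intro finite_measureI)
    (auto simp: emeasure_variation_measure bounded_vector_measure_def)

lemma norm_le_measure_variation:
  assumes "bounded_vector_measure M \<mu>" "A \<in> sets M"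
  shows "norm (\<mu> A) \<le> measure (variation_measure M \<mu>) A"
proof -
  interpret finite_measure "variation_measure M \<mu>" by (rule finite_measure_variation_measure) fact
  have "ennreal (norm (\<mu> A)) \<le> emeasure (variation_measure M \<mu>) A"
    using assms by (simp add: emeasure_variation_measure norm_le_variation)
  then show ?thesis by (simp add: emeasure_eq_measure)
qed

text \<open>The vanishing is asked for on \<open>sets M\<close> alone because singular parts are
  controlled on Borel sets only. The conclusion extends to every \<open>A\<close>, since
  \<open>emeasure\<close> is 0 off the sigma-algebra.\<close>

lemma null_measure_variation:
  assumes "\<And>A. A \<in> sets M \<Longrightarrow> \<mu> A = 0"
  shows "emeasure (variation_measure M \<mu>) A = 0"
proof -
  have "(\<Sum>B\<in>P. ennreal (norm (\<mu> B))) = 0" if "P \<subseteq> sets M" for P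
    using that assms by (intro sum.neutral) auto
  then have "variation M \<mu> A = 0" for A
    unfolding variation_def by (intro antisym SUP_least) auto
  then show ?thesis
    unfolding variation_measure_def by (simp add: emeasure_measure_of_conv)
qed

lemma integral_variation_measure_eq_0:
  assumes "\<And>A. A \<in> sets M \<Longrightarrow> \<mu> A = 0"
  shows "(LINT x|variation_measure M \<mu>. f x) = 0"
proof -
  have "AE x in variation_measure M \<mu>. f x = 0"
    by (rule AE_I[of _ _ "space M"]) (auto simp: null_measure_variation assms)
  then show ?thesis by (rule integral_eq_zero_AE)
qed

text \<open>The Radon--Nikodym theorem is applied to the nonnegative set function \<open>\<mu> + N\<close>.\<close>

lemma signed_Radon_Nikodym:
  fixes \<mu> :: "'a set \<Rightarrow> real"
  assumes "sigma_finite_measure M" "finite_measure N" and ac: "absolutely_continuous M N"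
    and sets_N: "sets N = sets M"
    and sums: "\<And>A. range A \<subseteq> sets M \<Longrightarrow> disjoint_family A \<Longrightarrow> (\<lambda>i::nat. \<mu> (A i)) sums \<mu> (\<Union>i. A i)"
    and le: "\<And>A. A \<in> sets M \<Longrightarrow> \<bar>\<mu> A\<bar> \<le> measure N A"
  obtains h where "integrable M h" "\<And>A. A \<in> sets M \<Longrightarrow> \<mu> A = (LINT x:A|M. h x)"
proof -
  interpret M: sigma_finite_measure M by fact
  interpret N: finite_measure N by fact
  have RN: "\<exists>h. integrable M h \<and> (\<forall>A\<in>sets M. measure K A = (LINT x:A|M. h x))"
    if finK: "finite_measure K" and acK: "absolutely_continuous M K" and K: "sets K = sets M" for K
  proof -
    interpret K: finite_measure K by fact
    obtain D where D: "D \<in> borel_measurable M" "AE x in M. RN_deriv M K x = ennreal (D x)" "\<And>x. 0 \<le> D x"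
      using M.real_RN_deriv[OF finK acK K] by metis
    have "density M D = density M (RN_deriv M K)"
      using D by (intro density_cong) auto
    also have "\<dots> = K" by (rule M.density_RN_deriv[OF acK K])
    finally have K_eq: "density M D = K" .
    have K_D: "emeasure K A = (\<integral>\<^sup>+x. ennreal (D x) * indicator A x \<partial>M)" if "A \<in> sets M" for A
      using D that unfolding K_eq[symmetric] by (intro emeasure_density) auto
    have "integrable M D"
    proof (rule integrableI_nonneg)
      have "(\<integral>\<^sup>+x. ennreal (D x) \<partial>M) = (\<integral>\<^sup>+x. ennreal (D x) * indicator (space M) x \<partial>M)"
        by (intro nn_integral_cong) auto
      also have "\<dots> = emeasure K (space M)" by (simp add: K_D)
      finally show "(\<integral>\<^sup>+x. ennreal (D x) \<partial>M) < \<infinity>" by (simp add: K.emeasure_eq_measure)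
    qed (use D in auto)
    moreover have "measure K A = (LINT x:A|M. D x)" if "A \<in> sets M" for A
    proof -
      have "emeasure K A = (\<integral>\<^sup>+x. ennreal (indicator A x * D x) \<partial>M)"
        unfolding K_D[OF that] by (intro nn_integral_cong) (auto simp: indicator_def)
      also have "\<dots> = ennreal (LINT x|M. indicator A x * D x)"
        using \<open>integrable M D\<close> D(3) that integrable_mult_indicator[of A M D] by (intro nn_integral_eq_integral) auto
      finally show ?thesis
        using D(3) by (simp add: set_lebesgue_integral_def K.emeasure_eq_measure)
    qed
    ultimately show ?thesis by blast
  qed
  define K where "K = measure_of (space M) (sets M) (\<lambda>A. ennreal (\<mu> A + measure N A))"
  have nonneg: "0 \<le> \<mu> A + measure N A" if "A \<in> sets M" for A using le[OF that] by linarith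
  have "\<bar>\<mu> {}\<bar> \<le> 0" using le[of "{}"] by simp
  then have "positive (sets M) (\<lambda>A. ennreal (\<mu> A + measure N A))" by (simp add: positive_def)
  moreover have "countably_additive (sets M) (\<lambda>A. ennreal (\<mu> A + measure N A))"
  proof (rule countably_additiveI)
    fix A :: "nat \<Rightarrow> 'a set" assume A: "range A \<subseteq> sets M" "disjoint_family A"
    have "(\<lambda>i. \<mu> (A i) + measure N (A i)) sums (\<mu> (\<Union>i. A i) + measure N (\<Union>i. A i))"
      using A sets_N by (intro sums_add sums N.finite_measure_UNION) auto
    then show "(\<Sum>i. ennreal (\<mu> (A i) + measure N (A i))) = ennreal (\<mu> (\<Union>i. A i) + measure N (\<Union>i. A i))"
      using A nonneg by (intro suminf_ennreal_eq) auto
  qed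
  ultimately have K: "emeasure K A = ennreal (\<mu> A + measure N A)" if "A \<in> sets M" for A
    using that sets.sigma_algebra_axioms unfolding K_def by (intro emeasure_measure_of_sigma)
  have sets_K: "sets K = sets M" and space_K: "space K = space M"
    unfolding K_def by (auto simp: sets.space_closed sets.sigma_sets_eq)
  have fin: "finite_measure K" by (rule finite_measureI) (simp add: space_K K)
  have "absolutely_continuous M K"
    unfolding absolutely_continuous_def
  proof
    fix A assume A: "A \<in> null_sets M"
    then have "A \<in> null_sets N" using ac by (auto simp: absolutely_continuous_def)
    then have "measure N A = 0" by (simp add: measure_def null_setsD1)
    then have "\<mu> A = 0" using le[of A] A by auto
    with \<open>measure N A = 0\<close> A show "A \<in> null_sets K"
      by (auto simp: null_sets_def sets_K K)
  qed
  then obtain h1 where h1: "integrable M h1" "\<And>A. A \<in> sets M \<Longrightarrow> measure K A = (LINT x:A|M. h1 x)"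
    using RN[OF fin _ sets_K] by auto
  obtain h2 where h2: "integrable M h2" "\<And>A. A \<in> sets M \<Longrightarrow> measure N A = (LINT x:A|M. h2 x)"
    using RN[OF assms(2) ac sets_N] by auto
  show ?thesis
  proof
    show "integrable M (\<lambda>x. h1 x - h2 x)" using h1 h2 by simp
    fix A assume A: "A \<in> sets M"
    have "set_integrable M A h1" "set_integrable M A h2"
      unfolding set_integrable_def by (rule integrable_mult_indicator[OF A h1(1)],
        rule integrable_mult_indicator[OF A h2(1)])
    then have "(LINT x:A|M. h1 x - h2 x) = measure K A - measure N A"
      using A h1 h2 by (simp add: set_integral_diff)
    also have "\<dots> = \<mu> A" using A nonneg by (simp add: measure_def[of K] K)
    finally show "\<mu> A = (LINT x:A|M. h1 x - h2 x)" ..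
  qed
qed

text \<open>Each component in an orthonormal basis is a signed set function dominated by the same
  \<open>N\<close>, so the scalar densities can be assembled into a vector.\<close>

lemma vector_Radon_Nikodym:
  fixes \<mu> :: "'a set \<Rightarrow> 'b::euclidean_space"
  assumes "sigma_finite_measure M" "finite_measure N" "absolutely_continuous M N" "sets N = sets M"
    and sums: "\<And>A. range A \<subseteq> sets M \<Longrightarrow> disjoint_family A \<Longrightarrow> (\<lambda>i::nat. \<mu> (A i)) sums \<mu> (\<Union>i. A i)"
    and le: "\<And>A. A \<in> sets M \<Longrightarrow> norm (\<mu> A) \<le> measure N A"
  obtains h where "integrable M h" "\<And>A. A \<in> sets M \<Longrightarrow> \<mu> A = (LINT x:A|M. h x)"
proof -
  have "\<exists>h. integrable M h \<and> (\<forall>A\<in>sets M. \<mu> A \<bullet> b = (LINT x:A|M. h x))" if b: "b \<in> Basis" for b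
  proof (rule signed_Radon_Nikodym[OF assms(1-4), of "\<lambda>A. \<mu> A \<bullet> b"])
    show "(\<lambda>i. \<mu> (A i) \<bullet> b) sums (\<mu> (\<Union>i. A i) \<bullet> b)"
      if "range A \<subseteq> sets M" "disjoint_family A" for A :: "nat \<Rightarrow> 'a set"
      using bounded_linear.sums[OF bounded_linear_inner_left sums[OF that]] .
    show "\<bar>\<mu> A \<bullet> b\<bar> \<le> measure N A" if "A \<in> sets M" for A
      using Basis_le_norm[OF b] le[OF that] by (rule order_trans)
  qed blast
  then obtain h where h: "\<And>b. b \<in> Basis \<Longrightarrow> integrable M (h b)"
    "\<And>b A. b \<in> Basis \<Longrightarrow> A \<in> sets M \<Longrightarrow> \<mu> A \<bullet> b = (LINT x:A|M. h b x)"
    by metis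
  show ?thesis
  proof
    show int: "integrable M (\<lambda>x. \<Sum>b\<in>Basis. h b x *\<^sub>R b)"
      using h(1) by (intro Bochner_Integration.integrable_sum integrable_scaleR_left) auto
    fix A assume A: "A \<in> sets M"
    have "(LINT x:A|M. \<Sum>b\<in>Basis. h b x *\<^sub>R b) = (\<Sum>b\<in>Basis. (LINT x:A|M. h b x) *\<^sub>R b)"
    proof -
      have "(LINT x:A|M. \<Sum>b\<in>Basis. h b x *\<^sub>R b) =
          (LINT x|M. (\<Sum>b\<in>Basis. (indicator A x *\<^sub>R h b x) *\<^sub>R b))"
        unfolding set_lebesgue_integral_def
        by (intro Bochner_Integration.integral_cong) (auto simp: scaleR_sum_right)
      also have "\<dots> = (\<Sum>b\<in>Basis. (LINT x|M. (indicator A x *\<^sub>R h b x) *\<^sub>R b))"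
        using h(1) A
        by (intro Bochner_Integration.integral_sum integrable_scaleR_left integrable_mult_indicator) auto
      also have "\<dots> = (\<Sum>b\<in>Basis. (LINT x:A|M. h b x) *\<^sub>R b)"
        unfolding set_lebesgue_integral_def
        using h(1) A
        by (intro sum.cong refl integral_scaleR_left integrable_mult_indicator) auto
      finally show ?thesis .
    qed
    also have "\<dots> = (\<Sum>b\<in>Basis. (\<mu> A \<bullet> b) *\<^sub>R b)" using h(2)[OF _ A] by simp
    finally show "\<mu> A = (LINT x:A|M. \<Sum>b\<in>Basis. h b x *\<^sub>R b)"
      by (simp add: euclidean_representation)
  qed
qed

text \<open>The variation dominates \<open>\<mu>\<close>, so Radon--Nikodym with the variation in
  the role of both \<open>M\<close> and \<open>N\<close> yields a density; hence the choice in
  \<open>polar_density\<close> has a witness and inherits its properties.\<close>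

lemma polar_density:
  fixes \<mu> :: "'a set \<Rightarrow> 'b::euclidean_space"
  assumes \<mu>: "bounded_vector_measure M \<mu>"
  shows "integrable (variation_measure M \<mu>) (polar_density M \<mu>)"
    and "\<And>A. A \<in> sets M \<Longrightarrow> \<mu> A = (LINT x:A|variation_measure M \<mu>. polar_density M \<mu> x)"
proof -
  interpret finite_measure "variation_measure M \<mu>" by (rule finite_measure_variation_measure) fact
  obtain h where "integrable (variation_measure M \<mu>) h"
    "\<And>A. A \<in> sets (variation_measure M \<mu>) \<Longrightarrow> \<mu> A = (LINT x:A|variation_measure M \<mu>. h x)"
    by (rule vector_Radon_Nikodym[of "variation_measure M \<mu>" "variation_measure M \<mu>" \<mu>])
      (use bounded_vector_measure_sums[OF \<mu>] norm_le_measure_variation[OF \<mu>] in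
        \<open>auto simp: absolutely_continuous_def intro: sigma_finite_measure_axioms finite_measure_axioms\<close>)
  then have "\<exists>h. integrable (variation_measure M \<mu>) h \<and>
      (\<forall>A\<in>sets M. \<mu> A = (LINT x:A|variation_measure M \<mu>. h x))" by auto
  from someI_ex[OF this]
  show "integrable (variation_measure M \<mu>) (polar_density M \<mu>)"
    and "\<And>A. A \<in> sets M \<Longrightarrow> \<mu> A = (LINT x:A|variation_measure M \<mu>. polar_density M \<mu> x)"
    unfolding polar_density_def by auto
qed

text \<open>The set carrying the singular part is a null set of maximal measure.\<close>

lemma exists_maximal_null_set:
  assumes "finite_measure N" and sets_N: "sets N = sets M"
  obtains Z where "Z \<in> null_sets M" "\<And>A. A \<in> null_sets M \<Longrightarrow> A \<inter> Z = {} \<Longrightarrow> emeasure N A = 0"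
proof -
  interpret N: finite_measure N by fact
  define S where "S = measure N ` null_sets M"
  have S: "S \<noteq> {}" "bdd_above S"
    by (auto simp: S_def intro!: bdd_aboveI[of _ "measure N (space N)"] N.bounded_measure)
  have "\<exists>Z\<in>null_sets M. Sup S - inverse (real (Suc n)) < measure N Z" for n
  proof -
    have "Sup S - inverse (real (Suc n)) < Sup S" by simp
    then show ?thesis unfolding less_cSup_iff[OF S] by (auto simp: S_def)
  qed
  then obtain Z where Z: "\<And>n. Z n \<in> null_sets M" "\<And>n. Sup S - inverse (real (Suc n)) < measure N (Z n)"
    by metis
  define Y where "Y = (\<Union>n. Z n)"
  have Y: "Y \<in> null_sets M" unfolding Y_def using Z(1) by (rule null_sets_UN)
  have YN: "Sup S \<le> measure N Y"
  proof (rule LIMSEQ_le_const2)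
    show "(\<lambda>n. Sup S - inverse (real (Suc n))) \<longlonglongrightarrow> Sup S"
      using tendsto_diff[OF tendsto_const LIMSEQ_inverse_real_of_nat, of "Sup S"] by simp
    have "Sup S - inverse (real (Suc n)) \<le> measure N Y" for n
    proof -
      have "measure N (Z n) \<le> measure N Y"
        using Y by (intro N.finite_measure_mono) (auto simp: Y_def sets_N)
      with Z(2)[of n] show ?thesis by linarith
    qed
    then show "\<exists>k. \<forall>n\<ge>k. Sup S - inverse (real (Suc n)) \<le> measure N Y" by blast
  qed
  show ?thesis
  proof
    show "Y \<in> null_sets M" by (rule Y)
    fix A assume A: "A \<in> null_sets M" "A \<inter> Y = {}"
    \<comment> \<open>Since \<open>Y\<close> attains the supremum, a disjoint null set of positive
      \<open>N\<close>-measure would push the union above it.\<close>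
    have "measure N A + measure N Y = measure N (A \<union> Y)"
      using A Y by (intro N.finite_measure_Union[symmetric]) (auto simp: sets_N)
    also have "\<dots> \<le> Sup S"
      using A Y S by (intro cSup_upper) (auto simp: S_def)
    finally have "measure N A = 0" using YN measure_nonneg[of N A] by linarith
    then show "emeasure N A = 0" by (simp add: N.emeasure_eq_measure)
  qed
qed

section \<open>Lebesgue decomposition of a bounded vector measure\<close>

lemma set_lebesgue_integral_restrict_space:
  fixes a :: "'a \<Rightarrow> 'b::{banach, second_countable_topology}"
  assumes "\<Omega> \<in> sets M" "A \<subseteq> \<Omega>"
  shows "(LINT x:A|restrict_space M \<Omega>. a x) = (LINT x:A|M. a x)"
  using assms sets.sets_into_space[OF assms(1)]
  by (auto simp: set_lebesgue_integral_def integral_restrict_space Int_absorb2 indicator_def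
      intro!: Bochner_Integration.integral_cong)

text \<open>Take a Lebesgue null set \<open>Z\<close> carrying as much of the variation as a null
  set can. Off \<open>Z\<close> the variation is absolutely continuous, so
  \<open>\<mu> (A - Z)\<close> has a density, and \<open>\<mu> (A \<inter> Z)\<close> is the
  singular part.\<close>

lemma lebesgue_decomposition_exists:
  fixes \<mu> :: "'a::euclidean_space set \<Rightarrow> 'b::euclidean_space"
  assumes \<mu>: "bounded_vector_measure (borel_on \<Omega>) \<mu>" and \<Omega>: "\<Omega> \<in> sets borel"
  shows "\<exists>a \<sigma>. lebesgue_decomposition \<Omega> \<mu> a \<sigma>"
proof -
  define M where "M = restrict_space lborel \<Omega>"
  define V where "V = variation_measure (borel_on \<Omega>) \<mu>"
  have \<Omega>': "\<Omega> \<in> sets lborel" using \<Omega> by simp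
  have sets_M: "sets M = sets (borel_on \<Omega>)" unfolding M_def by (rule sets_restrict_space_cong) simp
  have sets_V: "sets V = sets M" by (simp add: V_def sets_M)
  interpret V: finite_measure V unfolding V_def by (rule finite_measure_variation_measure[OF \<mu>])
  obtain Z where Z: "Z \<in> null_sets M" "\<And>A. A \<in> null_sets M \<Longrightarrow> A \<inter> Z = {} \<Longrightarrow> emeasure V A = 0"
    using exists_maximal_null_set[OF V.finite_measure_axioms sets_V] by metis
  have Z': "Z \<in> sets M" using Z by auto
  define N where "N = density V (indicator (space M - Z))"
  have N: "emeasure N A = emeasure V (A - Z)" if "A \<in> sets M" for A
  proof -
    have "emeasure N A = (\<integral>\<^sup>+x. indicator (space M - Z) x * indicator A x \<partial>V)"
      unfolding N_def using that Z' sets_V by (intro emeasure_density) auto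
    also have "\<dots> = (\<integral>\<^sup>+x. indicator (A - Z) x \<partial>V)"
      using sets.sets_into_space[OF that] by (intro nn_integral_cong) (auto simp: indicator_def)
    also have "\<dots> = emeasure V (A - Z)" using that Z' sets_V by simp
    finally show ?thesis .
  qed
  have sets_N: "sets N = sets M" by (simp add: N_def sets_V)
  have fin_N: "finite_measure N"
    by (rule finite_measureI) (simp add: sets_eq_imp_space_eq[OF sets_N] N V.emeasure_eq_measure)
  have ac: "absolutely_continuous M N"
    unfolding absolutely_continuous_def
  proof
    fix A assume A: "A \<in> null_sets M"
    then have "A - Z \<in> null_sets M" using Z' by (rule null_set_Diff)
    then have "emeasure V (A - Z) = 0" using Z(2) by blast
    then show "A \<in> null_sets N" using A by (auto simp: null_sets_def sets_N N)
  qed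
  interpret L: sigma_finite_measure M
    unfolding M_def by (rule sigma_finite_measure_restrict_space[OF sigma_finite_lborel \<Omega>'])
  obtain a where a: "integrable M a" "\<And>A. A \<in> sets M \<Longrightarrow> \<mu> (A - Z) = (LINT x:A|M. a x)"
  proof (rule vector_Radon_Nikodym[OF L.sigma_finite_measure_axioms fin_N ac sets_N, of "\<lambda>A. \<mu> (A - Z)"])
    show "(\<lambda>i. \<mu> (A i - Z)) sums \<mu> ((\<Union>i. A i) - Z)"
      if "range A \<subseteq> sets M" "disjoint_family A" for A :: "nat \<Rightarrow> 'a set"
    proof -
      have "(\<lambda>i. \<mu> (A i - Z)) sums \<mu> (\<Union>i. A i - Z)"
        using that Z' by (intro bounded_vector_measure_sums[OF \<mu>])
          (auto simp: disjoint_family_on_def sets_M[symmetric])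
      then show ?thesis by simp
    qed
    show "norm (\<mu> (A - Z)) \<le> measure N A" if "A \<in> sets M" for A
    proof -
      have "norm (\<mu> (A - Z)) \<le> measure V (A - Z)"
        unfolding V_def using that Z' sets_M by (intro norm_le_measure_variation[OF \<mu>]) auto
      also have "\<dots> = measure N A" using N[OF that] by (simp add: measure_def)
      finally show ?thesis .
    qed
  qed (rule that)
  have "set_integrable lborel \<Omega> a"
    using a(1) \<Omega>' by (simp add: M_def set_integrable_def integrable_restrict_space)
  moreover have "bounded_vector_measure (borel_on \<Omega>) (\<lambda>A. \<mu> (A \<inter> Z))"
    unfolding bounded_vector_measure_def
  proof (intro conjI allI impI)
    fix A :: "nat \<Rightarrow> 'a set" assume "range A \<subseteq> sets (borel_on \<Omega>) \<and> disjoint_family A"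
    then have "(\<lambda>i. \<mu> (A i \<inter> Z)) sums \<mu> (\<Union>i. A i \<inter> Z)"
      using Z' by (intro bounded_vector_measure_sums[OF \<mu>])
        (auto simp: disjoint_family_on_def sets_M[symmetric])
    then show "(\<lambda>i. \<mu> (A i \<inter> Z)) sums \<mu> ((\<Union>i. A i) \<inter> Z)" by simp
  next
    \<comment> \<open>The restriction to \<open>Z\<close> has finite variation because a disjoint
      family cut down to \<open>Z\<close> competes in the variation of \<open>\<mu>\<close>.\<close>
    have "variation (borel_on \<Omega>) (\<lambda>A. \<mu> (A \<inter> Z)) B \<le> variation (borel_on \<Omega>) \<mu> B" for B
      unfolding variation_def[of _ "\<lambda>A. \<mu> (A \<inter> Z)"]
    proof (rule SUP_least)
      fix P assume "P \<in> {P. finite P \<and> P \<subseteq> sets (borel_on \<Omega>) \<and> disjoint P \<and> \<Union>P \<subseteq> B}"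
      then have P: "finite P" "P \<subseteq> sets (borel_on \<Omega>)" "disjoint P" "\<Union>P \<subseteq> B" by auto
      have "(\<Sum>B\<in>P. ennreal (norm (\<mu> (B \<inter> Z)))) = (\<Sum>C\<in>(\<lambda>B. B \<inter> Z) ` P. ennreal (norm (\<mu> C)))"
      proof (subst sum.reindex_nontrivial[OF P(1)])
        fix B C assume "B \<in> P" "C \<in> P" "B \<noteq> C" "B \<inter> Z = C \<inter> Z"
        then have "B \<inter> Z = {}" using P(3) by (auto simp: disjoint_def)
        then show "ennreal (norm (\<mu> (B \<inter> Z))) = 0"
          by (simp add: bounded_vector_measure_empty[OF \<mu>])
      qed simp
      also have "\<dots> \<le> variation (borel_on \<Omega>) \<mu> B"
        unfolding variation_def
      proof (rule SUP_upper, intro CollectI conjI)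
        show "(\<lambda>B. B \<inter> Z) ` P \<subseteq> sets (borel_on \<Omega>)" using P Z' by (auto simp: sets_M[symmetric])
        show "disjoint ((\<lambda>B. B \<inter> Z) ` P)" using P(3) by (auto simp: disjoint_def)
      qed (use P in auto)
      finally show "(\<Sum>B\<in>P. ennreal (norm (\<mu> (B \<inter> Z)))) \<le> variation (borel_on \<Omega>) \<mu> B" .
    qed
    then show "variation (borel_on \<Omega>) (\<lambda>A. \<mu> (A \<inter> Z)) (space (borel_on \<Omega>)) < \<infinity>"
      using \<mu> unfolding bounded_vector_measure_def by (blast intro: order.strict_trans1)
  qed
  moreover have "emeasure lborel Z = 0"
    using Z(1) \<Omega>' by (auto simp: M_def null_sets_restrict_space)
  moreover have "\<mu> A = (LINT x:A|lborel. a x) + \<mu> (A \<inter> Z)" if A: "A \<in> sets (borel_on \<Omega>)" for A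
  proof -
    have "A \<subseteq> \<Omega>" using A sets.sets_into_space[OF A] by (simp add: space_restrict_space)
    then have "(LINT x:A|lborel. a x) = \<mu> (A - Z)"
      using a(2)[of A] A \<Omega>' by (simp add: sets_M[symmetric] M_def set_lebesgue_integral_restrict_space)
    moreover have "\<mu> ((A - Z) \<union> (A \<inter> Z)) = \<mu> (A - Z) + \<mu> (A \<inter> Z)"
      using A Z' by (intro bounded_vector_measure_Un[OF \<mu>]) (auto simp: sets_M)
    ultimately show ?thesis by (simp add: Un_Diff_Int)
  qed
  moreover have "Z \<in> sets (borel_on \<Omega>)" using Z' by (simp add: sets_M)
  moreover have "\<mu> (A \<inter> Z) = \<mu> (A \<inter> Z \<inter> Z)" for A by (simp add: Int_assoc)
  ultimately have "lebesgue_decomposition \<Omega> \<mu> a (\<lambda>A. \<mu> (A \<inter> Z))"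
    unfolding lebesgue_decomposition_def by blast
  then show ?thesis by blast
qed

text \<open>The choice of the density leaves its partner \<open>\<sigma>\<close> existentially
  bound, but on Borel subsets of \<open>\<Omega>\<close> the decomposition determines
  \<open>\<sigma>\<close> as the difference defining \<open>singular_part\<close>, and variation
  looks at those sets only.\<close>

lemma ac_density_singular_part:
  fixes \<mu> :: "'a::euclidean_space set \<Rightarrow> 'b::euclidean_space"
  assumes \<mu>: "bounded_vector_measure (borel_on \<Omega>) \<mu>" and \<Omega>: "\<Omega> \<in> sets borel"
  shows "lebesgue_decomposition \<Omega> \<mu> (ac_density \<Omega> \<mu>) (singular_part \<Omega> \<mu>)"
proof -
  obtain \<sigma> where \<sigma>: "lebesgue_decomposition \<Omega> \<mu> (ac_density \<Omega> \<mu>) \<sigma>"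
    using someI_ex[OF lebesgue_decomposition_exists[OF assms]] unfolding ac_density_def by blast
  have eq: "singular_part \<Omega> \<mu> A = \<sigma> A" if "A \<in> sets (borel_on \<Omega>)" for A
    using \<sigma> that by (simp add: lebesgue_decomposition_def singular_part_def)
  have "variation (borel_on \<Omega>) (singular_part \<Omega> \<mu>) B = variation (borel_on \<Omega>) \<sigma> B" for B
    unfolding variation_def by (intro SUP_cong sum.cong refl) (auto simp: eq subset_iff)
  moreover have "(\<lambda>i. singular_part \<Omega> \<mu> (A i)) sums singular_part \<Omega> \<mu> (\<Union>i. A i)"
    if "range A \<subseteq> sets (borel_on \<Omega>)" "disjoint_family A" for A :: "nat \<Rightarrow> 'a set"
    using that \<sigma> bounded_vector_measure_sums[of "borel_on \<Omega>" \<sigma> A]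
    by (simp add: lebesgue_decomposition_def eq range_subsetD sets.countable_UN)
  ultimately have "bounded_vector_measure (borel_on \<Omega>) (singular_part \<Omega> \<mu>)"
    using \<sigma> by (simp add: lebesgue_decomposition_def bounded_vector_measure_def)
  moreover have "A \<inter> N \<in> sets (borel_on \<Omega>)"
    if "A \<in> sets (borel_on \<Omega>)" "N \<in> sets (borel_on \<Omega>)" for A N using that by blast
  ultimately show ?thesis
    using \<sigma> eq unfolding lebesgue_decomposition_def by metis
qed

section \<open>Calibrations\<close>

lemma bounded_vector_measure_zero: "bounded_vector_measure M (\<lambda>_. 0 :: 'b::euclidean_space)"
proof -
  have "variation M (\<lambda>_. 0 :: 'b) A = 0" for A
    unfolding variation_def by (intro antisym SUP_least) auto
  then show ?thesis by (simp add: bounded_vector_measure_def)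
qed

text \<open>The density is a choice, so even for the zero measure it is known only almost
  everywhere. Off the null set carrying the singular part, its integral over every Borel set is
  0.\<close>

lemma ac_density_zero:
  assumes \<Omega>: "\<Omega> \<in> sets borel"
  shows "AE x in lborel. x \<in> \<Omega> \<longrightarrow> ac_density \<Omega> (\<lambda>_. 0 :: 'b::euclidean_space) (x :: 'a::euclidean_space) = 0"
proof -
  define a where "a = ac_density \<Omega> (\<lambda>_. 0 :: 'b)"
  define \<sigma> where "\<sigma> = singular_part \<Omega> (\<lambda>_. 0 :: 'b)"
  from ac_density_singular_part[OF bounded_vector_measure_zero \<Omega>] have dec: "lebesgue_decomposition \<Omega> (\<lambda>_. 0) a \<sigma>"
    by (simp add: a_def \<sigma>_def)
  then obtain Z where Z: "Z \<in> sets (borel_on \<Omega>)" "emeasure lborel Z = 0"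
    "\<And>A. A \<in> sets (borel_on \<Omega>) \<Longrightarrow> \<sigma> A = \<sigma> (A \<inter> Z)"
    unfolding lebesgue_decomposition_def by blast
  have \<sigma>: "bounded_vector_measure (borel_on \<Omega>) \<sigma>" and int: "set_integrable lborel \<Omega> a"
    using dec by (auto simp: lebesgue_decomposition_def)
  have sets_\<Omega>: "A \<in> sets (borel_on \<Omega>) \<longleftrightarrow> A \<in> sets borel \<and> A \<subseteq> \<Omega>" for A
    using \<Omega> by (simp add: sets_restrict_space_iff conj_commute)
  have "AE x in lborel. indicator \<Omega> x *\<^sub>R a x = 0"
  proof (rule sigma_finite_measure.density_zero[OF sigma_finite_lborel])
    show "integrable lborel (\<lambda>x. indicator \<Omega> x *\<^sub>R a x)"
      using int by (simp add: set_integrable_def)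
    fix A :: "'a set" assume A: "A \<in> sets lborel"
    have B: "A \<inter> \<Omega> - Z \<in> sets (borel_on \<Omega>)"
      using A Z(1) \<Omega> by (auto simp: sets_\<Omega>)
    have "(LINT x:A|lborel. indicator \<Omega> x *\<^sub>R a x) = (LINT x:A \<inter> \<Omega> - Z|lborel. a x)"
      unfolding set_lebesgue_integral_def
    proof (rule integral_cong_AE)
      show "(\<lambda>x. indicator A x *\<^sub>R indicator \<Omega> x *\<^sub>R a x) \<in> borel_measurable lborel"
        using int A unfolding set_integrable_def
        by (intro borel_measurable_scaleR[OF borel_measurable_indicator borel_measurable_integrable])
      have "set_integrable lborel (A \<inter> \<Omega> - Z) a"
        by (rule set_integrable_subset[OF int]) (use B sets_\<Omega> in auto)
      then show "(\<lambda>x. indicator (A \<inter> \<Omega> - Z) x *\<^sub>R a x) \<in> borel_measurable lborel"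
        by (auto simp: set_integrable_def)
      have "AE x in lborel. x \<notin> Z"
        using Z by (intro AE_not_in) (auto simp: null_sets_def sets_\<Omega>)
      then show "AE x in lborel. indicator A x *\<^sub>R indicator \<Omega> x *\<^sub>R a x = indicator (A \<inter> \<Omega> - Z) x *\<^sub>R a x"
        by eventually_elim (auto simp: indicator_def)
    qed
    also have "\<dots> = - \<sigma> (A \<inter> \<Omega> - Z)"
      using dec B by (auto simp: lebesgue_decomposition_def eq_neg_iff_add_eq_0)
    also have "\<sigma> (A \<inter> \<Omega> - Z) = 0"
    proof -
      have "(A \<inter> \<Omega> - Z) \<inter> Z = {}" by blast
      then show ?thesis using Z(3)[OF B] bounded_vector_measure_empty[OF \<sigma>] by simp
    qed
    finally show "(LINT x:A|lborel. indicator \<Omega> x *\<^sub>R a x) = 0" by simp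
  qed
  then show ?thesis
    unfolding a_def[symmetric] by eventually_elim (auto simp: indicator_def)
qed

section \<open>Integrals of bounded fields against a decomposed vector measure\<close>

lemma integral_simple_function_mult:
  fixes s h :: "'a \<Rightarrow> real"
  assumes s: "simple_function M s" and h: "integrable M h"
  shows "(LINT x|M. s x * h x) = (\<Sum>y\<in>s ` space M. y * (LINT x:s -` {y} \<inter> space M|M. h x))"
proof -
  have meas: "s -` {y} \<inter> space M \<in> sets M" for y using s by (rule simple_functionD(2))
  have "(LINT x|M. s x * h x) =
      (LINT x|M. (\<Sum>y\<in>s ` space M. y * (indicator (s -` {y} \<inter> space M) x *\<^sub>R h x)))"
  proof (rule Bochner_Integration.integral_cong[OF refl])
    fix x assume "x \<in> space M"
    then have "(\<Sum>y\<in>s ` space M. y * (indicator (s -` {y} \<inter> space M) x *\<^sub>R h x)) =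
        (\<Sum>y\<in>s ` space M. if s x = y then y * h x else 0)"
      by (intro sum.cong) (auto simp: indicator_def)
    also have "\<dots> = s x * h x"
      using simple_functionD(1)[OF s] \<open>x \<in> space M\<close> by simp
    finally show "s x * h x = (\<Sum>y\<in>s ` space M. y * (indicator (s -` {y} \<inter> space M) x *\<^sub>R h x))" ..
  qed
  also have "\<dots> = (\<Sum>y\<in>s ` space M. LINT x|M. y * (indicator (s -` {y} \<inter> space M) x *\<^sub>R h x))"
    using h meas by (intro Bochner_Integration.integral_sum integrable_mult_right integrable_mult_indicator)
  also have "\<dots> = (\<Sum>y\<in>s ` space M. y * (LINT x:s -` {y} \<inter> space M|M. h x))"
    by (simp add: set_lebesgue_integral_def)
  finally show ?thesis .
qed

text \<open>An identity between three set functions, each with its own base measure, passes from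
  sets to simple functions and then to bounded ones by dominated convergence. In the application the
  bases are the variation of the gradient, Lebesgue measure and the variation of the singular
  part.\<close>

lemma integral_bounded_mult_split:
  fixes \<phi> h1 h2 h3 :: "'a \<Rightarrow> real"
  assumes sets: "sets M2 = sets M1" "sets M3 = sets M1"
    and h: "integrable M1 h1" "integrable M2 h2" "integrable M3 h3"
    and eq: "\<And>A. A \<in> sets M1 \<Longrightarrow> (LINT x:A|M1. h1 x) = (LINT x:A|M2. h2 x) + (LINT x:A|M3. h3 x)"
    and \<phi>: "\<phi> \<in> borel_measurable M1" "\<And>x. x \<in> space M1 \<Longrightarrow> \<bar>\<phi> x\<bar> \<le> C"
  shows "(LINT x|M1. \<phi> x * h1 x) = (LINT x|M2. \<phi> x * h2 x) + (LINT x|M3. \<phi> x * h3 x)"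
proof -
  have space: "space M2 = space M1" "space M3 = space M1"
    using sets by (auto dest: sets_eq_imp_space_eq)
  obtain F where F: "\<And>i. simple_function M1 (F i)"
    "\<And>x. x \<in> space M1 \<Longrightarrow> (\<lambda>i. F i x) \<longlonglongrightarrow> \<phi> x"
    "\<And>i x. x \<in> space M1 \<Longrightarrow> dist (F i x) 0 \<le> 2 * dist (\<phi> x) 0"
    using borel_measurable_implies_sequence_metric[OF \<phi>(1), of 0] by blast
  have simple: "simple_function M2 (F i)" "simple_function M3 (F i)" for i
    using F(1)[of i] by (auto simp: simple_function_def space sets)
  have lim: "(\<lambda>i. LINT x|M. F i x * h x) \<longlonglongrightarrow> (LINT x|M. \<phi> x * h x)"
    if M: "sets M = sets M1" and h: "integrable M h" for M and h :: "'a \<Rightarrow> real"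
  proof (rule integral_dominated_convergence[where w="\<lambda>x. 2 * C * norm (h x)"])
    have sp: "space M = space M1" using M by (rule sets_eq_imp_space_eq)
    have meas: "g \<in> borel_measurable M" if "g \<in> borel_measurable M1" for g :: "'a \<Rightarrow> real"
      using that M measurable_cong_sets by blast
    show "(\<lambda>x. \<phi> x * h x) \<in> borel_measurable M"
      by (intro borel_measurable_times meas \<phi>(1) borel_measurable_integrable h)
    show "(\<lambda>x. F i x * h x) \<in> borel_measurable M" for i
      by (intro borel_measurable_times meas borel_measurable_simple_function F(1)
        borel_measurable_integrable h)
    show "integrable M (\<lambda>x. 2 * C * norm (h x))" using h by simp
    show "AE x in M. (\<lambda>i. F i x * h x) \<longlonglongrightarrow> \<phi> x * h x"
      by (intro AE_I2 tendsto_mult F(2) tendsto_const) (simp add: sp)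
    have "norm (F i x * h x) \<le> 2 * C * norm (h x)" if "x \<in> space M" for i x
    proof -
      have "\<bar>F i x\<bar> \<le> 2 * C" using F(3)[of x i] \<phi>(2)[of x] that by (simp add: sp)
      then show ?thesis by (simp add: abs_mult mult_right_mono)
    qed
    then show "AE x in M. norm (F i x * h x) \<le> 2 * C * norm (h x)" for i by (intro AE_I2)
  qed
  have "(LINT x|M1. F i x * h1 x) = (LINT x|M2. F i x * h2 x) + (LINT x|M3. F i x * h3 x)" for i
    using simple_functionD(2)[OF F(1)[of i]]
    by (simp add: integral_simple_function_mult F(1) simple h space eq sum.distrib distrib_left)
  then have "(\<lambda>i. LINT x|M1. F i x * h1 x) \<longlonglongrightarrow>
      (LINT x|M2. \<phi> x * h2 x) + (LINT x|M3. \<phi> x * h3 x)"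
    using tendsto_add[OF lim[OF sets(1) h(2)] lim[OF sets(2) h(3)]] by simp
  then show ?thesis using lim[OF refl h(1)] by (rule LIMSEQ_unique[rotated])
qed

lemma integrable_bounded_inner:
  fixes h \<sigma> :: "'a \<Rightarrow> 'b::euclidean_space"
  assumes h: "integrable M h" and \<sigma>: "\<sigma> \<in> borel_measurable M" "\<And>x. x \<in> space M \<Longrightarrow> norm (\<sigma> x) \<le> B"
  shows "integrable M (\<lambda>x. \<sigma> x \<bullet> h x)"
proof (rule Bochner_Integration.integrable_bound[of M "\<lambda>x. B * norm (h x)"])
  show "integrable M (\<lambda>x. B * norm (h x))" using h by simp
  show "(\<lambda>x. \<sigma> x \<bullet> h x) \<in> borel_measurable M"
    using \<sigma>(1) h by (intro borel_measurable_inner) auto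
  have "norm (\<sigma> x \<bullet> h x) \<le> norm (B * norm (h x))" if "x \<in> space M" for x
  proof -
    have "norm (\<sigma> x \<bullet> h x) \<le> norm (\<sigma> x) * norm (h x)"
      using Cauchy_Schwarz_ineq2 by (simp add: real_norm_def)
    also have "\<dots> \<le> B * norm (h x)" using \<sigma>(2)[OF that] by (rule mult_right_mono) simp
    finally show ?thesis by simp
  qed
  then show "AE x in M. norm (\<sigma> x \<bullet> h x) \<le> norm (B * norm (h x))" by (rule AE_I2)
qed

lemma integral_inner_split:
  fixes \<sigma> h1 h2 h3 :: "'a \<Rightarrow> 'b::euclidean_space"
  assumes sets: "sets M2 = sets M1" "sets M3 = sets M1"
    and h: "integrable M1 h1" "integrable M2 h2" "integrable M3 h3"
    and eq: "\<And>A. A \<in> sets M1 \<Longrightarrow> (LINT x:A|M1. h1 x) = (LINT x:A|M2. h2 x) + (LINT x:A|M3. h3 x)"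
    and \<sigma>: "\<sigma> \<in> borel_measurable M1" "\<And>x. x \<in> space M1 \<Longrightarrow> norm (\<sigma> x) \<le> C"
  shows "(LINT x|M1. \<sigma> x \<bullet> h1 x) = (LINT x|M2. \<sigma> x \<bullet> h2 x) + (LINT x|M3. \<sigma> x \<bullet> h3 x)"
proof -
  have expand: "(LINT x|M. \<sigma> x \<bullet> h x) = (\<Sum>b\<in>Basis. LINT x|M. (\<sigma> x \<bullet> b) * (h x \<bullet> b))"
    if "sets M = sets M1" "integrable M h" for M and h :: "'a \<Rightarrow> 'b"
  proof -
    have sp: "space M = space M1" using that(1) by (rule sets_eq_imp_space_eq)
    have \<sigma>M: "\<sigma> \<in> borel_measurable M"
      using \<sigma>(1) measurable_cong_sets[OF that(1) refl] by blast
    have m: "(\<lambda>x. (\<sigma> x \<bullet> b) *\<^sub>R b) \<in> borel_measurable M" for b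
      using \<sigma>M by measurable
    have "norm ((\<sigma> x \<bullet> b) *\<^sub>R b) \<le> C" if "x \<in> space M" "b \<in> Basis" for x b
      using \<sigma>(2)[of x] Basis_le_norm[OF that(2), of "\<sigma> x"] that by (simp add: sp)
    then have "integrable M (\<lambda>x. ((\<sigma> x \<bullet> b) *\<^sub>R b) \<bullet> h x)" if "b \<in> Basis" for b
      using that by (intro integrable_bounded_inner[OF \<open>integrable M h\<close> m])
    then have "integrable M (\<lambda>x. (\<sigma> x \<bullet> b) * (h x \<bullet> b))" if "b \<in> Basis" for b
      using that by (simp add: inner_commute)
    moreover have "(\<lambda>x. \<sigma> x \<bullet> h x) = (\<lambda>x. \<Sum>b\<in>Basis. (\<sigma> x \<bullet> b) * (h x \<bullet> b))"
      by (rule ext) (rule euclidean_inner)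
    ultimately show ?thesis by simp
  qed
  have component: "(LINT x:A|M. h x \<bullet> b) = (LINT x:A|M. h x) \<bullet> b"
    if "integrable M h" "A \<in> sets M" for M A b and h :: "'a \<Rightarrow> 'b"
    unfolding set_lebesgue_integral_def
    using integrable_mult_indicator[OF that(2,1)] by (simp add: integral_inner_left[symmetric] del: integral_inner_left)
  have "(LINT x|M1. (\<sigma> x \<bullet> b) * (h1 x \<bullet> b)) =
      (LINT x|M2. (\<sigma> x \<bullet> b) * (h2 x \<bullet> b)) + (LINT x|M3. (\<sigma> x \<bullet> b) * (h3 x \<bullet> b))"
    if b: "b \<in> Basis" for b
  proof (rule integral_bounded_mult_split[OF sets])
    show "integrable M1 (\<lambda>x. h1 x \<bullet> b)" "integrable M2 (\<lambda>x. h2 x \<bullet> b)" "integrable M3 (\<lambda>x. h3 x \<bullet> b)"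
      using h by simp_all
    show "(LINT x:A|M1. h1 x \<bullet> b) = (LINT x:A|M2. h2 x \<bullet> b) + (LINT x:A|M3. h3 x \<bullet> b)"
      if "A \<in> sets M1" for A
      using that by (simp add: component h sets eq inner_add_left)
    show "(\<lambda>x. \<sigma> x \<bullet> b) \<in> borel_measurable M1" using \<sigma>(1) by measurable
    show "\<bar>\<sigma> x \<bullet> b\<bar> \<le> C" if "x \<in> space M1" for x
      using \<sigma>(2)[OF that] Basis_le_norm[OF b, of "\<sigma> x"] by simp
  qed
  then show ?thesis
    by (simp add: expand h sets sum.distrib)
qed

lemma set_integral_eq_integral_restrict_space:
  fixes f :: "'a \<Rightarrow> 'b::{banach, second_countable_topology}"
  assumes "\<Omega> \<in> sets M"
  shows "(LINT x:\<Omega>|M. f x) = (LINT x|restrict_space M \<Omega>. f x)"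
  using assms by (simp add: set_lebesgue_integral_def integral_restrict_space)

lemma set_integrable_iff_restrict_space:
  fixes f :: "'a \<Rightarrow> 'b::{banach, second_countable_topology}"
  assumes "\<Omega> \<in> sets M"
  shows "set_integrable M \<Omega> f \<longleftrightarrow> integrable (restrict_space M \<Omega>) f"
  using assms by (simp add: set_integrable_def integrable_restrict_space)

text \<open>The trace formula integrates against the whole gradient, whereas the energy treats its
  two parts separately; this identity connects them.\<close>

lemma integral_inner_gradient_split:
  fixes \<sigma> :: "'a::euclidean_space \<Rightarrow> 'b::euclidean_space"
  assumes \<mu>: "bounded_vector_measure (borel_on \<Omega>) \<mu>" and \<Omega>: "\<Omega> \<in> sets borel"
    and \<sigma>: "\<sigma> \<in> borel_measurable borel" "\<And>x. x \<in> \<Omega> \<Longrightarrow> norm (\<sigma> x) \<le> C"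
  shows "(LINT x|variation_measure (borel_on \<Omega>) \<mu>. \<sigma> x \<bullet> polar_density (borel_on \<Omega>) \<mu> x) =
    (LINT x:\<Omega>|lborel. \<sigma> x \<bullet> ac_density \<Omega> \<mu> x) +
    (LINT x|variation_measure (borel_on \<Omega>) (singular_part \<Omega> \<mu>).
      \<sigma> x \<bullet> polar_density (borel_on \<Omega>) (singular_part \<Omega> \<mu>) x)"
proof -
  note dec = ac_density_singular_part[OF \<mu> \<Omega>]
  have sing: "bounded_vector_measure (borel_on \<Omega>) (singular_part \<Omega> \<mu>)"
    and int: "set_integrable lborel \<Omega> (ac_density \<Omega> \<mu>)"
    using dec by (auto simp: lebesgue_decomposition_def)
  have \<Omega>': "\<Omega> \<in> sets lborel" using \<Omega> by simp
  have sets_eq: "sets (restrict_space lborel \<Omega>) = sets (borel_on \<Omega>)"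
    by (rule sets_restrict_space_cong) simp
  show ?thesis
    unfolding set_integral_eq_integral_restrict_space[OF \<Omega>']
  proof (rule integral_inner_split)
    show "integrable (restrict_space lborel \<Omega>) (ac_density \<Omega> \<mu>)"
      using int \<Omega>' by (simp add: set_integrable_iff_restrict_space)
    fix A assume A: "A \<in> sets (variation_measure (borel_on \<Omega>) \<mu>)"
    then have A': "A \<in> sets (borel_on \<Omega>)" by simp
    have "A \<subseteq> \<Omega>" using sets.sets_into_space[OF A'] by (simp add: space_restrict_space)
    then show "(LINT x:A|variation_measure (borel_on \<Omega>) \<mu>. polar_density (borel_on \<Omega>) \<mu> x) =
        (LINT x:A|restrict_space lborel \<Omega>. ac_density \<Omega> \<mu> x) +
        (LINT x:A|variation_measure (borel_on \<Omega>) (singular_part \<Omega> \<mu>).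
          polar_density (borel_on \<Omega>) (singular_part \<Omega> \<mu>) x)"
      unfolding polar_density(2)[OF \<mu> A', symmetric] polar_density(2)[OF sing A', symmetric]
      using dec A' \<Omega>' by (simp add: lebesgue_decomposition_def set_lebesgue_integral_restrict_space)
  next
    have "\<sigma> \<in> borel_measurable (borel_on \<Omega>)" using \<sigma>(1) by (rule measurable_restrict_space1)
    then show "\<sigma> \<in> borel_measurable (variation_measure (borel_on \<Omega>) \<mu>)"
      using measurable_cong_sets[OF sets_variation_measure refl] by blast
  qed (use \<sigma>(2) polar_density(1)[OF \<mu>] polar_density(1)[OF sing] in
      \<open>auto simp: sets_eq space_restrict_space\<close>)
qed

text \<open>The pointwise inequality alone does not suffice, because a non-integrable
  \<open>f (h x)\<close> would have integral 0. Linear growth makes it integrable.\<close>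

lemma integral_calibration_le:
  fixes h \<sigma> :: "'a \<Rightarrow> 'b::euclidean_space" and f :: "'b \<Rightarrow> real"
  assumes h: "integrable M h"
    and \<sigma>: "\<sigma> \<in> borel_measurable M" "\<And>x. x \<in> space M \<Longrightarrow> norm (\<sigma> x) \<le> B"
    and f: "continuous_on UNIV f" "\<And>\<xi>. 0 \<le> f \<xi>" "\<And>\<xi>. f \<xi> \<le> C * norm \<xi>"
    and le: "\<And>x \<xi>. x \<in> space M \<Longrightarrow> \<sigma> x \<bullet> \<xi> \<le> f \<xi>"
  shows "(LINT x|M. \<sigma> x \<bullet> h x) \<le> (LINT x|M. f (h x))"
proof (rule integral_mono)
  show "integrable M (\<lambda>x. \<sigma> x \<bullet> h x)" by (rule integrable_bounded_inner[OF h \<sigma>])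
  show "integrable M (\<lambda>x. f (h x))"
  proof (rule Bochner_Integration.integrable_bound[of M "\<lambda>x. C * norm (h x)"])
    show "integrable M (\<lambda>x. C * norm (h x))" using h by simp
    show "(\<lambda>x. f (h x)) \<in> borel_measurable M"
      using h borel_measurable_continuous_onI[OF f(1)] by measurable
    show "AE x in M. norm (f (h x)) \<le> norm (C * norm (h x))"
      using f(2,3) by (intro AE_I2) (auto intro: order_trans[OF _ abs_ge_self])
  qed
qed (use le in auto)

text \<open>The form in which the matrix pairing on the boundary meets the trace formula, which is
  stated row by row.\<close>

lemma inner_tensor: "\<sigma> \<bullet> (v \<otimes>\<^sub>v w) = (\<Sum>i\<in>UNIV. v $ i * (\<sigma> $ i \<bullet> w))"
  by (simp add: inner_vec_def tensor_def sum_distrib_left algebra_simps)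

lemma tensor_diff_left: "(u - v) \<otimes>\<^sub>v w = u \<otimes>\<^sub>v w - v \<otimes>\<^sub>v w"
  by (simp add: tensor_def vec_eq_iff algebra_simps)

lemma norm_tensor: "norm (v \<otimes>\<^sub>v w) = norm v * norm w"
proof -
  have "(v \<otimes>\<^sub>v w) \<bullet> (v \<otimes>\<^sub>v w) = (v \<bullet> v) * (w \<bullet> w)"
    by (simp add: inner_vec_def tensor_def sum_product sum_distrib_left algebra_simps)
  then show ?thesis
    by (simp add: norm_eq_sqrt_inner real_sqrt_mult)
qed

lemma borel_measurable_tensor [measurable]:
  assumes "v \<in> borel_measurable M" "w \<in> borel_measurable M"
  shows "(\<lambda>x. (v x :: real^'n) \<otimes>\<^sub>v (w x :: real^'d)) \<in> borel_measurable M"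
proof -
  have "continuous_on UNIV (\<lambda>p. (fst p :: real^'n) \<otimes>\<^sub>v (snd p :: real^'d))"
    unfolding tensor_def by (intro continuous_intros)
  then have "(\<lambda>p. (fst p :: real^'n) \<otimes>\<^sub>v (snd p :: real^'d)) \<in> borel_measurable borel"
    by (rule borel_measurable_continuous_onI)
  from measurable_compose[OF borel_measurable_Pair[OF assms] this] show ?thesis by simp
qed

lemma BV_gradient_zero: "BV_gradient \<Omega> (\<lambda>_. 0) (\<lambda>_. 0)"
  and BV_trace_zero: "BV_trace \<Omega> (\<lambda>_. 0) (\<lambda>_. 0) (\<lambda>_. 0)"
proof -
  show "BV_gradient \<Omega> (\<lambda>_. 0) (\<lambda>_. 0)"
    by (simp add: BV_gradient_def bounded_vector_measure_zero integral_variation_measure_eq_0)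
  show "BV_trace \<Omega> (\<lambda>_. 0) (\<lambda>_. 0) (\<lambda>_. 0)"
    by (simp add: BV_trace_def integral_variation_measure_eq_0 set_integrable_def)
qed

text \<open>A divergence-free field \<open>\<sigma>\<close> in the polar of \<open>f\<close> bounds the energy from below by its flux
  against \<open>u0\<close>, which does not depend on the competitor.\<close>

lemma BV_minimizer_zero_calibration:
  fixes \<Omega> :: "(real^'d) set" and f :: "real^'d^'n \<Rightarrow> real" and \<sigma> :: "real^'d \<Rightarrow> real^'d^'n"
  assumes \<Omega>: "open \<Omega>" "bounded \<Omega>"
    and f: "continuous_on UNIV f" "\<And>\<xi>. 0 \<le> f \<xi>" "\<And>\<xi>. f \<xi> \<le> C * norm \<xi>"
    and f_sub: "\<And>\<xi> \<eta>. f (\<xi> - \<eta>) \<le> f \<xi> + f \<eta>" and rec: "recession f = f"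
    and \<sigma>: "continuous_on UNIV \<sigma>" "\<And>i. C_on 1 UNIV (\<lambda>x. \<sigma> x $ i)"
    and div_free: "\<And>i x. x \<in> \<Omega> \<Longrightarrow> divergence (\<lambda>x. \<sigma> x $ i) x = 0"
    and polar: "\<And>x \<xi>. x \<in> closure \<Omega> \<Longrightarrow> \<sigma> x \<bullet> \<xi> \<le> f \<xi>"
    and boundary: "\<And>x. x \<in> frontier \<Omega> \<Longrightarrow>
      \<sigma> x \<bullet> (u0 x \<otimes>\<^sub>v outer_unit_normal \<Omega> x) = f (u0 x \<otimes>\<^sub>v outer_unit_normal \<Omega> x)"
    and cont: "continuous_on (frontier \<Omega>) u0" "continuous_on (frontier \<Omega>) (outer_unit_normal \<Omega>)"
  shows "BV_minimizer \<Omega> f u0 (\<lambda>_. 0)"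
proof -
  define H :: "(real^'d) measure" where "H = restrict_space (hausdorff_measure (CARD('d) - 1)) (frontier \<Omega>)"
  define \<nu> where "\<nu> = outer_unit_normal \<Omega>"
  have fr: "frontier \<Omega> \<in> sets (hausdorff_measure (CARD('d) - 1))" by simp
  have \<Omega>b: "\<Omega> \<in> sets borel" using \<Omega>(1) by simp
  have space_H: "space H = frontier \<Omega>" by (simp add: H_def space_restrict_space)
  have H_meas: "g \<in> borel_measurable H" if "continuous_on (frontier \<Omega>) g" for g :: "real^'d \<Rightarrow> 'c::topological_space"
  proof -
    have "g \<in> borel_measurable (restrict_space borel (frontier \<Omega>))"
      using that by (rule borel_measurable_continuous_on_restrict)
    moreover have "sets H = sets (restrict_space borel (frontier \<Omega>))"
      unfolding H_def by (rule sets_restrict_space_cong) simp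
    ultimately show ?thesis using measurable_cong_sets by blast
  qed
  have f0: "f 0 = 0" using f(2)[of 0] f(3)[of 0] by simp
  have zero: "relaxed_energy \<Omega> f u0 (\<lambda>_. 0) (\<lambda>_. 0) = (LINT x|H. f (u0 x \<otimes>\<^sub>v \<nu> x))"
  proof -
    have ac0: "AE x in lborel. x \<in> \<Omega> \<longrightarrow> ac_density \<Omega> (\<lambda>_. 0 :: real^'d^'n) x = 0"
      by (rule ac_density_zero[OF \<Omega>b])
    have "singular_part \<Omega> (\<lambda>_. 0 :: real^'d^'n) A = 0" if "A \<in> sets (borel_on \<Omega>)" for A
    proof -
      have "A \<subseteq> \<Omega>" using sets.sets_into_space[OF that] by (simp add: space_restrict_space)
      then have "AE x in lborel. indicator A x *\<^sub>R ac_density \<Omega> (\<lambda>_. 0 :: real^'d^'n) x = 0"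
        using ac0 by (auto elim!: eventually_mono simp: indicator_def)
      then have "(LINT x:A|lborel. ac_density \<Omega> (\<lambda>_. 0 :: real^'d^'n) x) = 0"
        unfolding set_lebesgue_integral_def by (rule integral_eq_zero_AE)
      then show ?thesis by (simp add: singular_part_def)
    qed
    moreover have "AE x in lborel. indicator \<Omega> x *\<^sub>R f (ac_density \<Omega> (\<lambda>_. 0) x) = 0"
      using ac0 by eventually_elim (auto simp: indicator_def f0)
    then have "(LINT x:\<Omega>|lborel. f (ac_density \<Omega> (\<lambda>_. 0) x)) = 0"
      unfolding set_lebesgue_integral_def by (rule integral_eq_zero_AE)
    ultimately show ?thesis
      by (simp add: relaxed_energy_def integral_variation_measure_eq_0 rec H_def \<nu>_def
        set_integral_eq_integral_restrict_space)
  qed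
  have "compact (closure \<Omega>)" using \<Omega>(2) by (simp add: compact_closure)
  then have "bounded (\<sigma> ` closure \<Omega>)"
    by (intro compact_imp_bounded compact_continuous_image continuous_on_subset[OF \<sigma>(1)]) auto
  then obtain B where B: "\<And>x. x \<in> closure \<Omega> \<Longrightarrow> norm (\<sigma> x) \<le> B"
    by (auto simp: bounded_iff)
  have "compact (frontier \<Omega>)" using \<Omega>(2) by (rule compact_frontier_bounded)
  then have "bounded (\<nu> ` frontier \<Omega>)"
    unfolding \<nu>_def by (intro compact_imp_bounded compact_continuous_image cont)
  then obtain D where D: "\<And>x. x \<in> frontier \<Omega> \<Longrightarrow> norm (\<nu> x) \<le> D"
    by (auto simp: bounded_iff)
  have \<sigma>m: "\<sigma> \<in> borel_measurable borel" using \<sigma>(1) by (rule borel_measurable_continuous_onI)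
  have fm: "f \<in> borel_measurable borel" using f(1) by (rule borel_measurable_continuous_onI)
  have "relaxed_energy \<Omega> f u0 (\<lambda>_. 0) (\<lambda>_. 0) \<le> relaxed_energy \<Omega> f u0 \<mu> g"
    if grad: "BV_gradient \<Omega> w \<mu>" and trace: "BV_trace \<Omega> w \<mu> g" for w \<mu> g
  proof -
    define h where "h = polar_density (borel_on \<Omega>) \<mu>"
    define V where "V = variation_measure (borel_on \<Omega>) \<mu>"
    define hs where "hs = polar_density (borel_on \<Omega>) (singular_part \<Omega> \<mu>)"
    define Vs where "Vs = variation_measure (borel_on \<Omega>) (singular_part \<Omega> \<mu>)"
    define L where "L = restrict_space lborel \<Omega>"
    define a where "a = ac_density \<Omega> \<mu>"
    have \<mu>: "bounded_vector_measure (borel_on \<Omega>) \<mu>" using grad by (simp add: BV_gradient_def)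
    note dec = ac_density_singular_part[OF \<mu> \<Omega>b]
    have sing: "bounded_vector_measure (borel_on \<Omega>) (singular_part \<Omega> \<mu>)"
      and a: "integrable L a"
      using dec \<Omega>b by (auto simp: lebesgue_decomposition_def L_def a_def set_integrable_iff_restrict_space)
    have hs: "integrable Vs hs" unfolding Vs_def hs_def by (rule polar_density(1)[OF sing])
    have h: "integrable V h" unfolding V_def h_def by (rule polar_density(1)[OF \<mu>])
    have g: "integrable H g"
      using trace by (simp add: BV_trace_def H_def set_integrable_iff_restrict_space)
    have \<sigma>\<Omega>: "\<sigma> \<in> borel_measurable (borel_on \<Omega>)" using \<sigma>m by (rule measurable_restrict_space1)
    have \<sigma>V: "\<sigma> \<in> borel_measurable V" "\<sigma> \<in> borel_measurable Vs" "\<sigma> \<in> borel_measurable L"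
      unfolding V_def Vs_def L_def
      using \<sigma>\<Omega> measurable_cong_sets[OF sets_variation_measure refl] \<sigma>m
      by (auto intro: measurable_restrict_space1)
    have sp: "space V = \<Omega>" "space Vs = \<Omega>" "space L = \<Omega>"
      by (auto simp: V_def Vs_def L_def space_restrict_space)
    have cl: "x \<in> closure \<Omega>" if "x \<in> \<Omega>" for x using that closure_subset by blast
    have cl': "x \<in> closure \<Omega>" if "x \<in> frontier \<Omega>" for x using that by (simp add: frontier_def)
    have energy: "relaxed_energy \<Omega> f u0 \<mu> g =
        (LINT x|L. f (a x)) + (LINT x|Vs. f (hs x)) + (LINT x|H. f ((u0 x - g x) \<otimes>\<^sub>v \<nu> x))"
      using \<Omega>b by (simp add: relaxed_energy_def rec L_def a_def Vs_def hs_def H_def \<nu>_def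
        set_integral_eq_integral_restrict_space)
    have 1: "(LINT x|L. \<sigma> x \<bullet> a x) \<le> (LINT x|L. f (a x))"
      by (rule integral_calibration_le[where B=B, OF a \<sigma>V(3) _ f]) (auto simp: sp cl B polar)
    have 2: "(LINT x|Vs. \<sigma> x \<bullet> hs x) \<le> (LINT x|Vs. f (hs x))"
      by (rule integral_calibration_le[where B=B, OF hs \<sigma>V(2) _ f]) (auto simp: sp cl B polar)
    show ?thesis
    proof (cases "integrable H (\<lambda>x. f (u0 x \<otimes>\<^sub>v \<nu> x))")
      \<comment> \<open>Here the energy of the zero function is 0 by the convention for
        non-integrable functions, and energies are nonnegative.\<close>
      case False
      have "0 \<le> relaxed_energy \<Omega> f u0 \<mu> g"
        unfolding energy using f(2) by (intro add_nonneg_nonneg Bochner_Integration.integral_nonneg)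
      with False show ?thesis by (simp add: zero not_integrable_integral_eq)
    next
      case True
      have gm [measurable]: "g \<in> borel_measurable H" using g by simp
      have um [measurable]: "u0 \<in> borel_measurable H" by (rule H_meas[OF cont(1)])
      have nm [measurable]: "\<nu> \<in> borel_measurable H" unfolding \<nu>_def by (rule H_meas[OF cont(2)])
      have \<sigma>H [measurable]: "\<sigma> \<in> borel_measurable H"
        by (rule H_meas[OF continuous_on_subset[OF \<sigma>(1)]]) simp
      have gn: "integrable H (\<lambda>x. g x \<otimes>\<^sub>v \<nu> x)"
      proof (rule Bochner_Integration.integrable_bound[of H "\<lambda>x. D * norm (g x)"])
        show "integrable H (\<lambda>x. D * norm (g x))" using g by simp
        have "norm (g x \<otimes>\<^sub>v \<nu> x) \<le> norm (D * norm (g x))" if "x \<in> space H" for x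
        proof -
          have "norm (g x) * norm (\<nu> x) \<le> norm (g x) * D"
            using D that by (intro mult_left_mono) (auto simp: space_H)
          also have "\<dots> \<le> norm (D * norm (g x))" by (metis abs_ge_self mult.commute real_norm_def)
          finally show ?thesis by (simp add: norm_tensor)
        qed
        then show "AE x in H. norm (g x \<otimes>\<^sub>v \<nu> x) \<le> norm (D * norm (g x))" by (rule AE_I2)
      qed measurable
      have \<sigma>gn: "integrable H (\<lambda>x. \<sigma> x \<bullet> (g x \<otimes>\<^sub>v \<nu> x))"
        by (rule integrable_bounded_inner[where B=B, OF gn \<sigma>H]) (simp add: space_H cl' B)
      have "(LINT x|H. f (u0 x \<otimes>\<^sub>v \<nu> x)) - (LINT x|H. \<sigma> x \<bullet> (g x \<otimes>\<^sub>v \<nu> x)) =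
          (LINT x|H. f (u0 x \<otimes>\<^sub>v \<nu> x) - \<sigma> x \<bullet> (g x \<otimes>\<^sub>v \<nu> x))"
        using True \<sigma>gn by simp
      also have "\<dots> \<le> (LINT x|H. f ((u0 x - g x) \<otimes>\<^sub>v \<nu> x))"
      proof (rule integral_mono)
        show "integrable H (\<lambda>x. f (u0 x \<otimes>\<^sub>v \<nu> x) - \<sigma> x \<bullet> (g x \<otimes>\<^sub>v \<nu> x))"
          using True \<sigma>gn by simp
        show "integrable H (\<lambda>x. f ((u0 x - g x) \<otimes>\<^sub>v \<nu> x))"
        proof (rule Bochner_Integration.integrable_bound[of H
              "\<lambda>x. f (u0 x \<otimes>\<^sub>v \<nu> x) + C * norm (g x \<otimes>\<^sub>v \<nu> x)"])
          show "integrable H (\<lambda>x. f (u0 x \<otimes>\<^sub>v \<nu> x) + C * norm (g x \<otimes>\<^sub>v \<nu> x))"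
            using True gn by simp
          show "(\<lambda>x. f ((u0 x - g x) \<otimes>\<^sub>v \<nu> x)) \<in> borel_measurable H"
            using fm by measurable
          have "norm (f ((u0 x - g x) \<otimes>\<^sub>v \<nu> x)) \<le> norm (f (u0 x \<otimes>\<^sub>v \<nu> x) + C * norm (g x \<otimes>\<^sub>v \<nu> x))" for x
            using f_sub[of "u0 x \<otimes>\<^sub>v \<nu> x" "g x \<otimes>\<^sub>v \<nu> x"] f(3)[of "g x \<otimes>\<^sub>v \<nu> x"]
              f(2)[of "(u0 x - g x) \<otimes>\<^sub>v \<nu> x"] by (simp add: tensor_diff_left)
          then show "AE x in H. norm (f ((u0 x - g x) \<otimes>\<^sub>v \<nu> x)) \<le>
              norm (f (u0 x \<otimes>\<^sub>v \<nu> x) + C * norm (g x \<otimes>\<^sub>v \<nu> x))" by (intro AE_I2)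
        qed
        fix x assume "x \<in> space H"
        then have x: "x \<in> frontier \<Omega>" by (simp add: space_H)
        have "f (u0 x \<otimes>\<^sub>v \<nu> x) - \<sigma> x \<bullet> (g x \<otimes>\<^sub>v \<nu> x) = \<sigma> x \<bullet> ((u0 x - g x) \<otimes>\<^sub>v \<nu> x)"
          using boundary[OF x] by (simp add: \<nu>_def tensor_diff_left inner_diff_right)
        also have "\<dots> \<le> f ((u0 x - g x) \<otimes>\<^sub>v \<nu> x)" by (rule polar[OF cl'[OF x]])
        finally show "f (u0 x \<otimes>\<^sub>v \<nu> x) - \<sigma> x \<bullet> (g x \<otimes>\<^sub>v \<nu> x) \<le> f ((u0 x - g x) \<otimes>\<^sub>v \<nu> x)" .
      qed
      finally have 3: "(LINT x|H. f (u0 x \<otimes>\<^sub>v \<nu> x)) - (LINT x|H. \<sigma> x \<bullet> (g x \<otimes>\<^sub>v \<nu> x)) \<le>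
          (LINT x|H. f ((u0 x - g x) \<otimes>\<^sub>v \<nu> x))" .
      \<comment> \<open>The Gauss--Green formula defining the trace, tested with the row
        \<open>\<sigma> x $ i\<close>, whose divergence vanishes in \<open>\<Omega>\<close>.\<close>
      have flux_i: "(LINT x|V. \<sigma> x $ i \<bullet> (h x $ i)) = (LINT x|H. g x $ i * (\<sigma> x $ i \<bullet> \<nu> x))" for i
      proof -
        have "(LINT x:\<Omega>|lebesgue. w x $ i * divergence (\<lambda>x. \<sigma> x $ i) x) = 0"
          unfolding set_lebesgue_integral_def
          by (rule integral_eq_zero_AE) (auto simp: indicator_def div_free)
        moreover have "(LINT x:\<Omega>|lebesgue. w x $ i * divergence (\<lambda>x. \<sigma> x $ i) x) =
            - (LINT x|V. \<sigma> x $ i \<bullet> (h x $ i)) + (LINT x|H. g x $ i * (\<sigma> x $ i \<bullet> \<nu> x))"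
          using trace \<sigma>(2)[of i] fr
          by (simp add: BV_trace_def V_def h_def H_def \<nu>_def set_integral_eq_integral_restrict_space)
        ultimately show ?thesis by simp
      qed
      have row_m: "(\<lambda>y :: real^'d^'n. y $ i) \<in> borel_measurable borel" for i
        by (intro borel_measurable_continuous_onI continuous_intros)
      have vec_bound: "norm (y $ i) \<le> norm y" for y :: "real^'d^'n" and i by (rule Finite_Cartesian_Product.norm_nth_le)
      have "integrable V (\<lambda>x. \<sigma> x $ i \<bullet> (h x $ i))" for i
      proof (rule integrable_bounded_inner)
        show "integrable V (\<lambda>x. h x $ i)"
          using h by (rule integrable_bounded_linear[OF bounded_linear_vec_nth])
        show "(\<lambda>x. \<sigma> x $ i) \<in> borel_measurable V" using \<sigma>V(1) by (rule measurable_compose[OF _ row_m])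
        show "norm (\<sigma> x $ i) \<le> B" if "x \<in> space V" for x
          using B[OF cl] vec_bound order_trans that sp by metis
      qed
      then have "(LINT x|V. \<sigma> x \<bullet> h x) = (\<Sum>i\<in>UNIV. LINT x|V. \<sigma> x $ i \<bullet> (h x $ i))"
        by (simp add: inner_vec_def[of "\<sigma> _"])
      also have "\<dots> = (\<Sum>i\<in>UNIV. LINT x|H. g x $ i * (\<sigma> x $ i \<bullet> \<nu> x))" by (simp add: flux_i)
      also have "\<dots> = (LINT x|H. \<sigma> x \<bullet> (g x \<otimes>\<^sub>v \<nu> x))"
      proof -
        have "integrable H (\<lambda>x. g x $ i * (\<sigma> x $ i \<bullet> \<nu> x))" for i
        proof (rule Bochner_Integration.integrable_bound[of H "\<lambda>x. B * norm (g x \<otimes>\<^sub>v \<nu> x)"])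
          show "integrable H (\<lambda>x. B * norm (g x \<otimes>\<^sub>v \<nu> x))" using gn by simp
          have "(\<lambda>y :: real^'n. y $ i) \<in> borel_measurable borel"
            by (intro borel_measurable_continuous_onI continuous_intros)
          then show "(\<lambda>x. g x $ i * (\<sigma> x $ i \<bullet> \<nu> x)) \<in> borel_measurable H"
            by (intro borel_measurable_times borel_measurable_inner nm
              measurable_compose[OF gm] measurable_compose[OF \<sigma>H row_m])
          have "norm (g x $ i * (\<sigma> x $ i \<bullet> \<nu> x)) \<le> norm (B * norm (g x \<otimes>\<^sub>v \<nu> x))" if "x \<in> space H" for x
          proof -
            have "norm (\<sigma> x $ i) \<le> B"
              using B[OF cl', of x] vec_bound[of "\<sigma> x" i] that by (auto simp: space_H)
            then have "norm (\<sigma> x $ i \<bullet> \<nu> x) \<le> B * norm (\<nu> x)"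
              unfolding real_norm_def
              by (intro order_trans[OF Cauchy_Schwarz_ineq2] mult_right_mono) auto
            then have "norm (g x $ i) * norm (\<sigma> x $ i \<bullet> \<nu> x) \<le> norm (g x) * (B * norm (\<nu> x))"
              by (intro mult_mono Finite_Cartesian_Product.norm_nth_le) auto
            also have "\<dots> \<le> norm (B * norm (g x \<otimes>\<^sub>v \<nu> x))" by (simp add: norm_tensor algebra_simps)
            finally show ?thesis by (simp add: abs_mult)
          qed
          then show "AE x in H. norm (g x $ i * (\<sigma> x $ i \<bullet> \<nu> x)) \<le> norm (B * norm (g x \<otimes>\<^sub>v \<nu> x))"
            by (rule AE_I2)
        qed
        then show ?thesis by (simp add: inner_tensor)
      qed
      finally have flux: "(LINT x|V. \<sigma> x \<bullet> h x) = (LINT x|H. \<sigma> x \<bullet> (g x \<otimes>\<^sub>v \<nu> x))" .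
      \<comment> \<open>By \<open>1\<close> and \<open>2\<close> the interior energy is at least
        this sum, which by \<open>flux\<close> equals exactly the boundary term subtracted in
        \<open>3\<close>; what remains is the energy of the zero function.\<close>
      have "(LINT x|V. \<sigma> x \<bullet> h x) = (LINT x|L. \<sigma> x \<bullet> a x) + (LINT x|Vs. \<sigma> x \<bullet> hs x)"
        using integral_inner_gradient_split[OF \<mu> \<Omega>b \<sigma>m B[OF cl]] \<Omega>b
        by (simp add: V_def h_def Vs_def hs_def L_def a_def set_integral_eq_integral_restrict_space)
      with 1 2 3 flux show ?thesis unfolding energy zero by linarith
    qed
  qed
  then show ?thesis
    unfolding BV_minimizer_def BV_def using BV_gradient_zero BV_trace_zero by blast
qed

section \<open>Differentiability classes and homogeneous integrands\<close>

text \<open>\<open>frechet_derivative\<close> chooses among all derivatives, so it agrees for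
  \<open>f\<close> and \<open>g\<close> as soon as \<open>has_derivative\<close> cannot tell them
  apart, differentiable or not.\<close>

lemma frechet_derivative_cong_open:
  assumes "open U" "x \<in> U" "\<And>y. y \<in> U \<Longrightarrow> f y = g y"
  shows "frechet_derivative f (at x) = frechet_derivative g (at x)"
proof -
  have "(f has_derivative D) (at x) \<longleftrightarrow> (g has_derivative D) (at x)" for D
    using has_derivative_transform_within_open[OF _ assms(1,2), of f D UNIV g]
      has_derivative_transform_within_open[OF _ assms(1,2), of g D UNIV f] assms(3) by auto
  then show ?thesis by (simp add: frechet_derivative_def)
qed

lemma cont_diff_open_cong:
  assumes "open U" "\<And>x. x \<in> U \<Longrightarrow> f x = g x" "cont_diff_open m U f"
  shows "cont_diff_open m U g"
  using assms(2,3)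
proof (induction m arbitrary: f g)
  case 0
  then show ?case using continuous_on_cong by fastforce
next
  case (Suc m)
  have fd: "frechet_derivative f (at x) = frechet_derivative g (at x)" if "x \<in> U" for x
    using frechet_derivative_cong_open[OF assms(1) that] Suc.prems(1) by blast
  have "g differentiable (at x)" if "x \<in> U" for x
  proof -
    have "(f has_derivative frechet_derivative f (at x)) (at x)"
      using Suc.prems(2) that by (simp add: frechet_derivative_works[symmetric])
    then have "(g has_derivative frechet_derivative f (at x)) (at x)"
      using Suc.prems(1) by (rule has_derivative_transform_within_open[OF _ assms(1) that])
    then show ?thesis by (rule differentiableI)
  qed
  moreover have "cont_diff_open m U (\<lambda>x. frechet_derivative g (at x) v)" for v
  proof (rule Suc.IH)
    show "frechet_derivative f (at x) v = frechet_derivative g (at x) v" if "x \<in> U" for x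
      by (simp only: fd[OF that])
    show "cont_diff_open m U (\<lambda>x. frechet_derivative f (at x) v)" using Suc.prems(2) by simp
  qed
  ultimately show ?case by simp
qed

text \<open>A class of differentiable functions that contains the directional derivatives of its
  members consists of smooth functions. Smoothness thus reduces to one closure property, without
  tracking the order.\<close>

lemma cont_diff_open_coinduct:
  assumes "open U" "P g"
    and step: "\<And>g. P g \<Longrightarrow> \<exists>D. (\<forall>v. P (D v)) \<and> (\<forall>x\<in>U. (g has_derivative (\<lambda>v. D v x)) (at x))"
  shows "cont_diff_open m U g"
  using \<open>P g\<close>
proof (induction m arbitrary: g)
  case 0
  from step[OF this] have "continuous_on U g"
    by (auto simp: continuous_on_eq_continuous_at[OF \<open>open U\<close>] dest: has_derivative_continuous)
  then show ?case by simp
next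
  case (Suc m)
  from step[OF Suc.prems] obtain D where D: "\<And>v. P (D v)"
    "\<And>x. x \<in> U \<Longrightarrow> (g has_derivative (\<lambda>v. D v x)) (at x)" by blast
  have "cont_diff_open m U (\<lambda>x. frechet_derivative g (at x) v)" for v
    using D(2) by (intro cont_diff_open_cong[OF \<open>open U\<close> _ Suc.IH[OF D(1)[of v]]])
      (metis frechet_derivative_at)
  then show ?case using D(2) by (auto simp: differentiable_def)
qed

text \<open>Chosen to contain polynomials and the norm of a linear map and to be closed under
  directional derivatives. Differentiating \<open>norm (A x)\<close> produces its inverse, hence the
  last rule; both norm rules require \<open>A\<close> to have no zero on \<open>U\<close>.\<close>

inductive elementary_on :: "'a::euclidean_space set \<Rightarrow> ('a \<Rightarrow> real) \<Rightarrow> bool" for U where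
  const: "elementary_on U (\<lambda>_. c)"
| linear: "bounded_linear l \<Longrightarrow> elementary_on U l"
| plus: "elementary_on U f \<Longrightarrow> elementary_on U g \<Longrightarrow> elementary_on U (\<lambda>x. f x + g x)"
| times: "elementary_on U f \<Longrightarrow> elementary_on U g \<Longrightarrow> elementary_on U (\<lambda>x. f x * g x)"
| norm: "bounded_linear (A :: 'a \<Rightarrow> 'a) \<Longrightarrow> (\<And>x. x \<in> U \<Longrightarrow> A x \<noteq> 0) \<Longrightarrow> elementary_on U (\<lambda>x. norm (A x))"
| inverse_norm: "bounded_linear (A :: 'a \<Rightarrow> 'a) \<Longrightarrow> (\<And>x. x \<in> U \<Longrightarrow> A x \<noteq> 0) \<Longrightarrow>
    elementary_on U (\<lambda>x. inverse (norm (A x)))"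

lemma has_derivative_norm_linear:
  fixes A :: "'a::real_normed_vector \<Rightarrow> 'b::real_inner"
  assumes "bounded_linear A" "A x \<noteq> 0"
  shows "((\<lambda>x. norm (A x)) has_derivative (\<lambda>v. inverse (norm (A x)) * (A x \<bullet> A v))) (at x)"
proof -
  have "((\<lambda>x. norm (A x)) has_derivative (\<lambda>v. A v \<bullet> sgn (A x))) (at x)"
    using GDERIV_norm[OF assms(2)] bounded_linear_imp_has_derivative[OF assms(1)]
    unfolding gderiv_def by (rule has_derivative_compose[rotated])
  then show ?thesis by (simp add: sgn_div_norm inner_commute)
qed

lemma elementary_on_has_derivative:
  assumes "elementary_on U g"
  shows "\<exists>D. (\<forall>v. elementary_on U (D v)) \<and> (\<forall>x\<in>U. (g has_derivative (\<lambda>v. D v x)) (at x))"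
  using assms
proof induction
  case (const c)
  show ?case by (rule exI[of _ "\<lambda>_ _. 0"]) (auto intro: elementary_on.const)
next
  case (linear l)
  then show ?case
    by (intro exI[of _ "\<lambda>v _. l v"]) (auto intro: elementary_on.const bounded_linear_imp_has_derivative)
next
  case (plus f g)
  then obtain D E where "\<And>v. elementary_on U (D v)" "\<And>v. elementary_on U (E v)"
    "\<And>x. x \<in> U \<Longrightarrow> (f has_derivative (\<lambda>v. D v x)) (at x)"
    "\<And>x. x \<in> U \<Longrightarrow> (g has_derivative (\<lambda>v. E v x)) (at x)" by blast
  then show ?case
    by (intro exI[of _ "\<lambda>v x. D v x + E v x"])
      (auto intro: elementary_on.intros has_derivative_add)
next
  case (times f g)
  then obtain D E where "\<And>v. elementary_on U (D v)" "\<And>v. elementary_on U (E v)"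
    "\<And>x. x \<in> U \<Longrightarrow> (f has_derivative (\<lambda>v. D v x)) (at x)"
    "\<And>x. x \<in> U \<Longrightarrow> (g has_derivative (\<lambda>v. E v x)) (at x)" by blast
  with times show ?case
    by (intro exI[of _ "\<lambda>v x. f x * E v x + D v x * g x"])
      (auto intro!: elementary_on.plus elementary_on.times has_derivative_mult)
next
  case (norm A)
  have "bounded_linear (\<lambda>x. A x \<bullet> A v)" for v
    by (rule bounded_linear_compose[OF bounded_linear_inner_left norm(1)])
  then have "elementary_on U (\<lambda>x. inverse (norm (A x)) * (A x \<bullet> A v))" for v
    by (intro elementary_on.times elementary_on.inverse_norm norm elementary_on.linear)
  with norm show ?case
    by (intro exI[of _ "\<lambda>v x. inverse (norm (A x)) * (A x \<bullet> A v)"])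
      (auto intro!: has_derivative_norm_linear)
next
  case (inverse_norm A)
  have lin: "bounded_linear (\<lambda>x. A x \<bullet> A v)" for v
    by (rule bounded_linear_compose[OF bounded_linear_inner_left inverse_norm(1)])
  define D where "D v x = - 1 * (inverse (norm (A x)) * (inverse (norm (A x)) * (A x \<bullet> A v)) *
    inverse (norm (A x)))" for v x
  have "((\<lambda>x. inverse (norm (A x))) has_derivative (\<lambda>v. D v x)) (at x)" if "x \<in> U" for x
    using Deriv.has_derivative_inverse[OF _ has_derivative_norm_linear[OF inverse_norm(1)], of x]
      inverse_norm(2)[OF that] by (simp add: D_def)
  moreover have "elementary_on U (D v)" for v
    unfolding D_def
    by (intro elementary_on.times elementary_on.const elementary_on.inverse_norm
        elementary_on.linear lin inverse_norm)
  ultimately show ?case by blast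
qed

lemma elementary_on_uminus: "elementary_on U f \<Longrightarrow> elementary_on U (\<lambda>x. - f x)"
  using elementary_on.times[OF elementary_on.const[of U "-1"], of f] by simp

lemma elementary_on_diff:
  "elementary_on U f \<Longrightarrow> elementary_on U g \<Longrightarrow> elementary_on U (\<lambda>x. f x - g x)"
  using elementary_on.plus[OF _ elementary_on_uminus, of U f g] by simp

lemma elementary_on_power: "elementary_on U f \<Longrightarrow> elementary_on U (\<lambda>x. f x ^ n)"
  by (induction n) (auto intro: elementary_on.intros)

lemma elementary_on_vec_nth: "elementary_on U (\<lambda>x. x $ i)"
  by (rule elementary_on.linear) (rule bounded_linear_vec_nth)

lemma cont_diff_open_componentwise:
  fixes f :: "'a::euclidean_space \<Rightarrow> 'b::euclidean_space"
  assumes "open U" and f: "\<And>b. b \<in> Basis \<Longrightarrow> elementary_on U (\<lambda>x. f x \<bullet> b)"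
  shows "cont_diff_open m U f"
proof (rule cont_diff_open_coinduct[where P="\<lambda>f. \<forall>b\<in>Basis. elementary_on U (\<lambda>x. f x \<bullet> b)", OF \<open>open U\<close>])
  fix g :: "'a \<Rightarrow> 'b" assume g: "\<forall>b\<in>Basis. elementary_on U (\<lambda>x. g x \<bullet> b)"
  have "\<exists>D. \<forall>b\<in>Basis. (\<forall>v. elementary_on U (D b v)) \<and>
      (\<forall>x\<in>U. ((\<lambda>x. g x \<bullet> b) has_derivative (\<lambda>v. D b v x)) (at x))"
    using elementary_on_has_derivative[OF g[rule_format]] by (intro bchoice) blast
  then obtain D where D: "\<And>b v. b \<in> Basis \<Longrightarrow> elementary_on U (D b v)"
    "\<And>b x. b \<in> Basis \<Longrightarrow> x \<in> U \<Longrightarrow> ((\<lambda>x. g x \<bullet> b) has_derivative (\<lambda>v. D b v x)) (at x)" by blast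
  show "\<exists>D. (\<forall>v. \<forall>b\<in>Basis. elementary_on U (\<lambda>x. D v x \<bullet> b)) \<and>
      (\<forall>x\<in>U. (g has_derivative (\<lambda>v. D v x)) (at x))"
  proof (intro exI conjI allI ballI)
    show "elementary_on U (\<lambda>x. (\<Sum>b\<in>Basis. D b v x *\<^sub>R b) \<bullet> b)" if "b \<in> Basis" for v and b :: 'b
      using D(1)[OF that] that by simp
    show "(g has_derivative (\<lambda>v. \<Sum>b\<in>Basis. D b v x *\<^sub>R b)) (at x)" if "x \<in> U" for x
      using D(2)[OF _ that] by (subst has_derivative_componentwise_within) simp
  qed
qed (use f in blast)

lemma C_on_subset: "C_on k S f \<Longrightarrow> T \<subseteq> S \<Longrightarrow> C_on k T f"
  unfolding C_on_def by (meson order_trans subsetD)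

lemma C_on_imp_continuous_on:
  assumes "C_on k S f"
  shows "continuous_on S f"
proof -
  obtain U g where g: "S \<subseteq> U" "\<And>x. x \<in> S \<Longrightarrow> g x = f x"
    "\<And>m. enat m \<le> k \<Longrightarrow> cont_diff_open m U g"
    using assms unfolding C_on_def by blast
  from g(3)[of 0] have "continuous_on U g" by (simp flip: zero_enat_def)
  then have "continuous_on S g" using g(1) by (rule continuous_on_subset)
  then show ?thesis by (rule continuous_on_eq) (rule g(2))
qed

lemma C_on_componentwise:
  fixes f :: "'a::euclidean_space \<Rightarrow> 'b::euclidean_space"
  assumes "open U" "S \<subseteq> U" "\<And>b. b \<in> Basis \<Longrightarrow> elementary_on U (\<lambda>x. f x \<bullet> b)"
  shows "C_on k S f"
  unfolding C_on_def using assms cont_diff_open_componentwise[OF assms(1,3)] by blast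

lemma C_on_elementary:
  assumes "open U" "S \<subseteq> U" "elementary_on U f"
  shows "C_on k S f"
  using assms by (intro C_on_componentwise) auto

lemma C_on_vector_2:
  fixes p q :: "'a::euclidean_space \<Rightarrow> real"
  assumes "elementary_on UNIV p" "elementary_on UNIV q"
  shows "C_on k S (\<lambda>x. vector [p x, q x] :: real^2)"
proof (rule C_on_componentwise)
  fix b :: "real^2" assume "b \<in> Basis"
  then obtain i where "b = axis i 1" by (auto simp: Basis_vec_def)
  then show "elementary_on UNIV (\<lambda>x. (vector [p x, q x] :: real^2) \<bullet> b)"
    using assms exhaust_2[of i] by (auto simp: inner_axis)
qed auto

section \<open>Gradients, recession functions and condition (c) for homogeneous integrands\<close>

lemma grad_eq: "GDERIV f x :> D \<Longrightarrow> grad f x = D"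
  unfolding grad_def gderiv_def
  by (rule the_equality, assumption)
    (metis has_derivative_unique inner_commute vector_eq_ldot)

lemma recession_eq:
  assumes "pos_homogeneous1 f"
  shows "recession f = f"
proof
  fix \<xi>
  have "\<forall>\<^sub>F t in at_top. f (t *\<^sub>R \<xi>) / t = f \<xi>"
    by (rule eventually_mono[OF eventually_gt_at_top[of 0]])
      (use assms in \<open>simp add: pos_homogeneous1_def\<close>)
  then have "((\<lambda>t. f (t *\<^sub>R \<xi>) / t) \<longlongrightarrow> f \<xi>) at_top" by (rule tendsto_eventually)
  then show "recession f \<xi> = f \<xi>" unfolding recession_def by (intro tendsto_Lim) auto
qed

text \<open>A gradient that is constant along the ray through \<open>x\<close> has derivative 0 in
  the direction \<open>x\<close>: Euler's relation in degree 0.\<close>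

lemma hessian_radial:
  assumes "grad f differentiable (at x)" and hom: "\<And>t. t > 0 \<Longrightarrow> grad f (t *\<^sub>R x) = grad f x"
  shows "hessian f x x = 0"
proof -
  define D where "D = frechet_derivative (grad f) (at x)"
  have D: "(grad f has_derivative D) (at x)"
    unfolding D_def using assms(1) by (rule frechet_derivative_works[THEN iffD1])
  have "((\<lambda>t. grad f (t *\<^sub>R x)) has_derivative (\<lambda>t. D (t *\<^sub>R x))) (at 1)"
    by (rule has_derivative_compose[of "\<lambda>t. t *\<^sub>R x" "\<lambda>t. t *\<^sub>R x" 1 UNIV "grad f"])
      (use D in \<open>auto intro!: derivative_eq_intros\<close>)
  moreover have "((\<lambda>t. grad f (t *\<^sub>R x)) has_derivative (\<lambda>t. 0)) (at 1)"
    by (rule has_derivative_transform_within_open[of "\<lambda>_. grad f x" _ _ _ "{0<..}"]) (auto simp: hom)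
  ultimately have "(\<lambda>t. D (t *\<^sub>R x)) = (\<lambda>t. 0)" by (rule has_derivative_unique)
  from fun_cong[OF this, of 1] show ?thesis by (simp add: hessian_def D_def)
qed

text \<open>The integrand of (c) is a second derivative in the radial direction, which vanishes for
  a 1-homogeneous function; so all integrals and suprema in (c) are 0 away from the origin.\<close>

lemma cond_c_homogeneous:
  fixes f :: "real^'d^'n \<Rightarrow> real"
  assumes smooth: "C_on 2 (- {0}) f" "C_on 1 (- {0}) f"
    and grad: "\<And>x. x \<noteq> 0 \<Longrightarrow> grad f differentiable (at x)"
      "\<And>t x. t > 0 \<Longrightarrow> x \<noteq> 0 \<Longrightarrow> grad f (t *\<^sub>R x) = grad f x"
  shows "cond_c f"
proof -
  have zero: "hessian f (s *\<^sub>R sgn \<xi>) (sgn \<xi>) \<bullet> sgn \<xi> = 0" if "\<xi> \<noteq> 0" "s \<ge> norm \<xi>" for s and \<xi> :: "real^'d^'n"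
  proof -
    have "0 < norm \<xi>" using that by simp
    with that(2) have s: "s > 0" by linarith
    then have nz: "s *\<^sub>R sgn \<xi> \<noteq> 0" using that(1) by (simp add: sgn_zero_iff)
    define L where "L = frechet_derivative (grad f) (at (s *\<^sub>R sgn \<xi>))"
    have "linear L"
      unfolding L_def using grad(1)[OF nz] by (rule linear_frechet_derivative)
    \<comment> \<open>At the point \<open>s *\<^sub>R sgn \<xi>\<close> the direction
      \<open>sgn \<xi>\<close> is radial up to the factor \<open>s\<close>, so the radial identity
      applies after scaling.\<close>
    then have "s *\<^sub>R L (sgn \<xi>) = L (s *\<^sub>R sgn \<xi>)" by (simp add: linear_scale)
    also have "\<dots> = 0"
      using hessian_radial[OF grad(1)[OF nz] grad(2)[OF _ nz]] by (simp add: hessian_def L_def)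
    finally show ?thesis using s by (simp add: hessian_def L_def)
  qed
  have restricted: "C_on 2 (- ball 0 1) f"
    by (rule C_on_subset[OF smooth(1)]) auto
  have large: "\<forall>\<^sub>F \<xi> :: real^'d^'n in at_infinity. \<xi> \<noteq> 0"
    by (auto simp: eventually_at_infinity intro!: exI[of _ 1])
  have "set_integrable lborel {norm \<xi>..} (\<lambda>s. hessian f (s *\<^sub>R sgn \<xi>) (sgn \<xi>) \<bullet> sgn \<xi>)"
    if "\<xi> \<noteq> 0" for \<xi> :: "real^'d^'n"
  proof -
    have "(\<lambda>s. indicator {norm \<xi>..} s *\<^sub>R (hessian f (s *\<^sub>R sgn \<xi>) (sgn \<xi>) \<bullet> sgn \<xi>)) = (\<lambda>_. 0)"
      using zero[OF that] by (auto simp: indicator_def)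
    then show ?thesis by (simp add: set_integrable_def)
  qed
  with large have integrable: "\<forall>\<^sub>F \<xi> in at_infinity. set_integrable lborel {norm \<xi>..}
      (\<lambda>s. hessian f (s *\<^sub>R sgn \<xi>) (sgn \<xi>) \<bullet> sgn \<xi>)"
    by (auto elim: eventually_mono)
  have integral: "(LINT s:{norm \<xi>..}|lborel. hessian f (s *\<^sub>R sgn \<xi>) (sgn \<xi>) \<bullet> sgn \<xi>) = 0"
    if "\<xi> \<noteq> 0" for \<xi> :: "real^'d^'n"
  proof -
    have "(\<lambda>s. indicator {norm \<xi>..} s *\<^sub>R (hessian f (s *\<^sub>R sgn \<xi>) (sgn \<xi>) \<bullet> sgn \<xi>)) = (\<lambda>_. 0)"
      using zero[OF that] by (auto simp: indicator_def)
    then show ?thesis by (simp add: set_lebesgue_integral_def)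
  qed
  have "(SUP \<xi>\<in>{\<xi>. norm a \<le> norm \<xi>}. ereal (norm \<xi> *
      (LINT s:{norm \<xi>..}|lborel. hessian f (s *\<^sub>R sgn \<xi>) (sgn \<xi>) \<bullet> sgn \<xi>))) = 0"
    if "a \<noteq> 0" for a :: "real^'d^'n"
  proof -
    have "\<xi> \<noteq> 0" if "norm a \<le> norm \<xi>" for \<xi> :: "real^'d^'n"
      using that \<open>a \<noteq> 0\<close> by auto
    then have "(SUP \<xi>\<in>{\<xi>. norm a \<le> norm \<xi>}. ereal (norm \<xi> *
        (LINT s:{norm \<xi>..}|lborel. hessian f (s *\<^sub>R sgn \<xi>) (sgn \<xi>) \<bullet> sgn \<xi>))) =
        (SUP \<xi>\<in>{\<xi> :: real^'d^'n. norm a \<le> norm \<xi>}. 0 :: ereal)"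
      by (intro SUP_cong) (auto simp: integral)
    also have "\<dots> = 0" by (rule SUP_const) auto
    finally show ?thesis .
  qed
  then have "((\<lambda>a. SUP \<xi>\<in>{\<xi>. norm a \<le> norm \<xi>}. ereal (norm \<xi> *
      (LINT s:{norm \<xi>..}|lborel. hessian f (s *\<^sub>R sgn \<xi>) (sgn \<xi>) \<bullet> sgn \<xi>))) \<longlongrightarrow> 0)
      (at_infinity :: (real^'d^'n) filter)"
    using large by (intro tendsto_eventually) (auto elim: eventually_mono)
  then show ?thesis
    unfolding cond_c_def using restricted smooth(2) integrable by (intro conjI exI[of _ 1]) auto
qed

lemma outer_unit_normal_ball:
  fixes x :: "'a::euclidean_space"
  assumes "norm x = 1"
  shows "outer_unit_normal (ball 0 1) x = x"
  unfolding outer_unit_normal_def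
proof (rule the_equality)
  have xx: "x \<bullet> x = 1" using assms by (simp add: dot_square_norm)
  show "norm x = 1 \<and> (\<forall>\<epsilon>>0. \<exists>\<delta>>0. \<forall>y\<in>ball x \<delta>.
      (y \<in> ball 0 1 \<longrightarrow> (y - x) \<bullet> x \<le> \<epsilon> * norm (y - x)) \<and>
      (y \<notin> ball 0 1 \<longrightarrow> (y - x) \<bullet> x \<ge> - \<epsilon> * norm (y - x)))"
  proof (intro conjI allI impI)
    fix \<epsilon> :: real assume "\<epsilon> > 0"
    show "\<exists>\<delta>>0. \<forall>y\<in>ball x \<delta>.
      (y \<in> ball 0 1 \<longrightarrow> (y - x) \<bullet> x \<le> \<epsilon> * norm (y - x)) \<and>
      (y \<notin> ball 0 1 \<longrightarrow> (y - x) \<bullet> x \<ge> - \<epsilon> * norm (y - x))"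
    \<comment> \<open>Outside the ball \<open>(y - x) \<bullet> x\<close> is at least -|y - x|^2 /
      2, so the radius \<open>\<epsilon>\<close> itself works; inside, the product is nonpositive by
      Cauchy--Schwarz.\<close>
    proof (intro exI[of _ \<epsilon>] conjI ballI impI \<open>\<epsilon> > 0\<close>)
      fix y :: 'a assume "y \<in> ball 0 1"
      then have "y \<bullet> x \<le> 1" using norm_cauchy_schwarz[of y x] assms by simp
      moreover have "0 \<le> \<epsilon> * norm (y - x)" using \<open>\<epsilon> > 0\<close> by simp
      ultimately show "(y - x) \<bullet> x \<le> \<epsilon> * norm (y - x)" by (simp add: inner_diff_left xx)
    next
      fix y :: 'a assume y: "y \<in> ball x \<epsilon>" "y \<notin> ball 0 1"
      have "1 \<le> (norm y)\<^sup>2" using y(2) by (simp add: one_le_power)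
      moreover have "(norm (y - x))\<^sup>2 = (norm y)\<^sup>2 + 1 - 2 * (y \<bullet> x)"
        by (simp add: power2_norm_eq_inner inner_diff_left inner_diff_right xx inner_commute)
      moreover have "(norm (y - x))\<^sup>2 \<le> \<epsilon> * norm (y - x)"
        using y(1) by (simp add: power2_eq_square dist_norm norm_minus_commute mult_right_mono)
      moreover have "0 \<le> \<epsilon> * norm (y - x)" using \<open>\<epsilon> > 0\<close> by simp
      ultimately show "(y - x) \<bullet> x \<ge> - \<epsilon> * norm (y - x)"
        unfolding inner_diff_left xx mult_minus_left by linarith
    qed
  qed (rule assms)
next
  fix n assume n: "norm n = 1 \<and> (\<forall>\<epsilon>>0. \<exists>\<delta>>0. \<forall>y\<in>ball x \<delta>.
      (y \<in> ball 0 1 \<longrightarrow> (y - x) \<bullet> n \<le> \<epsilon> * norm (y - x)) \<and>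
      (y \<notin> ball 0 1 \<longrightarrow> (y - x) \<bullet> n \<ge> - \<epsilon> * norm (y - x)))"
  have xx: "x \<bullet> x = 1" and nn: "n \<bullet> n = 1" using assms n by (auto simp: dot_square_norm)
  show "n = x"
  proof (rule ccontr)
    assume "n \<noteq> x"
    \<comment> \<open>Moving from \<open>x\<close> in the direction \<open>n - x\<close> enters the ball, but increases the \<open>n\<close>-component.\<close>
    define v where "v = n - x"
    have v: "v \<noteq> 0" using \<open>n \<noteq> x\<close> by (simp add: v_def)
    define c where "c = v \<bullet> v / 2"
    have c: "c > 0" using v by (simp add: c_def)
    have "c = 1 - n \<bullet> x"
      by (simp add: c_def v_def inner_diff_left inner_diff_right xx nn inner_commute field_simps)
    then have vn: "v \<bullet> n = c" and vx: "v \<bullet> x = - c"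
      by (simp_all add: v_def inner_diff_left inner_diff_right xx nn inner_commute)
    \<comment> \<open>Half the slope of \<open>v\<close> along \<open>n\<close>: at
      \<open>y = x + t *\<^sub>R v\<close> the left side of the normal condition is
      \<open>t * c\<close>, the right side only \<open>t * c / 2\<close>.\<close>
    define \<epsilon> where "\<epsilon> = c / (2 * norm v)"
    have "\<epsilon> > 0" using c v by (simp add: \<epsilon>_def)
    then obtain \<delta> where \<delta>: "\<delta> > 0"
      "\<And>y. y \<in> ball x \<delta> \<Longrightarrow> y \<in> ball 0 1 \<Longrightarrow> (y - x) \<bullet> n \<le> \<epsilon> * norm (y - x)"
      using n by metis
    \<comment> \<open>The bound 1/2 makes \<open>1 - t\<close> positive, so that |y|^2 = 1 - 2 t c
      (1 - t) is below 1; the other bound keeps \<open>y\<close> in the ball of radius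
      \<open>\<delta>\<close>.\<close>
    define t where "t = min (1/2) (\<delta> / (2 * norm v))"
    have t: "t > 0" "t \<le> 1/2" "t * norm v < \<delta>"
    proof -
      show "t > 0" "t \<le> 1/2" using \<delta>(1) v by (auto simp: t_def)
      have "t * norm v \<le> \<delta> / (2 * norm v) * norm v" by (intro mult_right_mono) (auto simp: t_def)
      also have "\<dots> < \<delta>" using \<delta>(1) v by simp
      finally show "t * norm v < \<delta>" .
    qed
    define y where "y = x + t *\<^sub>R v"
    have "(norm y)\<^sup>2 = 1 - 2 * t * c + t\<^sup>2 * (2 * c)"
      unfolding power2_norm_eq_inner y_def
      using vx by (simp add: inner_add_left inner_add_right xx inner_commute c_def power2_eq_square)
    also have "\<dots> = 1 - 2 * (t * c) * (1 - t)" by (simp add: power2_eq_square algebra_simps)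
    also have "\<dots> < 1" using t c by simp
    finally have "norm y < 1" by (simp add: power2_less_1_iff abs_square_less_1)
    moreover have "y \<in> ball x \<delta>" using t by (simp add: y_def dist_norm)
    ultimately have "(y - x) \<bullet> n \<le> \<epsilon> * norm (y - x)" using \<delta>(2) by simp
    then have "t * c \<le> \<epsilon> * (t * norm v)" using t(1) by (simp add: y_def vn)
    also have "\<dots> = t * c / 2" using v by (simp add: \<epsilon>_def)
    finally show False using t(1) c by simp
  qed
qed

lemma divergence_vector_2:
  fixes p q :: "real^2 \<Rightarrow> real"
  assumes "(p has_derivative p') (at x)" "(q has_derivative q') (at x)"
  shows "divergence (\<lambda>x. vector [p x, q x] :: real^2) x = p' (axis 1 1) + q' (axis 2 1)"
proof -
  have eq: "vector [a, b] = a *\<^sub>R axis 1 1 + b *\<^sub>R (axis 2 1 :: real^2)" for a b :: real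
    by (simp add: vec_eq_iff forall_2 axis_def)
  have "((\<lambda>x. vector [p x, q x] :: real^2) has_derivative (\<lambda>h. vector [p' h, q' h])) (at x)"
    unfolding eq by (intro has_derivative_add has_derivative_scaleR_left assms)
  from frechet_derivative_at[OF this, symmetric] show ?thesis
    by (simp add: divergence_def sum_2)
qed

section \<open>The example\<close>

definition cofactor :: "real^2^2 \<Rightarrow> real^2^2" where
  "cofactor \<xi> = vector [vector [\<xi>$2$2, - (\<xi>$2$1)], vector [- (\<xi>$1$2), \<xi>$1$1]]"

text \<open>\<open>cofactor \<xi> \<bullet> \<xi>\<close> is twice the determinant, whence the
  factor 1/2.\<close>

definition qmap :: "real^2^2 \<Rightarrow> real^2^2" where
  "qmap \<xi> = \<xi> + (1/2) *\<^sub>R cofactor \<xi>"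

text \<open>A factor of \<open>qmap\<close>, which is the adjoint of \<open>qroot\<close> composed with \<open>qroot\<close>.\<close>

definition qroot :: "real^2^2 \<Rightarrow> real^2^2" where
  "qroot \<xi> = vector [vector [\<xi>$1$1 + \<xi>$2$2 / 2, \<xi>$1$2 - \<xi>$2$1 / 2],
     vector [sqrt 3 / 2 * \<xi>$2$1, sqrt 3 / 2 * \<xi>$2$2]]"

text \<open>As the Euclidean norm of an injective linear image, the integrand inherits convexity,
  the triangle inequality, Cauchy--Schwarz and smoothness off the origin without handling a square
  root.\<close>

definition qnorm :: "real^2^2 \<Rightarrow> real" where
  "qnorm \<xi> = norm (qroot \<xi>)"

lemma qnorm_nonneg: "0 \<le> qnorm \<xi>"
  by (simp add: qnorm_def)

lemma inner_matrix_2: "(\<xi> :: real^2^2) \<bullet> \<eta> =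
    \<xi>$1$1 * \<eta>$1$1 + \<xi>$1$2 * \<eta>$1$2 + \<xi>$2$1 * \<eta>$2$1 + \<xi>$2$2 * \<eta>$2$2"
  by (simp add: inner_vec_def sum_2)

lemma matrix_2_eq_iff: "(\<xi> :: real^2^2) = \<eta> \<longleftrightarrow>
    \<xi>$1$1 = \<eta>$1$1 \<and> \<xi>$1$2 = \<eta>$1$2 \<and> \<xi>$2$1 = \<eta>$2$1 \<and> \<xi>$2$2 = \<eta>$2$2"
  by (auto simp: vec_eq_iff forall_2)

lemma bounded_linear_qroot: "bounded_linear qroot"
  unfolding linear_conv_bounded_linear[symmetric]
  by (rule linearI) (simp_all add: qroot_def matrix_2_eq_iff field_simps)

lemma bounded_linear_qmap: "bounded_linear qmap"
  unfolding linear_conv_bounded_linear[symmetric]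
  by (rule linearI) (simp_all add: qmap_def cofactor_def matrix_2_eq_iff field_simps)

lemma inner_qroot: "qroot \<xi> \<bullet> qroot \<eta> = qmap \<xi> \<bullet> \<eta>"
proof -
  have *: "sqrt 3 * (sqrt 3 * x) = 3 * x" for x by (simp flip: mult.assoc)
  show ?thesis
    by (simp add: * inner_matrix_2 qroot_def qmap_def cofactor_def algebra_simps add_divide_distrib)
qed

lemma qnorm_power2: "(qnorm \<xi>)\<^sup>2 = qmap \<xi> \<bullet> \<xi>"
  by (simp add: qnorm_def power2_norm_eq_inner inner_qroot)

lemma qmap_symmetric: "qmap \<xi> \<bullet> \<eta> = \<xi> \<bullet> qmap \<eta>"
  by (simp add: inner_matrix_2 qmap_def cofactor_def field_simps)

text \<open>The least eigenvalue of \<open>qmap\<close> is 1/2, on anticonformal matrices, and the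
  largest is 3/2, on conformal ones. The remainder here is the squared norm of the conformal part;
  in the upper bound that follows it is that of the anticonformal part.\<close>

lemma qmap_ge: "(\<xi> \<bullet> \<xi>) / 2 \<le> qmap \<xi> \<bullet> \<xi>"
proof -
  have "qmap \<xi> \<bullet> \<xi> - (\<xi> \<bullet> \<xi>) / 2 = ((\<xi>$1$1 + \<xi>$2$2)\<^sup>2 + (\<xi>$1$2 - \<xi>$2$1)\<^sup>2) / 2"
    by (simp add: inner_matrix_2 qmap_def cofactor_def field_simps power2_eq_square)
  then show ?thesis by (metis diff_ge_0_iff_ge divide_nonneg_pos sum_power2_ge_zero zero_less_numeral)
qed

lemma qmap_le: "qmap \<xi> \<bullet> \<xi> \<le> 3 / 2 * (\<xi> \<bullet> \<xi>)"
proof -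
  have "3 / 2 * (\<xi> \<bullet> \<xi>) - qmap \<xi> \<bullet> \<xi> = ((\<xi>$1$1 - \<xi>$2$2)\<^sup>2 + (\<xi>$1$2 + \<xi>$2$1)\<^sup>2) / 2"
    by (simp add: inner_matrix_2 qmap_def cofactor_def field_simps power2_eq_square)
  then show ?thesis by (metis diff_ge_0_iff_ge divide_nonneg_pos sum_power2_ge_zero zero_less_numeral)
qed

text \<open>The sharp factors are the square roots of 1/2 and 3/2; they are rounded so that the
  single constant 2 serves in (b).\<close>

lemma qnorm_bounds: "norm \<xi> / 2 \<le> qnorm \<xi>" "qnorm \<xi> \<le> 2 * norm \<xi>"
proof -
  have nonneg: "0 \<le> \<xi> \<bullet> \<xi>" by simp
  have "(norm \<xi> / 2)\<^sup>2 \<le> (qnorm \<xi>)\<^sup>2"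
    unfolding qnorm_power2 power_divide power2_norm_eq_inner
    by simp (use qmap_ge[of \<xi>] nonneg in linarith)
  then show "norm \<xi> / 2 \<le> qnorm \<xi>" by (rule power2_le_imp_le) (rule qnorm_nonneg)
  have "(qnorm \<xi>)\<^sup>2 \<le> (2 * norm \<xi>)\<^sup>2"
    unfolding qnorm_power2 power_mult_distrib power2_norm_eq_inner
    by simp (use qmap_le[of \<xi>] nonneg in linarith)
  then show "qnorm \<xi> \<le> 2 * norm \<xi>" by (rule power2_le_imp_le) simp
qed

lemma qroot_eq_0_iff: "qroot \<xi> = 0 \<longleftrightarrow> \<xi> = 0"
  using qnorm_bounds[of \<xi>] by (auto simp: qnorm_def)

lemma qnorm_pos: "\<xi> \<noteq> 0 \<Longrightarrow> qnorm \<xi> > 0"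
  by (simp add: qnorm_def qroot_eq_0_iff)

text \<open>Cauchy--Schwarz for the inner product defined by \<open>qmap\<close>. It puts
  \<open>qmap \<rho>\<close> into the polar body as soon as
  \<open>qnorm \<rho> \<le> 1\<close>.\<close>

lemma qmap_inner_le: "qmap \<rho> \<bullet> \<xi> \<le> qnorm \<rho> * qnorm \<xi>"
  unfolding inner_qroot[symmetric] qnorm_def by (rule norm_cauchy_schwarz)

section \<open>Regularity of the integrand and the conditions (a) to (g)\<close>

lemma pos_homogeneous1_qnorm: "pos_homogeneous1 qnorm"
  by (simp add: pos_homogeneous1_def qnorm_def linear_scale bounded_linear_qroot bounded_linear.linear)

lemma qnorm_diff_le: "qnorm (\<xi> - \<eta>) \<le> qnorm \<xi> + qnorm \<eta>"
  by (simp add: qnorm_def linear_diff[OF bounded_linear.linear[OF bounded_linear_qroot]] norm_triangle_ineq4)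

lemma qnorm_uminus: "qnorm (- \<xi>) = qnorm \<xi>"
  by (simp add: qnorm_def linear_neg[OF bounded_linear.linear[OF bounded_linear_qroot]])

lemma recession_qnorm: "recession qnorm = qnorm"
  by (rule recession_eq) (rule pos_homogeneous1_qnorm)

lemma continuous_qnorm: "continuous_on UNIV qnorm"
  unfolding qnorm_def
  by (intro continuous_on_norm linear_continuous_on bounded_linear_qroot)

lemma C_on_qnorm: "C_on k (- {0}) qnorm"
  unfolding qnorm_def
  by (rule C_on_elementary[where U="- {0}"])
    (auto intro!: elementary_on.norm bounded_linear_qroot simp: qroot_eq_0_iff)

lemma grad_qnorm: "\<xi> \<noteq> 0 \<Longrightarrow> grad qnorm \<xi> = inverse (qnorm \<xi>) *\<^sub>R qmap \<xi>"
proof (rule grad_eq)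
  assume "\<xi> \<noteq> 0"
  then have "(qnorm has_derivative (\<lambda>v. inverse (norm (qroot \<xi>)) * (qroot \<xi> \<bullet> qroot v))) (at \<xi>)"
    unfolding qnorm_def[abs_def]
    by (intro has_derivative_norm_linear bounded_linear_qroot) (simp add: qroot_eq_0_iff)
  then show "GDERIV qnorm \<xi> :> inverse (qnorm \<xi>) *\<^sub>R qmap \<xi>"
    by (simp add: gderiv_def inner_qroot qnorm_def inner_commute[of "qmap \<xi>"])
qed

lemma grad_qnorm_scale: "t > 0 \<Longrightarrow> \<xi> \<noteq> 0 \<Longrightarrow> grad qnorm (t *\<^sub>R \<xi>) = grad qnorm \<xi>"
  using pos_homogeneous1_qnorm
  by (simp add: grad_qnorm pos_homogeneous1_def linear_scale[OF bounded_linear.linear[OF bounded_linear_qmap]])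

lemma grad_qnorm_differentiable:
  assumes "\<xi> \<noteq> 0"
  shows "grad qnorm differentiable (at \<xi>)"
proof -
  have "(\<lambda>\<xi>. inverse (qnorm \<xi>) *\<^sub>R qmap \<xi>) differentiable (at \<xi>)"
  proof -
    have "qnorm differentiable (at \<xi>)"
      unfolding qnorm_def[abs_def]
      by (rule differentiableI[OF has_derivative_norm_linear[OF bounded_linear_qroot]])
        (simp add: qroot_eq_0_iff assms)
    then show ?thesis
      using qnorm_pos[OF assms]
      by (intro differentiable_scaleR differentiable_inverse
        bounded_linear_imp_differentiable[OF bounded_linear_qmap]) auto
  qed
  then obtain D where "((\<lambda>\<xi>. inverse (qnorm \<xi>) *\<^sub>R qmap \<xi>) has_derivative D) (at \<xi>)"
    by (auto simp: differentiable_def)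
  then have "(grad qnorm has_derivative D) (at \<xi>)"
    by (rule has_derivative_transform_within_open[of _ _ _ _ "- {0}"])
      (use assms in \<open>auto simp: grad_qnorm\<close>)
  then show ?thesis by (rule differentiableI)
qed

lemma convex_qnorm: "convex_on UNIV qnorm"
proof (rule convex_onI)
  fix t :: real and x y :: "real^2^2" assume t: "0 < t" "t < 1"
  have "qroot ((1 - t) *\<^sub>R x + t *\<^sub>R y) = (1 - t) *\<^sub>R qroot x + t *\<^sub>R qroot y"
    by (simp add: bounded_linear.linear[OF bounded_linear_qroot] linear_add linear_scale)
  then show "qnorm ((1 - t) *\<^sub>R x + t *\<^sub>R y) \<le> (1 - t) * qnorm x + t * qnorm y"
    unfolding qnorm_def using t norm_triangle_ineq[of "(1 - t) *\<^sub>R qroot x" "t *\<^sub>R qroot y"] by simp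
qed simp

lemma cond_b_qnorm: "cond_b qnorm"
  unfolding cond_b_def
proof (intro exI[of _ 2] conjI allI)
  fix \<xi> :: "real^2^2"
  show "1 / 2 * norm \<xi> - 2 \<le> qnorm \<xi>" "qnorm \<xi> \<le> 2 * (norm \<xi> + 1)"
    using qnorm_bounds[of \<xi>] by simp_all
qed simp

text \<open>The squared integrand is a quadratic form with constant Hessian
  \<open>2 *\<^sub>R qmap h\<close>, whose least eigenvalue is 1; hence
  \<open>C2 = 1\<close>.\<close>

lemma cond_f_qnorm: "cond_f qnorm"
proof -
  have "GDERIV (\<lambda>\<eta>. (qnorm \<eta>)\<^sup>2) \<xi> :> 2 *\<^sub>R qmap \<xi>" for \<xi>
  proof -
    have "((\<lambda>\<eta>. qmap \<eta> \<bullet> \<eta>) has_derivative (\<lambda>h. qmap \<xi> \<bullet> h + qmap h \<bullet> \<xi>)) (at \<xi>)"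
      by (intro has_derivative_inner bounded_linear_imp_has_derivative bounded_linear_qmap has_derivative_ident)
    moreover have "qmap \<xi> \<bullet> h + qmap h \<bullet> \<xi> = h \<bullet> (2 *\<^sub>R qmap \<xi>)" for h
      by (simp add: inner_commute[of "qmap \<xi>"] qmap_symmetric[of h])
    ultimately show ?thesis unfolding gderiv_def qnorm_power2 by simp
  qed
  then have "grad (\<lambda>\<eta>. (qnorm \<eta>)\<^sup>2) = (\<lambda>\<xi>. 2 *\<^sub>R qmap \<xi>)" by (auto intro: grad_eq)
  moreover have "frechet_derivative (\<lambda>\<xi>. 2 *\<^sub>R qmap \<xi>) (at \<xi>) = (\<lambda>\<xi>. 2 *\<^sub>R qmap \<xi>)" for \<xi>
    by (rule frechet_derivative_at[symmetric])
      (intro bounded_linear_imp_has_derivative bounded_linear_compose[OF bounded_linear_scaleR_right bounded_linear_qmap])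
  ultimately have "hessian (\<lambda>\<eta>. (qnorm \<eta>)\<^sup>2) \<xi> h \<bullet> h \<ge> 1 * (h \<bullet> h)" for \<xi> h
    using qmap_ge[of h] by (simp add: hessian_def)
  then show ?thesis unfolding cond_f_def recession_qnorm by (intro exI[of _ 1]) auto
qed

lemma not_cond_e_qnorm: "\<not> cond_e qnorm"
proof
  assume "cond_e qnorm"
  then obtain \<mu>1 :: "real^2 \<Rightarrow> real^2" and \<mu>2 :: "real^2 \<Rightarrow> real^2" where
    \<mu>: "\<And>v1 v2. v1 \<noteq> 0 \<Longrightarrow> v2 \<noteq> 0 \<Longrightarrow> grad qnorm (v1 \<otimes>\<^sub>v v2) = \<mu>1 v1 \<otimes>\<^sub>v \<mu>2 v2"
    unfolding cond_e_def recession_qnorm by blast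
  define e :: "real^2" where "e = vector [1, 0]"
  define E :: "real^2^2" where "E = e \<otimes>\<^sub>v e"
  have e: "e \<noteq> 0" by (simp add: e_def vec_eq_iff forall_2)
  have E: "E$1$1 = 1" "E$1$2 = 0" "E$2$1 = 0" "E$2$2 = 0"
    by (simp_all add: E_def e_def tensor_def)
  then have "E \<noteq> 0" by (auto simp: matrix_2_eq_iff)
  have "(qnorm E)\<^sup>2 = 1"
    unfolding qnorm_power2 by (simp add: inner_matrix_2 qmap_def cofactor_def E)
  then have "qnorm E = 1" using qnorm_pos[OF \<open>E \<noteq> 0\<close>] by (simp add: power2_eq_1_iff)
  then have G: "grad qnorm E = qmap E" using \<open>E \<noteq> 0\<close> by (simp add: grad_qnorm)
  have "qmap E = \<mu>1 e \<otimes>\<^sub>v \<mu>2 e" using \<mu>[OF e e] G by (simp add: E_def)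
  \<comment> \<open>A tensor product has determinant 0, whatever \<open>\<mu>1\<close> and
    \<open>\<mu>2\<close> are, whereas \<open>qmap E\<close> is the diagonal matrix with entries 1
    and 1/2.\<close>
  then have "qmap E $1$1 * qmap E $2$2 = qmap E $1$2 * qmap E $2$1"
    by (simp add: tensor_def)
  then show False by (simp add: qmap_def cofactor_def E)
qed

lemma conditions_qnorm:
  "cond_a qnorm" "cond_b qnorm" "cond_c qnorm" "cond_d qnorm" "\<not> cond_e qnorm" "cond_f qnorm" "cond_g qnorm"
proof -
  show "cond_a qnorm" using convex_qnorm by (simp add: cond_a_def)
  show "cond_c qnorm"
    by (intro cond_c_homogeneous C_on_qnorm grad_qnorm_differentiable grad_qnorm_scale)
  show "cond_d qnorm" by (simp add: cond_d_def recession_qnorm C_on_qnorm)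
  \<comment> \<open>The integrand is its own recession function, so premise and conclusion of (g)
    are the same equation.\<close>
  show "cond_g qnorm" by (simp add: cond_g_def recession_qnorm)
qed (rule cond_b_qnorm cond_f_qnorm not_cond_e_qnorm)+

text \<open>In complex notation \<open>z = x$1 + i x$2\<close>, the boundary datum is \<open>z\<^sup>2\<close>.\<close>

definition square_datum :: "real^2 \<Rightarrow> real^2" where
  "square_datum x = vector [(x$1)\<^sup>2 - (x$2)\<^sup>2, 2 * (x$1 * x$2)]"

text \<open>A matrix is the sum of a conformal one, given by a complex number \<open>\<zeta>\<close>, and an anticonformal
  one, given by \<open>\<eta>\<close>; its rows are \<open>(Re \<zeta> + Re \<eta>, Im \<eta> - Im \<zeta>)\<close> and \<open>(Im \<zeta> + Im \<eta>, Re \<zeta> - Re \<eta>)\<close>.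
  The rows are divergence-free iff the derivative of \<open>\<zeta>\<close> with respect to the conjugate of \<open>z\<close>
  and that of \<open>\<eta>\<close> with respect to \<open>z\<close> add up to zero, and \<open>qmap\<close> multiplies \<open>\<zeta>\<close> by \<open>3/2\<close> and
  \<open>\<eta>\<close> by \<open>1/2\<close>. The calibration has \<open>\<zeta> = 3/2 (1 - \<bar>z\<bar>\<^sup>2/2) z\<close> and \<open>\<eta> = z\<^sup>3/4\<close>, which is
  \<open>qmap (z\<^sup>2 \<otimes> z)\<close> on the unit circle.\<close>

definition row1 :: "real^2 \<Rightarrow> real^2" where
  "row1 x = vector
    [(3/2 - 3/4 * ((x$1)\<^sup>2 + (x$2)\<^sup>2)) * x$1 + 1/4 * (x$1 ^ 3 - 3 * (x$1 * (x$2)\<^sup>2)),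
     1/4 * (3 * ((x$1)\<^sup>2 * x$2) - x$2 ^ 3) - (3/2 - 3/4 * ((x$1)\<^sup>2 + (x$2)\<^sup>2)) * x$2]"

definition row2 :: "real^2 \<Rightarrow> real^2" where
  "row2 x = vector
    [(3/2 - 3/4 * ((x$1)\<^sup>2 + (x$2)\<^sup>2)) * x$2 + 1/4 * (3 * ((x$1)\<^sup>2 * x$2) - x$2 ^ 3),
     (3/2 - 3/4 * ((x$1)\<^sup>2 + (x$2)\<^sup>2)) * x$1 - 1/4 * (x$1 ^ 3 - 3 * (x$1 * (x$2)\<^sup>2))]"

definition calibration :: "real^2 \<Rightarrow> real^2^2" where
  "calibration x = vector [row1 x, row2 x]"

text \<open>The preimage of the calibration under \<open>qmap\<close>, with conformal part (1 - s/2)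
  z and anticonformal part z^3/2; \<open>a\<close> and \<open>b\<close> are the real and imaginary
  parts of z^3. Polarity of the calibration becomes a bound on \<open>qnorm\<close> of this
  matrix.\<close>

definition precalibration :: "real^2 \<Rightarrow> real^2^2" where
  "precalibration x = (let s = (x$1)\<^sup>2 + (x$2)\<^sup>2; a = x$1 ^ 3 - 3 * (x$1 * (x$2)\<^sup>2);
     b = 3 * ((x$1)\<^sup>2 * x$2) - x$2 ^ 3 in
     vector [vector [(1 - s/2) * x$1 + a/2, b/2 - (1 - s/2) * x$2],
       vector [(1 - s/2) * x$2 + b/2, (1 - s/2) * x$1 - a/2]])"

lemma calibration_eq_qmap: "calibration x = qmap (precalibration x)"
  by (simp add: calibration_def row1_def row2_def qmap_def cofactor_def precalibration_def Let_def
      matrix_2_eq_iff field_simps)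

lemma norm_power2_2: "(norm (x :: real^2))\<^sup>2 = (x$1)\<^sup>2 + (x$2)\<^sup>2"
  unfolding power2_norm_eq_inner by (simp add: inner_vec_def sum_2 power2_eq_square)

text \<open>With s = |z|^2 the conformal part contributes 3s (1 - s/2)^2 and the anticonformal part
  s^3/4, which add up to 3s - 3s^2 + s^3. The value is at most 1 precisely on the closed
  disc.\<close>

lemma qnorm_precalibration: "(qnorm (precalibration x))\<^sup>2 = 1 - (1 - (norm x)\<^sup>2) ^ 3"
  unfolding qnorm_power2 norm_power2_2
  by (simp add: inner_matrix_2 qmap_def cofactor_def precalibration_def Let_def)
    (simp add: field_simps power2_eq_square power3_eq_cube)

lemma calibration_polar:
  assumes "norm x \<le> 1"
  shows "calibration x \<bullet> \<xi> \<le> qnorm \<xi>"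
proof -
  have "(norm x)\<^sup>2 \<le> 1" using assms by (simp add: power_le_one)
  then have "(qnorm (precalibration x))\<^sup>2 \<le> 1\<^sup>2" unfolding qnorm_precalibration by simp
  then have "qnorm (precalibration x) \<le> 1" by (rule power2_le_imp_le) simp
  then have "qnorm (precalibration x) * qnorm \<xi> \<le> 1 * qnorm \<xi>"
    by (rule mult_right_mono) (rule qnorm_nonneg)
  with qmap_inner_le[of "precalibration x" \<xi>] show ?thesis by (simp add: calibration_eq_qmap)
qed

lemma calibration_boundary:
  assumes "norm x = 1"
  shows "calibration x \<bullet> (square_datum x \<otimes>\<^sub>v x) = qnorm (square_datum x \<otimes>\<^sub>v x)"
proof -
  have s: "(x$1)\<^sup>2 + (x$2)\<^sup>2 = 1" using assms norm_power2_2[of x] by simp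
  have "calibration x \<bullet> (square_datum x \<otimes>\<^sub>v x) =
      (3/2 - ((x$1)\<^sup>2 + (x$2)\<^sup>2) / 2) * ((x$1)\<^sup>2 + (x$2)\<^sup>2)\<^sup>2"
    by (simp add: inner_matrix_2 calibration_def row1_def row2_def square_datum_def tensor_def)
      (simp add: field_simps power2_eq_square power3_eq_cube)
  then have 1: "calibration x \<bullet> (square_datum x \<otimes>\<^sub>v x) = 1" by (simp add: s)
  \<comment> \<open>The determinant of a rank-one matrix vanishes, so only the Frobenius norm
    |z^2|^2 |z|^2 = |z|^6 is left.\<close>
  have "(qnorm (square_datum x \<otimes>\<^sub>v x))\<^sup>2 = ((x$1)\<^sup>2 + (x$2)\<^sup>2) ^ 3"
    unfolding qnorm_power2
    by (simp add: inner_matrix_2 qmap_def cofactor_def square_datum_def tensor_def)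
      (simp add: field_simps power2_eq_square power3_eq_cube)
  then have "qnorm (square_datum x \<otimes>\<^sub>v x) = 1"
    using qnorm_nonneg[of "square_datum x \<otimes>\<^sub>v x"] by (auto simp: s power2_eq_1_iff)
  with 1 show ?thesis by simp
qed

lemma divergence_row1: "divergence row1 x = 0"
proof -
  have c: "((\<lambda>x::real^2. x$i) has_derivative (\<lambda>h. h$i)) (at x)" for i
    by (rule bounded_linear_imp_has_derivative[OF bounded_linear_vec_nth])
  show ?thesis
    unfolding row1_def[abs_def]
    by (subst divergence_vector_2)
      (rule derivative_intros c refl | simp add: axis_def power2_eq_square power3_eq_cube algebra_simps)+
qed

lemma divergence_row2: "divergence row2 x = 0"
proof -
  have c: "((\<lambda>x::real^2. x$i) has_derivative (\<lambda>h. h$i)) (at x)" for i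
    by (rule bounded_linear_imp_has_derivative[OF bounded_linear_vec_nth])
  show ?thesis
    unfolding row2_def[abs_def]
    by (subst divergence_vector_2)
      (rule derivative_intros c refl | simp add: axis_def power2_eq_square power3_eq_cube algebra_simps)+
qed

lemma C_on_row1: "C_on k S row1"
  unfolding row1_def[abs_def]
  by (rule C_on_vector_2)
    (intro elementary_on.plus elementary_on_diff elementary_on.times elementary_on_power
      elementary_on_vec_nth elementary_on.const)+

lemma C_on_row2: "C_on k S row2"
  unfolding row2_def[abs_def]
  by (rule C_on_vector_2)
    (intro elementary_on.plus elementary_on_diff elementary_on.times elementary_on_power
      elementary_on_vec_nth elementary_on.const)+

lemma C_on_square_datum: "C_on k S square_datum"
  unfolding square_datum_def[abs_def]
  by (rule C_on_vector_2)
    (intro elementary_on.plus elementary_on_diff elementary_on.times elementary_on_power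
      elementary_on_vec_nth elementary_on.const)+

lemma continuous_calibration: "continuous_on UNIV calibration"
proof -
  have "continuous_on UNIV (\<lambda>x. calibration x $ i)" for i
    using exhaust_2[of i] C_on_imp_continuous_on[OF C_on_row1[of 1 UNIV]]
      C_on_imp_continuous_on[OF C_on_row2[of 1 UNIV]]
    by (auto simp: calibration_def)
  then have "continuous_on UNIV (\<lambda>x. \<chi> i. calibration x $ i)" by (rule continuous_on_vec_lambda)
  then show ?thesis by simp
qed

lemma square_datum_neq_0:
  assumes "norm x = 1"
  shows "square_datum x \<noteq> 0"
proof -
  have "(norm (square_datum x))\<^sup>2 = ((norm x)\<^sup>2)\<^sup>2"
    unfolding norm_power2_2 by (simp add: square_datum_def power2_eq_square algebra_simps)
  then show ?thesis using assms by auto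
qed

text \<open>The first coordinate is 1-Lipschitz and maps the circle onto an interval of length 2,
  which is enough for positivity.\<close>

lemma emeasure_circle_pos: "emeasure (hausdorff_measure 1) (sphere (0 :: real^2) 1) > 0"
proof -
  have "{-1..1} \<subseteq> (\<lambda>x. x$1) ` sphere (0 :: real^2) 1"
  proof
    fix t :: real assume "t \<in> {-1..1}"
    then have "t\<^sup>2 \<le> 1" by (auto simp: abs_square_le_1 abs_le_iff)
    define x :: "real^2" where "x = vector [t, sqrt (1 - t\<^sup>2)]"
    have "(norm x)\<^sup>2 = 1" using \<open>t\<^sup>2 \<le> 1\<close> by (simp add: norm_power2_2 x_def)
    then have "x \<in> sphere 0 1" using norm_ge_zero[of x] by (auto simp: power2_eq_1_iff simp del: norm_ge_zero)
    moreover have "t = x$1" by (simp add: x_def)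
    ultimately show "t \<in> (\<lambda>x. x$1) ` sphere (0 :: real^2) 1" by blast
  qed
  moreover have "\<bar>x$1 - y$1\<bar> \<le> dist x y" for x y :: "real^2"
    using component_le_norm_cart[of "x - y" 1] by (simp add: dist_norm)
  ultimately have "ennreal (1 - - 1) \<le> hausdorff_outer 1 (sphere (0 :: real^2) 1)"
    by (intro hausdorff_outer_1_ge_shadow)
  then have "ennreal 2 \<le> hausdorff_outer 1 (sphere (0 :: real^2) 1)" by simp
  then show ?thesis
    by (simp add: emeasure_hausdorff_measure less_le_trans[of 0 "ennreal 2"])
qed

lemma BV_minimizer_square_datum: "BV_minimizer (ball 0 1) qnorm square_datum (\<lambda>_. 0)"
proof (rule BV_minimizer_zero_calibration[where \<sigma>=calibration and C=2])
  have \<nu>: "outer_unit_normal (ball 0 1) x = x" if "x \<in> frontier (ball 0 1)" for x :: "real^2"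
    using that by (simp add: outer_unit_normal_ball)
  show "C_on 1 UNIV (\<lambda>x. calibration x $ i)" for i
    using exhaust_2[of i] C_on_row1[of 1 UNIV] C_on_row2[of 1 UNIV] by (auto simp: calibration_def)
  show "divergence (\<lambda>x. calibration x $ i) x = 0" for i x
    using exhaust_2[of i] divergence_row1[of x] divergence_row2[of x] by (auto simp: calibration_def)
  show "calibration x \<bullet> \<xi> \<le> qnorm \<xi>" if "x \<in> closure (ball 0 1)" for x \<xi>
    using that by (intro calibration_polar) simp
  show "calibration x \<bullet> (square_datum x \<otimes>\<^sub>v outer_unit_normal (ball 0 1) x) =
      qnorm (square_datum x \<otimes>\<^sub>v outer_unit_normal (ball 0 1) x)" if "x \<in> frontier (ball 0 1)" for x
    using that by (subst (1 2) \<nu>) (auto intro: calibration_boundary)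
  show "continuous_on (frontier (ball 0 1)) square_datum"
    by (rule C_on_imp_continuous_on[OF C_on_square_datum[of 1]])
  show "continuous_on (frontier (ball 0 1)) (outer_unit_normal (ball (0 :: real^2) 1))"
    using continuous_on_id by (rule continuous_on_eq) (simp add: \<nu>)
qed (simp_all add: recession_qnorm continuous_qnorm qnorm_diff_le continuous_calibration
    qnorm_bounds(2) qnorm_nonneg)

theorem theorem1p6:
  shows "\<exists>(f :: real^2^2 \<Rightarrow> real) (u0 :: real^2 \<Rightarrow> real^2).
    pos_homogeneous1 f \<and> (\<forall>\<xi>. f (- \<xi>) = f \<xi>) \<and> C_on \<infinity> (- {0}) f \<and>
    cond_a f \<and> cond_b f \<and> cond_c f \<and> cond_d f \<and> \<not> cond_e f \<and> cond_f f \<and> cond_g f \<and>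
    C_on \<infinity> (sphere 0 1) u0 \<and> (\<exists>x\<in>sphere 0 1. u0 x \<noteq> 0) \<and>
    BV_minimizer (ball 0 1) f u0 (\<lambda>x. 0) \<and>
    emeasure (hausdorff_measure 1) {x \<in> sphere 0 1. u0 x \<noteq> 0} > 0"
proof (intro exI[of _ qnorm] exI[of _ square_datum] conjI)
  have "{x \<in> sphere 0 1. square_datum x \<noteq> 0} = sphere 0 1" using square_datum_neq_0 by auto
  then show "emeasure (hausdorff_measure 1) {x \<in> sphere 0 1. square_datum x \<noteq> 0} > 0"
    using emeasure_circle_pos by simp
  have "axis 1 1 \<in> sphere (0 :: real^2) 1" "square_datum (axis 1 1) \<noteq> 0"
    using square_datum_neq_0[of "axis 1 1"] by simp_all
  then show "\<exists>x\<in>sphere 0 1. square_datum x \<noteq> 0" ..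
qed (auto simp: pos_homogeneous1_qnorm qnorm_uminus C_on_qnorm conditions_qnorm C_on_square_datum
    BV_minimizer_square_datum)

end
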